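(* For each $n \in \{6,7\}$ and every integer $k \ge 1$, $$GR_k(C_{2n+1}) = n\cdot 2^k + 1.$$
   Context: All graphs are finite and simple. $K_N$ denotes the complete graph on $N$ vertices and $C_m$ the cycle on $m$ vertices. A Gallai coloring of a complete graph is a coloring of its edges with no rainbow triangle, i.e. no triangle whose three edges have three pairwise different colors. A Gallai $k$-coloring is a Gallai coloring $c: E(K_N)\to\{1,\dots,k\}$ using colors from a set of $k$ colors (not every color is required to appear). For an integer $k\ge 1$ and a graph $H$, the Gallai-Ramsey number $GR_k(H)$ is the least positive integer $N$ such that every Gallai $k$-coloring of $K_N$ contains a monochromatic copy of $H$, i.e. a (not necessarily induced) subgraph isomorphic to $H$ all of whose edges have the same color. *)

theory Defs
  imports "HOL-Library.Ramsey" "HOL-Library.FuncSet"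
begin

record 'a graph =
  verts :: "'a set"
  edges :: "'a set set"

definition simple_graph :: "'a graph \<Rightarrow> bool" where
  "simple_graph G \<longleftrightarrow> finite (verts G) \<and> edges G \<subseteq> [verts G]\<^bsup>2\<^esup>"

definition subgraph :: "'a graph \<Rightarrow> 'a graph \<Rightarrow> bool" where
  "subgraph S G \<longleftrightarrow> simple_graph S \<and> verts S \<subseteq> verts G \<and> edges S \<subseteq> edges G"

definition graph_iso :: "'a graph \<Rightarrow> 'b graph \<Rightarrow> bool" where
  "graph_iso G H \<longleftrightarrow>
     (\<exists>f. bij_betw f (verts G) (verts H) \<and>
          (\<forall>x\<in>verts G. \<forall>y\<in>verts G. {x, y} \<in> edges G \<longleftrightarrow> {f x, f y} \<in> edges H))"

definition complete_graph :: "nat \<Rightarrow> nat graph" where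
  "complete_graph N = \<lparr>verts = {..<N}, edges = [{..<N}]\<^bsup>2\<^esup>\<rparr>"

text \<open>The definition describes a cycle only for \<open>m \<ge> 3\<close>.\<close>
definition cycle_graph :: "nat \<Rightarrow> nat graph" where
  "cycle_graph m = \<lparr>verts = {..<m}, edges = {{i, Suc i mod m} | i. i < m}\<rparr>"

definition rainbow_triangle :: "nat \<Rightarrow> (nat set \<Rightarrow> 'c) \<Rightarrow> nat \<Rightarrow> nat \<Rightarrow> nat \<Rightarrow> bool" where
  "rainbow_triangle N c x y z \<longleftrightarrow>
     {x, y} \<in> edges (complete_graph N) \<and> {y, z} \<in> edges (complete_graph N) \<and>
     {x, z} \<in> edges (complete_graph N) \<and>
     c {x, y} \<noteq> c {y, z} \<and> c {y, z} \<noteq> c {x, z} \<and> c {x, y} \<noteq> c {x, z}"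

text \<open>Only the values of \<open>c\<close> on the edges of the complete graph matter.\<close>
definition gallai_coloring :: "nat \<Rightarrow> nat \<Rightarrow> (nat set \<Rightarrow> nat) \<Rightarrow> bool" where
  "gallai_coloring k N c \<longleftrightarrow>
     c \<in> edges (complete_graph N) \<rightarrow> {1..k} \<and> \<not> (\<exists>x y z. rainbow_triangle N c x y z)"

definition has_monochromatic_copy :: "nat \<Rightarrow> (nat set \<Rightarrow> 'c) \<Rightarrow> 'a graph \<Rightarrow> bool" where
  "has_monochromatic_copy N c H \<longleftrightarrow>
     (\<exists>S. subgraph S (complete_graph N) \<and> graph_iso H S \<and> (\<exists>i. \<forall>e\<in>edges S. c e = i))"

definition gallai_ramsey_number :: "nat \<Rightarrow> 'a graph \<Rightarrow> nat" (\<open>GR\<close>) where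
  "GR k H = (LEAST N. N > 0 \<and> (\<forall>c. gallai_coloring k N c \<longrightarrow> has_monochromatic_copy N c H))"

lemma simple_complete_graph: "simple_graph (complete_graph N)"
  by (simp add: simple_graph_def complete_graph_def)

lemma simple_cycle_graph:
  assumes "m \<ge> 2"
  shows "simple_graph (cycle_graph m)"
proof -
  have "i \<noteq> Suc i mod m" if "i < m" for i
    using that assms by (cases "Suc i = m") auto
  then show ?thesis
    using assms by (auto simp: simple_graph_def cycle_graph_def)
qed

text \<open>By Ramsey's theorem the minimum in the definition of \<open>GR\<close> is over a nonempty set.\<close>
lemma gallai_ramsey_number_exists:
  assumes H: "simple_graph H" and "k \<ge> 1"
  shows "\<exists>N>0. \<forall>c. gallai_coloring k N c \<longrightarrow> has_monochromatic_copy N c H"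
proof -
  define m where "m = card (verts H)"
  obtain N0 :: nat where N0: "partn_lst {..<N0} (replicate k m) 2"
    using ramsey_full [of "replicate k m" 2] by blast
  define N where "N = Suc N0"
  have N: "partn_lst {..<N} (replicate k m) 2"
    using partn_lst_greater_resource [OF N0] by (simp add: N_def)
  have "has_monochromatic_copy N c H" if c: "gallai_coloring k N c" for c
  proof -
    have c': "c \<in> [{..<N}]\<^bsup>2\<^esup> \<rightarrow> {1..k}"
      using c by (simp add: gallai_coloring_def complete_graph_def)
    have "(\<lambda>e. c e - 1) \<in> [{..<N}]\<^bsup>2\<^esup> \<rightarrow> {..<length (replicate k m)}"
    proof
      fix e assume "e \<in> [{..<N}]\<^bsup>2\<^esup>"
      then have "c e \<in> {1..k}" using c' by blast
      then show "c e - 1 \<in> {..<length (replicate k m)}" by auto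
    qed
    then obtain i where i: "i < k" and
      "monochromatic {..<N} (replicate k m ! i) 2 (\<lambda>e. c e - 1) i"
      using N unfolding partn_lst_def by fastforce
    then obtain U where U: "U \<in> [{..<N}]\<^bsup>m\<^esup>"
      and mono: "(\<lambda>e. c e - 1) ` [U]\<^bsup>2\<^esup> \<subseteq> {i}"
      by (auto simp: monochromatic_def)
    have U': "U \<subseteq> {..<N}" "finite U" "card U = m"
      using U by (auto simp: nsets_def)
    obtain f where f: "bij_betw f (verts H) U"
      using H U' by (metis finite_same_card_bij m_def simple_graph_def)
    have inj: "inj_on f (verts H)" and im: "f ` verts H = U"
      using f by (auto simp: bij_betw_def)
    define S where "S = \<lparr>verts = U, edges = (`) f ` edges H\<rparr>"
    have esub: "e \<subseteq> verts H" if "e \<in> edges H" for e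
      using that H by (auto simp: simple_graph_def nsets_def)
    have edgesS: "edges S \<subseteq> [U]\<^bsup>2\<^esup>"
    proof
      fix e assume "e \<in> edges S"
      then obtain d where d: "d \<in> edges H" "e = f ` d" by (auto simp: S_def)
      then have "d \<in> [verts H]\<^bsup>2\<^esup>" using H by (auto simp: simple_graph_def)
      then show "e \<in> [U]\<^bsup>2\<^esup>"
        using d(2) inj im by (auto simp: nsets_def card_image inj_on_subset)
    qed
    have "subgraph S (complete_graph N)"
      using edgesS U' nsets_mono [OF U'(1), of 2]
      by (auto simp: subgraph_def simple_graph_def complete_graph_def S_def)
    moreover have "graph_iso H S"
    proof -
      have "{x, y} \<in> edges H \<longleftrightarrow> {f x, f y} \<in> edges S" if xy: "x \<in> verts H" "y \<in> verts H" for x y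
      proof
        assume "{x, y} \<in> edges H"
        then show "{f x, f y} \<in> edges S"
          by (metis (no_types, lifting) S_def graph.select_convs(2) image_eqI image_empty image_insert)
      next
        assume "{f x, f y} \<in> edges S"
        then obtain d where d: "d \<in> edges H" "f ` {x, y} = f ` d" by (auto simp: S_def)
        then have "{x, y} = d"
          using inj_on_image_eq_iff [OF inj, of "{x, y}" d] xy esub by auto
        then show "{x, y} \<in> edges H" using d by simp
      qed
      then show ?thesis
        using f by (auto simp: graph_iso_def S_def)
    qed
    moreover have "\<forall>e\<in>edges S. c e = Suc i"
    proof
      fix e assume "e \<in> edges S"
      then have e: "e \<in> [U]\<^bsup>2\<^esup>" using edgesS by blast
      then have "c e - 1 = i" using mono by auto
      moreover have "c e \<ge> 1" using e nsets_mono [OF U'(1), of 2] c' by fastforce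
      ultimately show "c e = Suc i" by simp
    qed
    ultimately show ?thesis
      unfolding has_monochromatic_copy_def by blast
  qed
  then show ?thesis
    by (auto simp: N_def)
qed

end

theory Submission
  imports Defs "HOL-Number_Theory.Cong"
begin

text \<open>
  Write \<open>m = 2 n + 1\<close>. For the lower bound, a clique on \<open>2 n\<close> vertices is doubled \<open>k - 1\<close> times,
  each time with a new colour between the two copies. The upper bound is an induction on \<open>k\<close>.

  For \<open>k = 2\<close>, the theorem of Erdos and Gallai on the circumference provides a monochromatic
  cycle of length at least \<open>m\<close> on \<open>4 n + 1\<close> vertices. A shortest one that is longer than \<open>m\<close> has even
  length, and its two parity classes are cliques in the other colour; these extend to a
  monochromatic cycle of length \<open>m\<close>.

  For \<open>k \<ge> 3\<close>, take a smallest module \<open>A\<close> to which each colour attaches at most \<open>n\<close> of the outside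
  vertices, and a Gallai partition of \<open>A\<close>, with colours red and blue between the parts. Two
  parts with more than \<open>n\<close> vertices miss a colour each, since a complete bipartite graph with an
  additional edge contains a cycle of length \<open>m\<close>; attached vertices are recoloured and counted by
  the induction hypothesis together with the part they are attached to. A single such part contradicts
  minimality or leaves few other vertices. If there is no such part, then there is a red-blue colouring
  of a complete multipartite graph with small classes of twins on at least \<open>7 n + 1\<close> vertices,
  which is completed to a colouring of a complete graph by separating one twin after the other.
\<close>

section \<open>Cycles in complete bipartite and multipartite graphs\<close>

text \<open>A complete bipartite graph has no odd cycle; a cycle of length \<open>2 n + 1\<close>
  appears once a side of \<open>n + 1\<close> vertices contains an edge, or a vertex sees both sides
  of size \<open>n\<close>. Hence \<open>n\<close> is the limit both for attached sets and for
  parts. Counting alone fails when one huge part has at most \<open>n\<close> vertices on its red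
  and on its blue side. Such a part is itself a module of the required kind, and this is why a
  smallest module replaces \<open>V\<close>. When all parts are small, edges inside parts may have
  third colours, so the two-colour theorem on complete graphs does not apply directly. The number
  \<open>7 n + 1\<close> is what is left of \<open>8 n + 1\<close> for \<open>k = 3\<close> after
  removing \<open>n\<close> vertices attached in the third colour. It is also what the twin argument
  consumes: at most \<open>n\<close> vertices in the class of a vertex, \<open>3 n + 1\<close>
  neighbours in one colour among the other \<open>6 n + 1\<close>, at most \<open>n\<close> of these
  on a cycle of length \<open>2 n\<close>, and \<open>2 n + 1\<close> outside it, which force an
  edge of this colour among them. For \<open>n = 6\<close> and \<open>n = 7\<close> the concluding
  cycle is then written out vertex by vertex.\<close>

text \<open>The definition describes a cycle only for \<open>m \<ge> 3\<close>.\<close>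

definition has_cycle :: "('a \<Rightarrow> 'a \<Rightarrow> bool) \<Rightarrow> 'a set \<Rightarrow> nat \<Rightarrow> bool" where
  "has_cycle R V m \<longleftrightarrow> (\<exists>xs. length xs = m \<and> distinct xs \<and> set xs \<subseteq> V \<and>
     successively R xs \<and> R (last xs) (hd xs))"

lemma has_cycleI:
  assumes "length xs = m" "distinct xs" "set xs \<subseteq> V" "successively R xs" "R (last xs) (hd xs)"
  shows "has_cycle R V m"
  using assms unfolding has_cycle_def by blast

lemma has_cycle_mono:
  assumes "has_cycle R V m" "V \<subseteq> W" "m > 0"
    and "\<And>x y. x \<in> V \<Longrightarrow> y \<in> V \<Longrightarrow> R x y \<Longrightarrow> S x y"
  shows "has_cycle S W m"
proof -
  obtain xs where xs: "length xs = m" "distinct xs" "set xs \<subseteq> V" "successively R xs" "R (last xs) (hd xs)"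
    using assms(1) unfolding has_cycle_def by blast
  have "xs \<noteq> []" using xs(1) assms(3) by auto
  then have "S (last xs) (hd xs)"
    using assms(4) xs(3,5) by (meson hd_in_set last_in_set subset_iff)
  moreover have "successively S xs"
    using successively_mono[OF xs(4)] assms(4) xs(3) by (metis subset_iff)
  ultimately show ?thesis using xs assms(2) by (intro has_cycleI[of xs]) auto
qed

lemma has_cycle_conjD:
  assumes "has_cycle (\<lambda>x y. P x y \<and> Q x y) V m" "m > 0"
  shows "has_cycle Q V m"
  by (rule has_cycle_mono[OF assms(1) subset_refl assms(2)]) blast

lemma successively_upt:
  assumes "\<And>i. a \<le> i \<Longrightarrow> Suc i < b \<Longrightarrow> P i (Suc i)"
  shows "successively P [a..<b]"
  using assms
proof (induction b)
  case (Suc b)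
  then show ?case
    by (cases b) (auto simp: successively_append_iff)
qed simp

text \<open>Both ends are prescribed so that the path can be closed through outside vertices. The
  induction peels off \<open>x\<close> and a vertex of \<open>Y\<close> other than \<open>y\<close>,
  which keeps the last vertex available.\<close>

lemma alternating_path:
  assumes "finite X" "finite Y" "X \<inter> Y = {}"
    and "\<And>x y. x \<in> X \<Longrightarrow> y \<in> Y \<Longrightarrow> R x y \<and> R y x"
    and "x \<in> X" "y \<in> Y" "1 \<le> k" "k \<le> card X" "k \<le> card Y"
  shows "\<exists>xs. length xs = 2 * k \<and> distinct xs \<and> set xs \<subseteq> X \<union> Y \<and> successively R xs \<and>
           hd xs = x \<and> last xs = y"
  using assms
proof (induction k arbitrary: X Y x)
  case 0
  then show ?case by simp
next
  case (Suc k)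
  show ?case
  proof (cases "k = 0")
    case True
    then show ?thesis using Suc.prems by (intro exI[of _ "[x, y]"]) auto
  next
    case False
    have "card (X - {x}) \<ge> k" "card (Y - {y}) \<ge> k" using Suc.prems by auto
    then have "X - {x} \<noteq> {}" "Y - {y} \<noteq> {}" using False by (metis card.empty le_zero_eq)+
    then obtain x1 y1 where x1: "x1 \<in> X" "x1 \<noteq> x" and y1: "y1 \<in> Y" "y1 \<noteq> y" by blast
    have "\<exists>xs. length xs = 2 * k \<and> distinct xs \<and> set xs \<subseteq> (X - {x}) \<union> (Y - {y1}) \<and>
        successively R xs \<and> hd xs = x1 \<and> last xs = y"
      using Suc.prems x1 y1 False
      by (intro Suc.IH) auto
    then obtain xs where xs: "length xs = 2 * k" "distinct xs" "set xs \<subseteq> (X - {x}) \<union> (Y - {y1})"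
      "successively R xs" "hd xs = x1" "last xs = y" by blast
    have ne: "xs \<noteq> []" using xs(1) False by auto
    have "R x y1" "R y1 x1" using Suc.prems x1 y1 by auto
    then show ?thesis using xs ne Suc.prems x1 y1
      by (intro exI[of _ "x # y1 # xs"]) (auto simp: successively_Cons)
  qed
qed

lemma bipartite_apex_cycle:
  assumes "finite X" "finite Y" "X \<inter> Y = {}"
    and "\<And>x y. x \<in> X \<Longrightarrow> y \<in> Y \<Longrightarrow> R x y \<and> R y x"
    and "x \<in> X" "y \<in> Y" "1 \<le> n" "n \<le> card X" "n \<le> card Y"
    and "v \<notin> X" "v \<notin> Y" "R v x" "R y v"
  shows "has_cycle R (insert v (X \<union> Y)) (2 * n + 1)"
proof -
  obtain xs where xs: "length xs = 2 * n" "distinct xs" "set xs \<subseteq> X \<union> Y" "successively R xs"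
     "hd xs = x" "last xs = y"
    using alternating_path[of X Y R x y n, OF assms(1-9)] by blast
  have "xs \<noteq> []" using xs(1) assms(7) by auto
  then show ?thesis using xs assms
    by (intro has_cycleI[of "v # xs"]) (auto simp: successively_Cons)
qed

text \<open>\<open>u\<close> serves as the apex over \<open>X - {u}\<close> and \<open>Y\<close>: it
  sees \<open>v\<close> on its own side and all of \<open>Y\<close>.\<close>

lemma bipartite_edge_cycle:
  assumes "finite X" "finite Y" "X \<inter> Y = {}"
    and "\<And>x y. x \<in> X \<Longrightarrow> y \<in> Y \<Longrightarrow> R x y \<and> R y x"
    and "1 \<le> n" "n + 1 \<le> card X" "n \<le> card Y"
    and "u \<in> X" "v \<in> X" "u \<noteq> v" "R u v"
  shows "has_cycle R (X \<union> Y) (2 * n + 1)"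
proof -
  obtain y where y: "y \<in> Y" using assms(5,7) by (metis all_not_in_conv card.empty le_zero_eq not_one_le_zero)
  have "has_cycle R (insert u ((X - {u}) \<union> Y)) (2 * n + 1)"
    using assms y by (intro bipartite_apex_cycle[of _ _ _ v y]) auto
  moreover have "insert u ((X - {u}) \<union> Y) = X \<union> Y" using assms(8) by blast
  ultimately show ?thesis by simp
qed

text \<open>Three extra vertices take the place of one apex, so \<open>n - 1\<close> from each side
  suffice: \<open>3 + 2 * (n - 1) = 2 * n + 1\<close>.\<close>

lemma bipartite_detour_cycle:
  assumes "finite X" "finite Y" "X \<inter> Y = {}"
    and "\<And>x y. x \<in> X \<Longrightarrow> y \<in> Y \<Longrightarrow> R x y \<and> R y x"
    and "x \<in> X" "y \<in> Y" "2 \<le> n" "n - 1 \<le> card X" "n - 1 \<le> card Y"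
    and "distinct [u, v, w]" "{u, v, w} \<inter> (X \<union> Y) = {}" "R u v" "R v w" "R w x" "R y u"
  shows "has_cycle R ({u, v, w} \<union> (X \<union> Y)) (2 * n + 1)"
proof -
  obtain xs where xs: "length xs = 2 * (n - 1)" "distinct xs" "set xs \<subseteq> X \<union> Y" "successively R xs"
     "hd xs = x" "last xs = y"
    using alternating_path[of X Y R x y "n - 1", OF assms(1-6) _ assms(8,9)] assms(7) by fastforce
  have "xs \<noteq> []" using xs(1) assms(7) by auto
  then show ?thesis using xs assms
    by (intro has_cycleI[of "u # v # w # xs"]) (auto simp: successively_Cons)
qed

text \<open>When the vertices are listed class by class, any two that are \<open>n\<close> or \<open>n + 1\<close> positions apart are
  adjacent, and stepping by \<open>n\<close> modulo \<open>2 n + 1\<close> visits them all.\<close>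

lemma multipartite_cycle:
  fixes f :: "'a \<Rightarrow> nat"
  assumes "finite W" "2 * n + 1 \<le> card W" "1 \<le> n"
    and R: "\<And>x y. x \<in> W \<Longrightarrow> y \<in> W \<Longrightarrow> f x \<noteq> f y \<Longrightarrow> R x y"
    and cls: "\<And>a. card {x \<in> W. f x = a} \<le> n"
  shows "has_cycle R W (2 * n + 1)"
proof -
  define m where "m = 2 * n + 1"
  obtain W0 where W0: "W0 \<subseteq> W" "card W0 = m" "finite W0"
    using assms(1,2) by (metis m_def obtain_subset_with_card_n)
  obtain xs where xs0: "set xs = W0" "distinct xs" using finite_distinct_list[OF W0(3)] by blast
  define vs where "vs = sort_key f xs"
  have vs: "set vs = W0" "distinct vs" "length vs = m" "sorted (map f vs)"
    using xs0 W0(2) by (auto simp: vs_def distinct_card)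
  have far: "R (vs ! i) (vs ! j)" if "i < m" "j < m" "i + n \<le> j \<or> j + n \<le> i" for i j
  proof -
    \<comment> \<open>Sorting makes the classes contiguous, so one class at both positions would
      fill at least \<open>n + 1\<close> positions.\<close>
    have ne: "f (vs ! i) \<noteq> f (vs ! j)" if ij: "i + n \<le> j" "j < m" for i j
    proof
      assume eq: "f (vs ! i) = f (vs ! j)"
      have "f (vs ! k) = f (vs ! i)" if "k \<in> {i..i+n}" for k
      proof -
        have "f (vs ! i) \<le> f (vs ! k)" "f (vs ! k) \<le> f (vs ! j)"
          using sorted_nth_mono[OF vs(4), of i k] sorted_nth_mono[OF vs(4), of k j] that ij vs(3) by auto
        then show ?thesis using eq by simp
      qed
      moreover have "vs ! k \<in> W" if "k \<in> {i..i+n}" for k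
      proof -
        have "k < length vs" using that ij vs(3) by auto
        then show ?thesis using vs(1) W0(1) nth_mem by blast
      qed
      ultimately have "(!) vs ` {i..i+n} \<subseteq> {x \<in> W. f x = f (vs ! i)}" by blast
      moreover have "inj_on ((!) vs) {i..i+n}"
        using vs(2,3) ij by (intro inj_on_nth) auto
      ultimately have "card {i..i+n} \<le> card {x \<in> W. f x = f (vs ! i)}"
        using assms(1) card_inj_on_le[of "(!) vs" "{i..i+n}" "{x \<in> W. f x = f (vs ! i)}"] by simp
      then show False using cls[of "f (vs ! i)"] by simp
    qed
    have "vs ! i \<in> W" "vs ! j \<in> W" using that vs(1,3) W0(1) by auto
    then show ?thesis using R ne[of i j] ne[of j i] that by metis
  qed
  define p where "p j = j * n mod m" for j
  have p: "p j < m" for j by (simp add: p_def m_def)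
  \<comment> \<open>Modulo \<open>2 n + 1\<close>, a step by \<open>n\<close> moves forward by
    \<open>n\<close> or wraps to a position \<open>n + 1\<close> lower.\<close>
  have step: "p (Suc j) = p j + n \<or> p j = p (Suc j) + n + 1" for j
  proof -
    have "p (Suc j) = (p j + n) mod m" by (simp add: p_def mod_simps add.commute)
    then show ?thesis using p[of j]
      by (cases "p j + n < m") (auto simp: mod_if m_def)
  qed
  have Rstep: "R (vs ! p j) (vs ! p (Suc j))" for j
    using far[of "p j" "p (Suc j)"] p step[of j] by auto
  have cop: "coprime n m"
    unfolding m_def by (rule coprimeI) (metis dvd_add_right_iff dvd_mult)
  have inj: "inj_on p {..<m}"
  proof (rule inj_onI)
    fix i j assume ij: "i \<in> {..<m}" "j \<in> {..<m}" "p i = p j"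
    have "i = j" if "i \<le> j" "i < m" "j < m" "p i = p j" for i j
    proof -
      have "m dvd j * n - i * n" using that(1,4) unfolding p_def
        by (metis mod_eq_dvd_iff_nat mult_le_mono1)
      then have "m dvd (j - i) * n" by (simp add: diff_mult_distrib)
      then have "m dvd j - i" using cop by (simp add: coprime_commute coprime_dvd_mult_left_iff)
      then show "i = j" using that by (auto dest!: dvd_imp_le simp: not_less)
    qed
    from this[of i j] this[of j i] show "i = j" using ij by (cases "i \<le> j") auto
  qed
  define ys where "ys = map (\<lambda>j. vs ! p j) [0..<m]"
  have pm: "p m = 0" "p 0 = 0" by (auto simp: p_def)
  have mpos: "m > 0" by (simp add: m_def)
  have "distinct ys"
    using inj vs(2,3) p by (auto simp: ys_def distinct_map inj_on_def nth_eq_iff_index_eq atLeast0LessThan)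
  moreover have "successively R ys"
    unfolding ys_def successively_map using Rstep by (intro successively_upt) auto
  moreover have "R (last ys) (hd ys)"
  proof -
    have "last ys = vs ! p (m - 1)" "hd ys = vs ! p m"
      using mpos pm by (auto simp: ys_def last_map hd_map)
    then show ?thesis using Rstep[of "m - 1"] mpos by simp
  qed
  moreover have "set ys \<subseteq> W" using p vs(1,3) W0(1) by (auto simp: ys_def subset_iff)
  ultimately show ?thesis
    by (intro has_cycleI[of ys]) (auto simp: ys_def m_def)
qed

section \<open>Circumference\<close>

lemma sum_card_swap:
  assumes "finite A" "finite B"
  shows "(\<Sum>x\<in>A. card {y \<in> B. R x y}) = (\<Sum>y\<in>B. card {x \<in> A. R x y})"
proof -
  have "(\<Sum>x\<in>A. card {y \<in> B. R x y}) = (\<Sum>x\<in>A. \<Sum>y\<in>B. if R x y then 1 else 0)"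
    using assms by (intro sum.cong) (auto simp flip: sum.inter_filter)
  also have "\<dots> = (\<Sum>y\<in>B. \<Sum>x\<in>A. if R x y then 1 else 0)"
    by (rule sum.swap)
  also have "\<dots> = (\<Sum>y\<in>B. card {x \<in> A. R x y})"
    using assms by (intro sum.cong) (auto simp flip: sum.inter_filter)
  finally show ?thesis .
qed

text \<open>Among the longest paths, choose one whose first vertex has the largest degree \<open>d\<close>. The
  predecessors of its neighbours are first vertices of longest paths as well, so that they have degree
  at most \<open>d\<close> and all their neighbours among the first \<open>c\<close> vertices of the path. Deleting these \<open>d\<close> vertices
  destroys at most \<open>c d / 2\<close> edges.\<close>

lemma erdos_gallai_circumference:
  assumes "finite V" "V \<noteq> {}" "2 \<le> c"
    and sym: "\<And>x y. x \<in> V \<Longrightarrow> y \<in> V \<Longrightarrow> R x y \<Longrightarrow> R y x"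
    and irr: "\<And>x. x \<in> V \<Longrightarrow> \<not> R x x"
    and nocyc: "\<And>m. c < m \<Longrightarrow> \<not> has_cycle R V m"
  shows "(\<Sum>x\<in>V. card {y \<in> V. R x y}) \<le> c * (card V - 1)"
  using assms
proof (induction V rule: finite_psubset_induct)
  case (psubset V)
  note fin = psubset.hyps and sym = psubset.prems(3) and irr = psubset.prems(4)
    and nocyc = psubset.prems(5)
  show ?case
  proof (cases "\<exists>a\<in>V. \<exists>b\<in>V. R a b")
    case False
    then have "(\<Sum>x\<in>V. card {y \<in> V. R x y}) = (\<Sum>x\<in>V. 0)"
      by (intro sum.cong) (auto simp: card_eq_0_iff)
    then show ?thesis by simp
  next
    case True
    then obtain a b where ab: "a \<in> V" "b \<in> V" "R a b" by blast
    define deg where "deg x = card {y \<in> V. R x y}" for x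
    have degle: "deg x \<le> card V" for x
      unfolding deg_def using fin by (intro card_mono) auto
    define P where "P xs \<longleftrightarrow> xs \<noteq> [] \<and> distinct xs \<and> set xs \<subseteq> V \<and> successively R xs" for xs
    \<comment> \<open>The factor makes one more vertex outweigh any degree: length is maximised
      first, then the degree of the head.\<close>
    define \<mu> where "\<mu> xs = length xs * (card V + 1) + deg (hd xs)" for xs
    have lenP: "length xs \<le> card V" if "P xs" for xs
      using that fin card_mono[of V "set xs"] by (auto simp: P_def distinct_card)
    have bound: "\<mu> xs \<le> card V * (card V + 1) + card V" if "P xs" for xs
      unfolding \<mu>_def using lenP[OF that] degle by (intro add_mono mult_le_mono1) auto
    have Pab: "P [a, b]" using ab irr by (auto simp: P_def)
    obtain xs where xs: "P xs" and max: "\<And>ys. P ys \<Longrightarrow> \<mu> ys \<le> \<mu> xs"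
      using Lattices_Big.ex_has_greatest_nat[of P "[a, b]" \<mu> "Suc (card V * (card V + 1) + card V)"]
        Pab bound le_imp_less_Suc by blast
    have maxlen: "length ys \<le> length xs" if "P ys" for ys
    proof (rule ccontr)
      assume "\<not> length ys \<le> length xs"
      then have "(length xs + 1) * (card V + 1) \<le> length ys * (card V + 1)"
        by (intro mult_le_mono1) simp
      then have "\<mu> xs < \<mu> ys" using degle[of "hd xs"] by (simp add: \<mu>_def)
      then show False using max[OF that] by simp
    qed
    have maxdeg: "deg (hd ys) \<le> deg (hd xs)" if "P ys" "length ys = length xs" for ys
      using max[OF that(1)] that(2) by (simp add: \<mu>_def)
    have len2: "2 \<le> length xs" using maxlen[OF Pab] by simp
    have nbr: "y \<in> set (take c ys)" if ys: "P ys" "length ys = length xs" and y: "y \<in> V" "R (hd ys) y" for ys y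
    proof -
      have hdV: "hd ys \<in> V" using ys(1) by (auto simp: P_def)
      have "R y (hd ys)" using sym hdV y by blast
      have "y \<in> set ys"
      proof (rule ccontr)
        assume "y \<notin> set ys"
        then have "P (y # ys)" using ys(1) y \<open>R y (hd ys)\<close> by (auto simp: P_def successively_Cons)
        then show False using maxlen[of "y # ys"] ys(2) by simp
      qed
      then obtain i where i: "i < length ys" "y = ys ! i" by (metis in_set_conv_nth)
      \<comment> \<open>Otherwise the initial segment up to \<open>y\<close> closes to a cycle with
        more than \<open>c\<close> vertices.\<close>
      have "i < c"
      proof (rule ccontr)
        assume "\<not> i < c"
        define zs where "zs = take (Suc i) ys"
        have ap: "ys = zs @ drop (Suc i) ys" by (simp add: zs_def)
        have "successively R ys" using ys(1) by (simp add: P_def)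
        then have "successively R zs" using ap by (metis successively_append_iff)
        moreover have "last zs = y" "hd zs = hd ys" "length zs = Suc i"
          using i by (auto simp: zs_def take_Suc_conv_app_nth hd_append hd_conv_nth)
        moreover have "distinct zs" "set zs \<subseteq> V"
          using ys(1) by (auto simp: zs_def P_def dest: in_set_takeD)
        ultimately have "has_cycle R V (Suc i)" using \<open>R y (hd ys)\<close> by (intro has_cycleI[of zs]) auto
        then show False using nocyc \<open>\<not> i < c\<close> by simp
      qed
      then show ?thesis using i by (auto simp: in_set_conv_nth)
    qed
    define x0 where "x0 = hd xs"
    have x0: "x0 = xs ! 0" "x0 \<in> V" using xs by (auto simp: x0_def P_def hd_conv_nth)
    define J where "J = {j. j < length xs \<and> R x0 (xs ! j)}"
    define U where "U = (\<lambda>j. xs ! (j - 1)) ` J"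
    define M where "M = set (take c xs)"
    define d where "d = deg x0"
    have dxs: "distinct xs" "set xs \<subseteq> V" "successively R xs" using xs by (auto simp: P_def)
    have Jpos: "j \<ge> 1" if "j \<in> J" for j
      using that irr[OF x0(2)] x0(1) by (cases j) (auto simp: J_def)
    have Jc: "j < c" if "j \<in> J" for j
    proof -
      have j: "j < length xs" "R x0 (xs ! j)" using that by (auto simp: J_def)
      then have "xs ! j \<in> V" using dxs(2) by auto
      then have "xs ! j \<in> set (take c xs)" using nbr[OF xs refl, of "xs ! j"] j(2) by (simp add: x0_def)
      then obtain i where "i < c" "i < length xs" "xs ! j = xs ! i" by (auto simp: in_set_conv_nth)
      then show ?thesis using dxs(1) j(1) by (simp add: nth_eq_iff_index_eq)
    qed
    have finJ: "finite J" by (simp add: J_def)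
    have cardJ: "card J = d"
    proof -
      have "(!) xs ` J = {y \<in> V. R x0 y}"
      proof
        show "(!) xs ` J \<subseteq> {y \<in> V. R x0 y}" using dxs(2) by (auto simp: J_def)
        show "{y \<in> V. R x0 y} \<subseteq> (!) xs ` J"
        proof
          fix y assume "y \<in> {y \<in> V. R x0 y}"
          then have "y \<in> set xs" "R x0 y" using nbr[OF xs refl, of y] by (auto simp: x0_def dest: in_set_takeD)
          then show "y \<in> (!) xs ` J" by (auto simp: J_def in_set_conv_nth)
        qed
      qed
      moreover have "inj_on ((!) xs) J" using dxs(1) by (intro inj_on_nth) (auto simp: J_def)
      ultimately show ?thesis by (metis card_image d_def deg_def)
    qed
    have cardU: "card U = d"
    proof -
      have "inj_on (\<lambda>j. xs ! (j - 1)) J"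
      proof (rule inj_onI)
        fix i j assume ij: "i \<in> J" "j \<in> J" "xs ! (i - 1) = xs ! (j - 1)"
        then have "i - 1 = j - 1" using dxs(1) by (auto simp: nth_eq_iff_index_eq J_def)
        then show "i = j" using Jpos[OF ij(1)] Jpos[OF ij(2)] by simp
      qed
      then show ?thesis using cardJ by (simp add: U_def card_image)
    qed
    have rot: "deg u \<le> d \<and> {y \<in> V. R u y} \<subseteq> M \<and> u \<in> M" if uU: "u \<in> U" for u
    proof -
      obtain j where j: "j \<in> J" "u = xs ! (j - 1)" using uU unfolding U_def by blast
      have jl: "j < length xs" "R x0 (xs ! j)" "j \<ge> 1" "j < c"
        using j(1) Jpos Jc by (auto simp: J_def)
      \<comment> \<open>Rotation: the edge from \<open>x0\<close> to \<open>xs ! j\<close> allows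
        the first \<open>j\<close> vertices to be reversed, and the new path starts at the
        predecessor \<open>u\<close>. As \<open>j < c\<close>, its first \<open>c\<close> vertices
        form the same set \<open>M\<close>.\<close>
      define ys where "ys = rev (take j xs) @ drop j xs"
      have s: "successively R (take j xs)" "successively R (drop j xs)"
        using dxs(3) append_take_drop_id[of j xs] successively_append_iff[of R "take j xs" "drop j xs"] by auto
      have "successively (\<lambda>x y. R y x) (take j xs)"
        by (rule successively_mono[OF s(1)]) (meson sym dxs(2) in_set_takeD subsetD)
      moreover have "last (take j xs) = xs ! (j - 1)"
        using jl by (subst last_conv_nth) auto
      then have "last (rev (take j xs)) = x0" "hd (drop j xs) = xs ! j" "hd (rev (take j xs)) = u"
        using jl j(2) by (auto simp: last_rev hd_rev hd_drop_conv_nth last_conv_nth x0_def min_def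
            simp del: length_greater_0_conv)
      moreover have ne: "rev (take j xs) \<noteq> []" "drop j xs \<noteq> []" using jl by auto
      ultimately have succ: "successively R ys" "hd ys = u"
        using s(2) jl(2) by (auto simp: ys_def successively_append_iff)
      have setys: "set ys = set xs" 
        unfolding ys_def by (metis append_take_drop_id set_append set_rev)
      have "length ys = length xs" using jl by (simp add: ys_def)
      then have dys: "distinct ys" using setys dxs(1) by (metis card_distinct distinct_card)
      have "ys \<noteq> []" using ne by (simp add: ys_def)
      then have Py: "P ys" "length ys = length xs"
        using succ dys setys dxs \<open>length ys = length xs\<close> by (auto simp: P_def)
      have "take c ys = rev (take j xs) @ take (c - j) (drop j xs)"
        using jl by (simp add: ys_def)
      then have "set (take c ys) = set (take j xs @ take (c - j) (drop j xs))" by simp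
      also have "\<dots> = M" using jl(4) by (simp add: M_def flip: take_add)
      finally have M: "set (take c ys) = M" .
      have "deg u \<le> d" using maxdeg[OF Py] succ(2) by (simp add: d_def x0_def)
      moreover have "{y \<in> V. R u y} \<subseteq> M" using nbr[OF Py] succ(2) M by auto
      moreover have "u \<in> M" using jl j(2) by (auto simp: M_def in_set_conv_nth intro!: exI[of _ "j - 1"])
      ultimately show ?thesis by blast
    qed
    have UV: "U \<subseteq> V" using rot dxs(2) by (auto simp: M_def dest!: in_set_takeD)
    have finU: "finite U" using finJ by (simp add: U_def)
    have finM: "finite M" by (simp add: M_def)
    have cardM: "card M \<le> c" by (metis M_def card_length length_take min.cobounded2 le_trans)
    have cardMU: "card (M - U) \<le> c - d"
      using rot finU cardM cardU by (subst card_Diff_subset) auto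
    have dc: "d \<le> c" using card_mono[OF finM, of U] rot cardM cardU by (metis le_trans subsetI)
    \<comment> \<open>The last vertex precedes nothing, so \<open>V - U\<close> is nonempty: the
      induction hypothesis applies and the truncated subtractions are exact.\<close>
    have last: "last xs \<in> V - U"
    proof -
      have "last xs \<noteq> xs ! (j - 1)" if "j \<in> J" for j
      proof -
        have "j - 1 < length xs - 1" using that Jpos[OF that] by (auto simp: J_def)
        moreover have "last xs = xs ! (length xs - 1)" using len2 by (intro last_conv_nth) auto
        ultimately show ?thesis using dxs(1) len2 nth_eq_iff_index_eq[OF dxs(1), of "length xs - 1" "j - 1"]
          by auto
      qed
      moreover have "last xs \<in> V" using dxs(2) xs by (auto simp: P_def)
      ultimately show ?thesis by (auto simp: U_def)
    qed
    have "J \<noteq> {}"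
    proof -
      have "R (xs ! 0) (xs ! 1)"
        using dxs(3) len2 by (cases xs rule: remdups_adj.cases) auto
      then have "1 \<in> J" using len2 x0(1) by (simp add: J_def)
      then show ?thesis by blast
    qed
    then have Une: "U \<noteq> {}" by (simp add: U_def)
    then have ps: "V - U \<subset> V" using UV by blast
    have IH: "(\<Sum>x\<in>V - U. card {y \<in> V - U. R x y}) \<le> c * (card (V - U) - 1)"
    proof (rule psubset.IH[OF ps])
      show "V - U \<noteq> {}" using last by blast
      show "\<not> has_cycle R (V - U) m" if "c < m" for m
        using nocyc[OF that] has_cycle_mono[of R "V - U" m V R] that by auto
    qed (use sym irr psubset.prems(2) in auto)
    have cV: "card (V - U) = card V - d" using cardU UV finU by (simp add: card_Diff_subset)
    have cVpos: "card (V - U) \<ge> 1" using last fin by (metis One_nat_def Suc_leI card_gt_0_iff empty_iff finite_Diff)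
    have split: "card {y \<in> V. R x y} = card {y \<in> V - U. R x y} + card {y \<in> U. R x y}" for x
    proof -
      have "{y \<in> V. R x y} = {y \<in> V - U. R x y} \<union> {y \<in> U. R x y}" using UV by blast
      then show ?thesis using fin finU by (simp add: card_Un_disjoint disjoint_iff)
    qed
    \<comment> \<open>The degrees in \<open>U\<close> contribute at most \<open>d * d\<close>; the
      pairs entering \<open>U\<close> from outside start in \<open>M - U\<close> and contribute at
      most \<open>d * (c - d)\<close>. The total \<open>c * d\<close> is exactly what
      \<open>d\<close> fewer vertices take from the bound.\<close>
    have "(\<Sum>x\<in>V. card {y \<in> V. R x y}) = (\<Sum>x\<in>V - U. card {y \<in> V. R x y}) + (\<Sum>x\<in>U. deg x)"
      using UV fin by (simp add: sum.subset_diff deg_def)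
    also have "(\<Sum>x\<in>V - U. card {y \<in> V. R x y})
        = (\<Sum>x\<in>V - U. card {y \<in> V - U. R x y}) + (\<Sum>x\<in>V - U. card {y \<in> U. R x y})"
      by (simp add: split sum.distrib)
    also have "(\<Sum>x\<in>V - U. card {y \<in> U. R x y}) = (\<Sum>y\<in>U. card {x \<in> V - U. R x y})"
      using fin finU by (intro sum_card_swap) auto
    also have "\<dots> \<le> (\<Sum>y\<in>U. c - d)"
    proof (rule sum_mono)
      fix y assume "y \<in> U"
      then have "{x \<in> V - U. R x y} \<subseteq> M - U" using rot[of y] sym UV by blast
      then show "card {x \<in> V - U. R x y} \<le> c - d" using cardMU finM
        by (meson card_mono finite_Diff le_trans)
    qed
    also have "(\<Sum>x\<in>U. deg x) \<le> (\<Sum>x\<in>U. d)" using rot by (intro sum_mono) auto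
    finally have "(\<Sum>x\<in>V. card {y \<in> V. R x y})
       \<le> c * (card V - d - 1) + d * (c - d) + d * d"
      using IH cV cardU by simp
    also have "\<dots> = c * (card V - d - 1) + d * (c - d + d)"
      by (simp only: add_mult_distrib2 add.assoc)
    also have "\<dots> = c * (card V - d - 1 + d)"
      using dc by (simp add: add_mult_distrib2 mult.commute)
    also have "card V - d - 1 + d = card V - 1"
      using cVpos cV by simp
    finally show ?thesis .
  qed
qed

section \<open>Two colours\<close>

text \<open>Indexing by all natural numbers turns a rotation into a shift of the argument and lets
  chords be written without reducing indices modulo \<open>L\<close>.\<close>

definition periodic_cycle :: "('a \<Rightarrow> 'a \<Rightarrow> bool) \<Rightarrow> (nat \<Rightarrow> 'a) \<Rightarrow> nat \<Rightarrow> bool" where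
  "periodic_cycle R x L \<longleftrightarrow>
     (\<forall>i. x (i + L) = x i) \<and> inj_on x {..<L} \<and> (\<forall>i. R (x i) (x (Suc i)))"

lemma has_cycle_periodic:
  assumes "has_cycle R V L" "L > 0"
  obtains x where "periodic_cycle R x L" "range x \<subseteq> V"
proof -
  obtain xs where xs: "length xs = L" "distinct xs" "set xs \<subseteq> V" "successively R xs" "R (last xs) (hd xs)"
    using assms(1) unfolding has_cycle_def by blast
  have step: "R (xs ! i) (xs ! Suc i)" if "Suc i < L" for i
    using xs(4) that unfolding xs(1)[symmetric]
  proof (induction xs arbitrary: i rule: induct_list012)
    case (3 a b zs)
    then show ?case by (cases i) auto
  qed auto
  define x where "x i = xs ! (i mod L)" for i
  have "R (x i) (x (Suc i))" for i
  proof (cases "Suc (i mod L) = L")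
    case True
    then have "i mod L = L - 1" "Suc i mod L = 0" by (auto simp: mod_Suc)
    moreover have "xs \<noteq> []" using xs(1) assms(2) by auto
    ultimately have "x i = last xs" "x (Suc i) = hd xs"
      using xs(1) by (auto simp: x_def last_conv_nth hd_conv_nth)
    then show ?thesis using xs(5) by simp
  next
    case False
    then have "Suc (i mod L) < L" using assms(2) by (metis Suc_lessI mod_less_divisor)
    then show ?thesis using step by (auto simp: x_def mod_Suc)
  qed
  moreover have "inj_on x {..<L}"
    using xs(1,2) by (auto simp: x_def inj_on_def nth_eq_iff_index_eq)
  moreover have "range x \<subseteq> V" using xs(1,3) assms(2) by (auto simp: x_def)
  ultimately show ?thesis by (intro that[of x]) (auto simp: periodic_cycle_def x_def)
qed

lemma periodic_cycle_eq_iff: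
  assumes "periodic_cycle R x L" "L > 0"
  shows "x i = x j \<longleftrightarrow> i mod L = j mod L"
proof -
  have "x (i + L * k) = x i" for i k
  proof (induction k)
    case (Suc k)
    have "x (i + L * Suc k) = x ((i + L * k) + L)" by (simp add: algebra_simps)
    then show ?case using Suc assms(1) by (simp add: periodic_cycle_def)
  qed simp
  then have "x i = x (i mod L)" for i
    by (metis mod_mult_div_eq)
  moreover have "x (i mod L) = x (j mod L) \<longleftrightarrow> i mod L = j mod L"
    using assms by (auto simp: periodic_cycle_def inj_on_def)
  ultimately show ?thesis by metis
qed

lemma periodic_cycle_shift:
  assumes "periodic_cycle R x L" "L > 0"
  shows "periodic_cycle R (\<lambda>i. x (i + k)) L"
proof -
  have "i = j" if "i < L" "j < L" "x (i + k) = x (j + k)" for i j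
  proof -
    have "(i + k) mod L = (j + k) mod L" using that periodic_cycle_eq_iff[OF assms] by blast
    then have "[i = j] (mod L)" using cong_add_rcancel_nat[of i k j L] by (simp add: cong_def)
    then show ?thesis using that by (simp add: cong_def)
  qed
  moreover have "x (i + L + k) = x (i + k)" for i
    using assms(1) unfolding periodic_cycle_def by (metis add.assoc add.commute)
  ultimately show ?thesis using assms(1) by (auto simp: periodic_cycle_def inj_on_def)
qed

text \<open>New cycles on the vertices of an old one, in either colour, are given by index lists;
  distinctness and length then become arithmetic of intervals.\<close>

lemma periodic_cycle_subcycle:
  assumes "periodic_cycle R x L" "range x \<subseteq> V" "distinct is" "is \<noteq> []" "\<And>i. i \<in> set is \<Longrightarrow> i < L"
    and "successively (\<lambda>i j. Q (x i) (x j)) is" "Q (x (last is)) (x (hd is))" "m = length is"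
  shows "has_cycle Q V m"
proof (rule has_cycleI[of "map x is"])
  show "distinct (map x is)" 
    using assms(1,3,5) by (auto simp: distinct_map periodic_cycle_def intro: inj_on_subset)
qed (use assms in \<open>auto simp: successively_map last_map hd_map\<close>)

section \<open>Chords of a monochromatic cycle when no cycle is one vertex shorter\<close>

locale two_colour_complete =
  fixes V :: "'a set" and R S :: "'a \<Rightarrow> 'a \<Rightarrow> bool"
  assumes symR: "\<And>x y. R x y \<Longrightarrow> R y x"
    and symS: "\<And>x y. S x y \<Longrightarrow> S y x"
    and complete: "\<And>x y. x \<in> V \<Longrightarrow> y \<in> V \<Longrightarrow> x \<noteq> y \<Longrightarrow> R x y \<or> S x y"
begin

lemma swapped: "two_colour_complete V S R"
  using symR symS complete by unfold_locales blast+

lemma path_upt: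
  assumes "\<And>i. R (x i) (x (Suc i))"
  shows "successively (\<lambda>i j. R (x i) (x j)) [a..<b]"
    and "successively (\<lambda>i j. R (x j) (x i)) [a..<b]"
  using assms symR by (auto intro!: successively_upt)

text \<open>An \<open>R\<close>-chord of step two bypasses one vertex and would leave an
  \<open>R\<close>-cycle of length \<open>L - 1\<close>.\<close>

lemma step_two:
  assumes x: "periodic_cycle R x L" "range x \<subseteq> V" and "L \<ge> 4" and no: "\<not> has_cycle R V (L - 1)"
  shows "S (x i) (x (i + 2))"
proof -
  define y where "y j = x (j + i)" for j
  have y: "periodic_cycle R y L" "range y \<subseteq> V"
    using periodic_cycle_shift[OF x(1), of i] x(2) assms(3) by (auto simp: y_def [abs_def])
  have stepR: "R (y j) (y (Suc j))" for j using y(1) by (simp add: periodic_cycle_def)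
  have "y (0 + L) = y 0" using y(1) unfolding periodic_cycle_def by blast
  then have "y L = y 0" by simp
  have "\<not> R (y 0) (y 2)"
  proof
    assume "R (y 0) (y 2)"
    have "R (y (L - 1)) (y 0)"
      using stepR[of "L - 1"] \<open>y L = y 0\<close> assms(3) by simp
    have "has_cycle R V (L - 1)"
    proof (rule periodic_cycle_subcycle[OF y, of "[0] @ [2..<L]"])
      show "successively (\<lambda>i j. R (y i) (y j)) ([0] @ [2..<L])"
        using path_upt(1)[where x = y, OF stepR] \<open>R (y 0) (y 2)\<close> assms(3)
        by (simp add: successively_Cons)
      show "R (y (last ([0] @ [2..<L]))) (y (hd ([0] @ [2..<L])))"
        using \<open>R (y (L - 1)) (y 0)\<close> assms(3) by simp
    qed (use assms(3) in auto)
    then show False using no by simp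
  qed
  moreover have "y 0 \<noteq> y 2" using periodic_cycle_eq_iff[OF y(1), of 0 2] assms(3) by auto
  moreover have "y 0 \<in> V" "y 2 \<in> V" using y(2) by blast+
  ultimately have "S (y 0) (y 2)" using complete by blast
  then show ?thesis by (simp add: y_def add.commute)
qed

text \<open>In an odd cycle the chords of step two form a cycle of the other colour, whose own chords of
  step two have the first colour again; the walk \<open>0, 4, 5, 1, 2, 6\<close> then skips exactly one vertex.\<close>

lemma odd_cycle_descent:
  assumes x: "periodic_cycle R x L" "range x \<subseteq> V" and "odd L" "L \<ge> 7"
    and no: "\<not> has_cycle R V (L - 1)" "\<not> has_cycle S V (L - 1)"
  shows False
proof -
  have S2: "S (x i) (x (i + 2))" for i using step_two[OF x _ no(1)] assms(4) by simp
  \<comment> \<open>As \<open>L\<close> is odd, doubling permutes the residues modulo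
    \<open>L\<close>, so the chords of step two form a single cycle through all vertices.\<close>
  define y where "y i = x (2 * i)" for i
  have per: "x (i + L) = x i" for i using x(1) by (simp add: periodic_cycle_def)
  have per2: "x (i + 2 * L) = x i" for i using per[of "i + L"] per[of i] by (simp add: mult_2 add.assoc)
  have y: "periodic_cycle S y L" "range y \<subseteq> V"
  proof -
    have inj: "i = j" if ij: "i < L" "j < L" "y i = y j" for i j
    proof -
      have "(2 * i) mod L = (2 * j) mod L" 
        using ij periodic_cycle_eq_iff[OF x(1), of "2 * i" "2 * j"] assms(4) by (simp add: y_def)
      moreover have "coprime 2 L" using assms(3) by simp
      ultimately have "[i = j] (mod L)"
        using cong_mult_lcancel_nat[of 2 L i j] by (simp add: cong_def)
      then show ?thesis using ij by (simp add: cong_def)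
    qed
    have "S (y i) (y (Suc i))" for i using S2[of "2 * i"] by (simp add: y_def)
    moreover have "y (i + L) = y i" for i using per2[of "2 * i"] by (simp add: y_def add_mult_distrib2)
    moreover have "inj_on y {..<L}" using inj by (auto intro!: inj_onI)
    ultimately show "periodic_cycle S y L" by (simp add: periodic_cycle_def)
    show "range y \<subseteq> V" using x(2) by (auto simp: y_def)
  qed
  have R4even: "R (x (2 * i)) (x (2 * i + 4))" for i
  proof -
    have "y (i + 2) = x (2 * i + 4)" unfolding y_def by (rule arg_cong[of _ _ x]) simp
    moreover have "R (y i) (y (i + 2))"
      using two_colour_complete.step_two[OF swapped y _ no(2), of i] assms(4) by simp
    ultimately show ?thesis by (simp only: y_def)
  qed
  \<comment> \<open>For odd \<open>i\<close>, the index \<open>i + L\<close> is even and names the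
    same vertex.\<close>
  have R4: "R (x i) (x (i + 4))" for i
  proof (cases "even i")
    case True
    then show ?thesis using R4even[of "i div 2"] by simp
  next
    case False
    then have "2 * ((i + L) div 2) = i + L" using assms(3) by simp
    then have "R (x (i + L)) (x (i + 4 + L))" using R4even[of "(i + L) div 2"] by (simp add: algebra_simps)
    then show ?thesis using per by metis
  qed
  have stepR: "R (x j) (x (Suc j))" for j using x(1) by (simp add: periodic_cycle_def)
  have "x L = x 0" using per[of 0] by simp
  have last: "last ([0,4,5,1,2,6] @ [7..<L]) = L - 1" using assms(4) by (cases "L = 7") auto
  have "has_cycle R V (L - 1)"
  proof (rule periodic_cycle_subcycle[OF x, of "[0,4,5,1,2,6] @ [7..<L]"])
    show "successively (\<lambda>i j. R (x i) (x j)) ([0,4,5,1,2,6] @ [7..<L])"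
    proof -
      have "R (x 1) (x 2)" "R (x 6) (x 7)" "R (x 4) (x 5)"
        using stepR[of 1] stepR[of 4] stepR[of 6] by (simp_all add: eval_nat_numeral)
      moreover have "R (x 5) (x 1)" "R (x 2) (x 6)" "R (x 0) (x 4)"
        using R4[of 0] symR[OF R4[of 1]] R4[of 2] by simp_all
      ultimately show ?thesis using path_upt(1)[where x = x, OF stepR, of 7 L] assms(4)
        by (cases "L = 7") (auto simp: successively_Cons)
    qed
    show "R (x (last ([0,4,5,1,2,6] @ [7..<L]))) (x (hd ([0,4,5,1,2,6] @ [7..<L])))"
      unfolding last using stepR[of "L - 1"] \<open>x L = x 0\<close> assms(4) by simp
  qed (use assms(4) in auto)
  then show False using no by simp
qed

text \<open>Together with the chord, either of two further \<open>R\<close>-edges would give an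
  \<open>R\<close>-cycle missing one vertex. Both are therefore \<open>S\<close>-edges, and they
  link the step-two paths through the two parity classes to an \<open>S\<close>-cycle that misses
  only \<open>x 0\<close>.\<close>

lemma even_cycle_chord:
  assumes x: "periodic_cycle R x (2 * l)" "range x \<subseteq> V" and "2 \<le> s" "s + 2 \<le> l"
    and no: "\<not> has_cycle R V (2 * l - 1)" "\<not> has_cycle S V (2 * l - 1)"
  shows "\<not> R (x 0) (x (2 * s))"
proof
  assume chord: "R (x 0) (x (2 * s))"
  have S2: "S (x i) (x (i + 2))" for i using step_two[OF x _ no(1)] assms(3,4) by simp
  have stepR: "R (x j) (x (Suc j))" for j using x(1) by (simp add: periodic_cycle_def)
  have per: "x (i + 2 * l) = x i" for i using x(1) by (simp add: periodic_cycle_def)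
  have close: "R (x (2 * l - 1)) (x 0)" using stepR[of "2 * l - 1"] per[of 0] assms(3,4) by simp
  have ne: "x i \<noteq> x j" if "i < 2 * l" "j < 2 * l" "i \<noteq> j" for i j
    using that periodic_cycle_eq_iff[OF x(1), of i j] assms(3,4) by simp
  have inV: "x i \<in> V" for i using x(2) by blast
  \<comment> \<open>With this edge: \<open>0\<close>, then \<open>2 s\<close> down to
    \<open>2\<close>, then \<open>2 s + 1\<close> up to \<open>2 l - 1\<close>, and back to
    \<open>0\<close>. Only index \<open>1\<close> is missing.\<close>
  have "\<not> R (x 2) (x (2 * s + 1))"
  proof
    assume a: "R (x 2) (x (2 * s + 1))"
    have "has_cycle R V (2 * l - 1)"
    proof (rule periodic_cycle_subcycle[OF x, of "[0] @ rev [2..<2*s+1] @ [2*s+1..<2*l]"])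
      show "successively (\<lambda>i j. R (x i) (x j)) ([0] @ rev [2..<2*s+1] @ [2*s+1..<2*l])"
        unfolding successively_append_iff
        using a chord path_upt[where x = x, OF stepR] assms(3,4)
        by (simp add: hd_rev last_rev hd_append del: upt_Suc)
    qed (use assms(3,4) close in \<open>auto simp: hd_append\<close>)
    then show False using no by simp
  qed
  then have a: "S (x 2) (x (2 * s + 1))" using complete inV ne[of 2 "2 * s + 1"] assms(3,4) by auto
  \<comment> \<open>With this edge: \<open>0\<close>, then \<open>2 s\<close> up to
    \<open>2 l - 2\<close>, then \<open>2 s - 1\<close> down to \<open>1\<close>, and back to
    \<open>0\<close>. Only index \<open>2 l - 1\<close> is missing.\<close>
  have "\<not> R (x (2 * s - 1)) (x (2 * l - 2))"
  proof
    assume b: "R (x (2 * s - 1)) (x (2 * l - 2))"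
    have "has_cycle R V (2 * l - 1)"
    proof (rule periodic_cycle_subcycle[OF x, of "[0] @ [2*s..<2*l-1] @ rev [1..<2*s]"])
      have eq: "last [2*s..<2*l-1] = 2 * l - 2" "hd (rev [1..<2*s]) = 2 * s - 1"
        using assms(3,4) by (auto simp: hd_rev)
      show "successively (\<lambda>i j. R (x i) (x j)) ([0] @ [2*s..<2*l-1] @ rev [1..<2*s])"
      proof -
        have "hd ([2*s..<2*l-1] @ rev [1..<2*s]) = 2 * s" "last [0] = (0::nat)"
          using assms(3,4) by (auto simp: hd_append)
        moreover have "successively (\<lambda>i j. R (x i) (x j)) (rev [1..<2*s])"
          using path_upt(2)[where x = x, OF stepR] by (simp only: successively_rev)
        ultimately show ?thesis
          unfolding successively_append_iff successively.simps
          using symR[OF b] chord path_upt(1)[where x = x, OF stepR] eq by metis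
      qed
      show "R (x (last ([0] @ [2*s..<2*l-1] @ rev [1..<2*s]))) (x (hd ([0] @ [2*s..<2*l-1] @ rev [1..<2*s])))"
        using symR[OF stepR[of 0]] assms(3,4) by (simp add: last_rev)
    qed (use assms(3,4) in auto)
    then show False using no by simp
  qed
  then have b: "S (x (2 * l - 2)) (x (2 * s - 1))"
  proof -
    have "x (2 * s - 1) \<noteq> x (2 * l - 2)" by (rule ne) (use assms(3,4) in linarith)+
    then have "S (x (2 * s - 1)) (x (2 * l - 2))"
      using complete inV \<open>\<not> R (x (2 * s - 1)) (x (2 * l - 2))\<close> by blast
    then show ?thesis by (rule symS)
  qed
  let ?e = "\<lambda>i. 2 * i :: nat" and ?o = "\<lambda>i. 2 * i + 1 :: nat"
  \<comment> \<open>The positive even indices upwards, the odd ones from \<open>2 s - 1\<close> down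
    to \<open>1\<close>, then from \<open>2 l - 1\<close> down to \<open>2 s + 1\<close>. The
    junctions are the second \<open>S\<close>-edge, the step-two chord between \<open>1\<close> and
    \<open>2 l - 1\<close>, and the first \<open>S\<close>-edge, which closes the cycle.\<close>
  let ?is = "map ?e [1..<l] @ map ?o (rev [0..<s]) @ map ?o (rev [s..<l])"
  have "has_cycle S V (2 * l - 1)"
  proof (rule periodic_cycle_subcycle[OF x, of ?is])
    have "S (x (2 * i)) (x (2 * Suc i))" "S (x (2 * Suc i + 1)) (x (2 * i + 1))" for i
      using S2[of "2 * i"] symS[OF S2[of "2 * i + 1"]] by auto
    then have m: "successively (\<lambda>i j. S (x i) (x j)) (map ?e [1..<l])"
      "successively (\<lambda>i j. S (x i) (x j)) (map ?o (rev [0..<s]))"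
      "successively (\<lambda>i j. S (x i) (x j)) (map ?o (rev [s..<l]))"
      by (auto simp: successively_map intro!: successively_upt)
    have S1: "S (x 1) (x (2 * l - 1))"
      using S2[of "2 * l - 1"] per[of 1] assms(3,4) symS by (simp add: add.commute)
    show "successively (\<lambda>i j. S (x i) (x j)) ?is"
    proof -
      have "last (map ?e [1..<l]) = 2 * l - 2" "hd (map ?o (rev [0..<s])) = 2 * s - 1"
        "last (map ?o (rev [0..<s])) = 1" "hd (map ?o (rev [s..<l])) = 2 * l - 1"
        using assms(3,4) by (auto simp: last_map hd_map hd_rev last_rev)
      moreover have "hd (map ?o (rev [0..<s]) @ map ?o (rev [s..<l])) = hd (map ?o (rev [0..<s]))"
        using assms(3,4) by (simp add: hd_append)
      ultimately show ?thesis
        unfolding successively_append_iff using m b S1 by metis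
    qed
    show "S (x (last ?is)) (x (hd ?is))"
      using symS[OF a] assms(3,4) by (simp add: last_map last_rev hd_map)
    show "distinct ?is"
      using assms(3,4) by (auto simp: distinct_map inj_on_def) presburger+
  qed (use assms(3,4) in auto)
  then show False using no by simp
qed

text \<open>After a rotation taking \<open>i\<close> to \<open>0\<close>,
  \<open>even_cycle_chord\<close> covers every even distance except two in either direction, which
  is \<open>step_two\<close>.\<close>

lemma even_cycle_classes:
  assumes x: "periodic_cycle R x (2 * l)" "range x \<subseteq> V" and "4 \<le> l"
    and no: "\<not> has_cycle R V (2 * l - 1)" "\<not> has_cycle S V (2 * l - 1)"
    and "even (i + j)" "x i \<noteq> x j"
  shows "S (x i) (x j)"
proof -
  have S2: "S (x i) (x (i + 2))" for i using step_two[OF x _ no(1)] assms(3) by simp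
  have per: "x (i + 2 * l) = x i" for i using x(1) by (simp add: periodic_cycle_def)
  have ineq: "S (x i) (x (i + 2 * s))" if s: "1 \<le> s" "s < l" for i s
  proof -
    have "s = 1 \<or> s = l - 1 \<or> 2 \<le> s \<and> s + 2 \<le> l" using s by linarith
    then consider "s = 1" | "s = l - 1" | "2 \<le> s" "s + 2 \<le> l" by blast
    then show ?thesis
    proof cases
      case 1
      then show ?thesis using S2 by simp
    next
      case 2
      then have "i + 2 * s + 2 = i + 2 * l" using s by simp
      then have "S (x (i + 2 * s)) (x i)" using S2[of "i + 2 * s"] per[of i] by metis
      then show ?thesis by (rule symS)
    next
      case 3
      define y where "y k = x (k + i)" for k
      have y: "periodic_cycle R y (2 * l)" "range y \<subseteq> V"
        using periodic_cycle_shift[OF x(1), of i] x(2) assms(3) by (auto simp: y_def [abs_def])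
      have "\<not> R (y 0) (y (2 * s))" using even_cycle_chord[OF y 3 no] .
      moreover have "y 0 \<noteq> y (2 * s)"
        using periodic_cycle_eq_iff[OF y(1), of 0 "2 * s"] s by auto
      moreover have "y 0 \<in> V" "y (2 * s) \<in> V" using y(2) by blast+
      ultimately have "S (y 0) (y (2 * s))" using complete by blast
      then show ?thesis by (simp add: y_def add.commute)
    qed
  qed
  have main: "S (x i) (x j)" if "i < j" "j < 2 * l" "even (i + j)" for i j
  proof -
    have "j = i + 2 * ((j - i) div 2)" using that by (simp add: even_diff_nat)
    moreover have "1 \<le> (j - i) div 2" "(j - i) div 2 < l" using that by presburger+
    ultimately show ?thesis using ineq[of "(j - i) div 2" i] by simp
  qed
  \<comment> \<open>The modulus is even, so reduction preserves parity.\<close>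
  define i' j' where "i' = i mod (2 * l)" "j' = j mod (2 * l)"
  have e: "x i = x i'" "x j = x j'"
    using periodic_cycle_eq_iff[OF x(1)] assms(3) by (auto simp: i'_j'_def)
  have "even i' \<longleftrightarrow> even i" "even j' \<longleftrightarrow> even j" unfolding i'_j'_def by (rule dvd_mod_iff, simp)+
  then have ev: "even (i' + j')" using assms(6) by simp
  have lt: "i' < 2 * l" "j' < 2 * l" using assms(3) by (auto simp: i'_j'_def)
  consider "i' < j'" | "j' < i'" using assms(7) e by (metis nat_neq_iff)
  then show ?thesis
  proof cases
    case 1
    then show ?thesis using main lt ev e by simp
  next
    case 2
    then show ?thesis using main[of j' i'] lt ev e symS by (simp add: add.commute)
  qed
qed

end

section \<open>Large cliques of one colour\<close>

context two_colour_complete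
begin

text \<open>Any \<open>n + 1\<close> core vertices form one side of a complete bipartite
  \<open>S\<close>-graph with an \<open>S\<close>-edge inside; the remaining vertices of
  \<open>W\<close>, at least \<open>n\<close>, form the other.\<close>

lemma clique_core_cycle:
  assumes "finite W" "X0 \<subseteq> W" "n + 1 \<le> card X0" "2 * n + 1 \<le> card W" "2 \<le> n"
    and "\<And>x y. x \<in> X0 \<Longrightarrow> y \<in> W \<Longrightarrow> x \<noteq> y \<Longrightarrow> S x y"
  shows "has_cycle S W (2 * n + 1)"
proof -
  obtain X where X: "X \<subseteq> X0" "card X = n + 1" "finite X"
    using assms(3) by (metis obtain_subset_with_card_n)
  then have "\<exists>u v. u \<in> X \<and> v \<in> X \<and> u \<noteq> v"
    using assms(5) card_le_Suc0_iff_eq[OF X(3)] by fastforce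
  then obtain u v where uv: "u \<in> X" "v \<in> X" "u \<noteq> v" by blast
  have XW: "X \<subseteq> W" using X assms(2) by blast
  have "has_cycle S (X \<union> (W - X)) (2 * n + 1)"
  proof (rule bipartite_edge_cycle[of _ _ S n u v])
    show "n \<le> card (W - X)" using XW X assms(4) by (simp add: card_Diff_subset)
    show "S x y \<and> S y x" if "x \<in> X" "y \<in> W - X" for x y
      using that assms(6)[of x y] symS X(1) by blast
    show "S u v" using uv assms(6)[of u v] X(1) XW by blast
  qed (use assms X uv in auto)
  moreover have "X \<union> (W - X) = W" using XW by blast
  ultimately show ?thesis by simp
qed

text \<open>A clique has paths of all lengths between two prescribed vertices. A path on
  \<open>n + 1\<close> vertices of \<open>E\<close> and one on \<open>n\<close> vertices of
  \<open>F\<close> are joined by the two cross edges.\<close>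

lemma two_cliques_cycle:
  assumes "finite E" "finite F" "E \<inter> F = {}" "n + 1 \<le> card E" "n + 1 \<le> card F" "3 \<le> n"
    and E: "\<And>x y. x \<in> E \<Longrightarrow> y \<in> E \<Longrightarrow> x \<noteq> y \<Longrightarrow> S x y"
    and F: "\<And>x y. x \<in> F \<Longrightarrow> y \<in> F \<Longrightarrow> x \<noteq> y \<Longrightarrow> S x y"
    and e: "e1 \<in> E" "e2 \<in> E" "e1 \<noteq> e2" and o: "o1 \<in> F" "o2 \<in> F" "o1 \<noteq> o2"
    and cross: "S e1 o1" "S e2 o2"
  shows "has_cycle S (E \<union> F) (2 * n + 1)"
proof -
  have clique_path: "\<exists>xs. length xs = k + 2 \<and> distinct xs \<and> set xs \<subseteq> C \<and> successively S xs \<and> hd xs = a \<and> last xs = b"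
    if C: "finite C" "k + 2 \<le> card C" "a \<in> C" "b \<in> C" "a \<noteq> b"
      "\<And>x y. x \<in> C \<Longrightarrow> y \<in> C \<Longrightarrow> x \<noteq> y \<Longrightarrow> S x y" for C k a b
  proof -
    have "k \<le> card (C - {a, b})" using C by (simp add: card_Diff_subset)
    then obtain D where D: "D \<subseteq> C - {a, b}" "card D = k" "finite D"
      by (metis obtain_subset_with_card_n)
    obtain ds where ds: "set ds = D" "distinct ds" using finite_distinct_list[OF D(3)] by blast
    define xs where "xs = a # ds @ [b]"
    have dist: "distinct xs" "set xs \<subseteq> C" using ds D C by (auto simp: xs_def)
    have "sorted_wrt (\<lambda>x y. x \<noteq> y) xs" using dist(1) by (simp add: distinct_conv_nth sorted_wrt_iff_nth_less)
    then have "successively (\<lambda>x y. x \<noteq> y) xs" by (rule successively_if_sorted_wrt)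
    then have "successively S xs"
      by (rule successively_mono) (use C(6) dist(2) in blast)
    then show ?thesis using dist ds D by (intro exI[of _ xs]) (auto simp: xs_def distinct_card)
  qed
  obtain xs where xs: "length xs = n - 1 + 2" "distinct xs" "set xs \<subseteq> E" "successively S xs" "hd xs = e1" "last xs = e2"
    using clique_path[of E "n - 1" e1 e2] assms by auto
  have "\<exists>ys. length ys = n - 2 + 2 \<and> distinct ys \<and> set ys \<subseteq> F \<and> successively S ys \<and> hd ys = o2 \<and> last ys = o1"
    by (rule clique_path[OF assms(2)]) (use assms(5,6) o F in auto)
  then obtain ys where ys: "length ys = n - 2 + 2" "distinct ys" "set ys \<subseteq> F" "successively S ys"
    "hd ys = o2" "last ys = o1" by blast
  have "xs \<noteq> []" "ys \<noteq> []" using xs(1) ys(1) by auto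
  then show ?thesis
    using xs ys assms(3,6) cross symS
    by (intro has_cycleI[of "xs @ ys"]) (auto simp: successively_append_iff)
qed

text \<open>Disjoint \<open>S\<close>-edges between the two cliques would close an \<open>S\<close>-cycle, so these edges form a
  star. Hence there are enough \<open>R\<close>-edges between the cliques to forbid an outside vertex with
  \<open>R\<close>-edges to both of them.\<close>

lemma two_cliques_in_large_set:
  assumes fin: "finite V" and EO: "E \<subseteq> V" "F \<subseteq> V" "E \<inter> F = {}"
    and big: "n + 1 \<le> card E" "n + 1 \<le> card F" "3 \<le> n" "4 * n + 1 \<le> card V"
    and E: "\<And>x y. x \<in> E \<Longrightarrow> y \<in> E \<Longrightarrow> x \<noteq> y \<Longrightarrow> S x y"
    and F: "\<And>x y. x \<in> F \<Longrightarrow> y \<in> F \<Longrightarrow> x \<noteq> y \<Longrightarrow> S x y"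
    and nbE: "\<And>x y. x \<in> E \<Longrightarrow> \<exists>z\<in>F. z \<noteq> y \<and> R x z"
    and nbO: "\<And>x y. x \<in> F \<Longrightarrow> \<exists>z\<in>E. z \<noteq> y \<and> R x z"
  shows "has_cycle R V (2 * n + 1) \<or> has_cycle S V (2 * n + 1)"
proof (rule ccontr)
  assume neg: "\<not> ?thesis"
  have finEO: "finite E" "finite F" using finite_subset[OF EO(1) fin] finite_subset[OF EO(2) fin] by auto
  have mono: "has_cycle Q V (2 * n + 1)" if "has_cycle Q U (2 * n + 1)" "U \<subseteq> V" for Q U
    using has_cycle_mono[OF that] by simp
  have noblue: "e1 = e2 \<or> o1 = o2" if "e1 \<in> E" "e2 \<in> E" "o1 \<in> F" "o2 \<in> F" "S e1 o1" "S e2 o2" for e1 e2 o1 o2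
    using two_cliques_cycle[OF finEO EO(3) big(1,2,3) E F that(1,2) _ that(3,4) _ that(5,6)] mono neg EO by blast
  \<comment> \<open>Pairwise intersecting edges of a bipartite graph share a vertex
    \<open>c\<close>; without any edge, every \<open>c\<close> will do.\<close>
  have "\<exists>c. \<forall>e\<in>E. \<forall>p\<in>F. S e p \<longrightarrow> e = c \<or> p = c"
  proof (cases "\<exists>e1\<in>E. \<exists>o1\<in>F. S e1 o1")
    case True
    then obtain e1 o1 where 1: "e1 \<in> E" "o1 \<in> F" "S e1 o1" by blast
    show ?thesis
    proof (cases "\<forall>e\<in>E. \<forall>p\<in>F. S e p \<longrightarrow> e = e1")
      case False
      then obtain e2 o2 where 2: "e2 \<in> E" "o2 \<in> F" "S e2 o2" "e2 \<noteq> e1" by blast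
      then have "o2 = o1" using noblue 1 by blast
      then show ?thesis using noblue 1 2 by metis
    qed blast
  qed blast
  then obtain c where c: "\<And>e p. e \<in> E \<Longrightarrow> p \<in> F \<Longrightarrow> S e p \<Longrightarrow> e = c \<or> p = c" by blast
  have red: "R e p" if "e \<in> E" "p \<in> F" "e \<noteq> c" "p \<noteq> c" for e p
    using that c complete[of e p] EO by blast
  have one_side: "\<not> (\<exists>e\<in>E. \<exists>p\<in>F. R v e \<and> R v p)" if v: "v \<in> V" "v \<notin> E" "v \<notin> F" for v
  proof
    assume "\<exists>e\<in>E. \<exists>p\<in>F. R v e \<and> R v p"
    then obtain e p where ep: "e \<in> E" "p \<in> F" "R v e" "R v p" by blast
    have "\<exists>xs. length xs = 2 * n \<and> distinct xs \<and> set xs \<subseteq> E \<union> F \<and> successively R xs \<and> hd xs = e \<and> last xs = p"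
    \<comment> \<open>If the centre of the star is an end of the desired path, both ends are entered
      through the \<open>R\<close>-edges from \<open>nbE\<close> and \<open>nbO\<close>, and only
      \<open>2 * (n - 1)\<close> inner vertices alternate, away from the centre. Otherwise
      \<open>c\<close> is simply avoided.\<close>
    proof (cases "c = e \<or> c = p")
      case True
      obtain p' where p': "p' \<in> F" "p' \<noteq> p" "R e p'" using nbE[OF ep(1), of p] by blast
      obtain e' where e': "e' \<in> E" "e' \<noteq> e" "R p e'" using nbO[OF ep(2), of e] by blast
      have "\<exists>xs. length xs = 2 * (n - 1) \<and> distinct xs \<and> set xs \<subseteq> (F - {p}) \<union> (E - {e}) \<and> successively R xs \<and> hd xs = p' \<and> last xs = e'"
      proof (rule alternating_path)
        fix x y assume "x \<in> F - {p}" "y \<in> E - {e}"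
        then show "R x y \<and> R y x"
          using True red[of y x] symR EO(3) ep by blast
      qed (use finEO EO(3) p' e' big ep in auto)
      then obtain xs where xs: "length xs = 2 * (n - 1)" "distinct xs" "set xs \<subseteq> (F - {p}) \<union> (E - {e})"
        "successively R xs" "hd xs = p'" "last xs = e'" by blast
      then have "xs \<noteq> []" using big(3) by auto
      then show ?thesis using xs p' e' ep EO(3) symR big(3)
        by (intro exI[of _ "e # xs @ [p]"]) (auto simp: successively_Cons successively_append_iff)
    next
      case False
      have "\<exists>xs. length xs = 2 * n \<and> distinct xs \<and> set xs \<subseteq> (E - {c}) \<union> (F - {c}) \<and> successively R xs \<and> hd xs = e \<and> last xs = p"
      proof (rule alternating_path)
        show "R x y \<and> R y x" if "x \<in> E - {c}" "y \<in> F - {c}" for x y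
          using that red symR by blast
        show "n \<le> card (E - {c})" "n \<le> card (F - {c})"
          using big finEO by (auto simp: card_Diff_singleton_if)
      qed (use finEO EO(3) big ep False in auto)
      then show ?thesis by blast
    qed
    then obtain xs where xs: "length xs = 2 * n" "distinct xs" "set xs \<subseteq> E \<union> F" "successively R xs"
      "hd xs = e" "last xs = p" by blast
    then have "xs \<noteq> []" using big(3) by auto
    then have "has_cycle R V (2 * n + 1)"
      using xs v ep symR EO
      by (intro has_cycleI[of "v # xs"]) (auto simp: successively_Cons)
    then show False using neg by blast
  qed
  \<comment> \<open>By \<open>one_side\<close>, an outside vertex with an \<open>R\<close>-edge to
    \<open>E\<close> is \<open>S\<close>-joined to all of \<open>F\<close>. One of the two cliques,
    enlarged by its fully \<open>S\<close>-joined vertices, thus has at least half of the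
    \<open>4 n + 1\<close> vertices.\<close>
  define V1 where "V1 = {v \<in> V - E - F. \<forall>e\<in>E. S v e}"
  define V2 where "V2 = V - E - F - V1"
  have V2: "S v p" if "v \<in> V2" "p \<in> F" for v p
  proof -
    have v: "v \<in> V" "v \<notin> E" "v \<notin> F" "v \<notin> V1" using that by (auto simp: V2_def)
    then obtain e where e: "e \<in> E" "\<not> S v e" by (auto simp: V1_def)
    then have "R v e" using complete[of v e] v EO by blast
    then have "\<not> R v p" using one_side[OF v(1,2,3)] e that by blast
    then show ?thesis using complete[of v p] v EO that by blast
  qed
  have "card V = card (E \<union> V1) + card (F \<union> V2)"
  proof -
    have "V = (E \<union> V1) \<union> (F \<union> V2)" using EO by (auto simp: V1_def V2_def)
    moreover have "(E \<union> V1) \<inter> (F \<union> V2) = {}" using EO by (auto simp: V1_def V2_def)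
    moreover have "finite (E \<union> V1)" "finite (F \<union> V2)" using fin finEO by (auto simp: V1_def V2_def)
    ultimately show ?thesis using card_Un_disjoint[of "E \<union> V1" "F \<union> V2"] by metis
  qed
  then consider "2 * n + 1 \<le> card (E \<union> V1)" | "2 * n + 1 \<le> card (F \<union> V2)" using big(4) by linarith
  then show False
  proof cases
    case 1
    have "has_cycle S (E \<union> V1) (2 * n + 1)"
    proof (rule clique_core_cycle[of _ E])
      show "finite (E \<union> V1)" using fin finEO by (auto simp: V1_def)
      show "S x y" if "x \<in> E" "y \<in> E \<union> V1" "x \<noteq> y" for x y
        using that E symS by (auto simp: V1_def)
    qed (use 1 big in auto)
    then show False using mono[of S "E \<union> V1"] neg EO by (auto simp: V1_def)
  next
    case 2
    have "has_cycle S (F \<union> V2) (2 * n + 1)"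
    proof (rule clique_core_cycle[of _ F])
      show "finite (F \<union> V2)" using fin finEO by (auto simp: V2_def)
      show "S x y" if "x \<in> F" "y \<in> F \<union> V2" "x \<noteq> y" for x y
        using that F V2 symS by auto
    qed (use 2 big in auto)
    then show False using mono[of S "F \<union> V2"] neg EO by (auto simp: V2_def)
  qed
qed

text \<open>The parity classes are \<open>S\<close>-cliques, and the two neighbours along the cycle
  give each vertex an \<open>R\<close>-neighbour in the other class besides any given one.\<close>

lemma even_cycle_large_set:
  assumes fin: "finite V" and x: "periodic_cycle R x (2 * l)" "range x \<subseteq> V"
    and no: "\<not> has_cycle R V (2 * l - 1)" "\<not> has_cycle S V (2 * l - 1)"
    and big: "n + 1 \<le> l" "3 \<le> n" "4 * n + 1 \<le> card V"
  shows "has_cycle R V (2 * n + 1) \<or> has_cycle S V (2 * n + 1)"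
proof -
  have eq: "x i = x j \<longleftrightarrow> i mod (2 * l) = j mod (2 * l)" for i j
    using periodic_cycle_eq_iff[OF x(1)] big by simp
  have stepR: "R (x j) (x (Suc j))" for j using x(1) by (simp add: periodic_cycle_def)
  have per: "x (i + 2 * l) = x i" for i using x(1) by (simp add: periodic_cycle_def)
  have par: "even i \<longleftrightarrow> even j" if "x i = x j" for i j
    using that unfolding eq by (metis dvd_mod_iff dvd_triv_left)
  have cls: "S (x i) (x j)" if "even (i + j)" "x i \<noteq> x j" for i j
    using even_cycle_classes[OF x _ no that] big by simp
  define E where "E = (\<lambda>i. x (2 * i)) ` {..<l}"
  define F where "F = (\<lambda>i. x (2 * i + 1)) ` {..<l}"
  have memE: "x i \<in> E" if "even i" for i
  proof -
    have "x i = x (i mod (2 * l))" using eq by simp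
    moreover have "i mod (2 * l) = 2 * (i mod (2 * l) div 2)" using that by (simp add: dvd_mod)
    moreover have "i mod (2 * l) div 2 < l" using big by (simp add: less_mult_imp_div_less mult.commute)
    ultimately show ?thesis by (metis E_def imageI lessThan_iff)
  qed
  have memO: "x i \<in> F" if "odd i" for i
  proof -
    have "x i = x (i mod (2 * l))" using eq by simp
    moreover have "odd (i mod (2 * l))" using that by (simp add: dvd_mod_iff)
    then have "i mod (2 * l) = 2 * (i mod (2 * l) div 2) + 1" by simp
    moreover have "i mod (2 * l) div 2 < l" using big by (simp add: less_mult_imp_div_less mult.commute)
    ultimately show ?thesis by (metis F_def imageI lessThan_iff)
  qed
  have cardE: "card E = l" unfolding E_def using eq by (subst card_image) (auto simp: inj_on_def)
  have cardO: "card F = l" unfolding F_def using eq by (subst card_image) (auto simp: inj_on_def)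
  have nb: "\<exists>k. odd k \<and> x (i + k) \<noteq> y \<and> R (x i) (x (i + k))" for i y
  proof -
    have "R (x i) (x (i + 1))" using stepR by simp
    moreover have "R (x i) (x (i + (2 * l - 1)))"
      using stepR[of "i + (2 * l - 1)"] per[of i] big by (simp add: symR)
    moreover have "x (i + 1) \<noteq> x (i + (2 * l - 1))"
    proof
      assume "x (i + 1) = x (i + (2 * l - 1))"
      then have "(i + 1) mod (2 * l) = (i + (2 * l - 1)) mod (2 * l)" using eq by blast
      then have "2 * l dvd (i + (2 * l - 1)) - (i + 1)" by (metis mod_eq_dvd_iff_nat add_le_cancel_left
            One_nat_def Suc_leI big(1) add_leD2 diff_is_0_eq' dvd_0_right nat_le_linear)
      then have "2 * l dvd 2 * l - 2" by (simp add: numeral_2_eq_2)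
      then show False using big by (auto dest!: dvd_imp_le)
    qed
    moreover have "odd (1::nat)" "odd (2 * l - 1)" using big by auto
    ultimately show ?thesis by metis
  qed
  show ?thesis
  proof (rule two_cliques_in_large_set[OF fin, of E F])
    show "E \<inter> F = {}" using par by (fastforce simp: E_def F_def)
    show "S a b" if ab: "a \<in> E" "b \<in> E" "a \<noteq> b" for a b
    proof -
      obtain i j where "a = x (2 * i)" "b = x (2 * j)" using ab by (auto simp: E_def)
      then show ?thesis using cls[of "2 * i" "2 * j"] ab(3) by simp
    qed
    show "S a b" if ab: "a \<in> F" "b \<in> F" "a \<noteq> b" for a b
    proof -
      obtain i j where "a = x (2 * i + 1)" "b = x (2 * j + 1)" using ab by (auto simp: F_def)
      then show ?thesis using cls[of "2 * i + 1" "2 * j + 1"] ab(3) by simp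
    qed
    show "\<exists>z\<in>F. z \<noteq> b \<and> R a z" if a: "a \<in> E" for a b
    proof -
      obtain i where i: "a = x (2 * i)" using a by (auto simp: E_def)
      obtain k where "odd k" "x (2 * i + k) \<noteq> b" "R (x (2 * i)) (x (2 * i + k))" using nb by blast
      then show ?thesis using memO[of "2 * i + k"] i by auto
    qed
    show "\<exists>z\<in>E. z \<noteq> b \<and> R a z" if a: "a \<in> F" for a b
    proof -
      obtain i where i: "a = x (2 * i + 1)" using a by (auto simp: F_def)
      obtain k where "odd k" "x (2 * i + 1 + k) \<noteq> b" "R (x (2 * i + 1)) (x (2 * i + 1 + k))" using nb by blast
      then show ?thesis using memE[of "2 * i + 1 + k"] i by auto
    qed
  qed (use cardE cardO big x(2) in \<open>auto simp: E_def F_def\<close>)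
qed

lemma least_cycle_large_set:
  assumes fin: "finite V" and cyc: "has_cycle R V L" "2 * n + 1 < L"
    and least: "\<And>m. 2 * n + 1 \<le> m \<Longrightarrow> m < L \<Longrightarrow> \<not> has_cycle R V m \<and> \<not> has_cycle S V m"
    and big: "3 \<le> n" "4 * n + 1 \<le> card V"
  shows False
proof -
  obtain x where x: "periodic_cycle R x L" "range x \<subseteq> V"
    using has_cycle_periodic[OF cyc(1)] cyc(2) by auto
  have no: "\<not> has_cycle R V (L - 1)" "\<not> has_cycle S V (L - 1)"
    using least[of "L - 1"] cyc(2) by auto
  have no': "\<not> has_cycle R V (2 * n + 1)" "\<not> has_cycle S V (2 * n + 1)"
    using least[of "2 * n + 1"] cyc(2) by auto
  show False
  proof (cases "even L")
    case True
    then obtain l where l: "L = 2 * l" by blast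
    have "n + 1 \<le> l" using cyc(2) l by simp
    then show False
      using even_cycle_large_set[OF fin x[unfolded l] no[unfolded l] _ big] no' by blast
  next
    case False
    then show False using odd_cycle_descent[OF x False _ no] cyc(2) big by simp
  qed
qed

end

text \<open>On exactly \<open>4 n + 1\<close> vertices, without a monochromatic cycle longer than
  \<open>2 n\<close> each degree sum would be at most \<open>2 n * 4 n\<close>, while together they
  reach \<open>(4 n + 1) * 4 n\<close>.\<close>

lemma two_colour_odd_cycle:
  assumes "two_colour_complete V R S" "finite V" "3 \<le> n" "4 * n + 1 \<le> card V"
    and irr: "\<And>x. \<not> R x x" "\<And>x. \<not> S x x"
  shows "has_cycle R V (2 * n + 1) \<or> has_cycle S V (2 * n + 1)"
proof -
  obtain W where W: "W \<subseteq> V" "card W = 4 * n + 1" "finite W"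
    using assms(4) by (metis obtain_subset_with_card_n)
  interpret two_colour_complete W R S
    using assms(1) W(1) unfolding two_colour_complete_def by blast
  have "\<exists>m>2 * n. has_cycle R W m \<or> has_cycle S W m"
  proof (rule ccontr)
    assume neg: "\<not> ?thesis"
    have ne: "W \<noteq> {}" using W(2) by auto
    have "(\<Sum>x\<in>W. card {y \<in> W. R x y}) \<le> 2 * n * (card W - 1)"
      using neg symR irr assms(3) by (intro erdos_gallai_circumference[OF W(3) ne]) auto
    moreover have "(\<Sum>x\<in>W. card {y \<in> W. S x y}) \<le> 2 * n * (card W - 1)"
      using neg symS irr assms(3) by (intro erdos_gallai_circumference[OF W(3) ne]) auto
    moreover have "(\<Sum>x\<in>W. card W - 1) \<le> (\<Sum>x\<in>W. card {y \<in> W. R x y} + card {y \<in> W. S x y})"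
    proof (rule sum_mono)
      fix x assume x: "x \<in> W"
      have "card W - 1 = card (W - {x})" using x W(3) by simp
      also have "\<dots> \<le> card ({y \<in> W. R x y} \<union> {y \<in> W. S x y})"
        using complete[OF x] W(3) by (intro card_mono) auto
      also have "\<dots> \<le> card {y \<in> W. R x y} + card {y \<in> W. S x y}" by (rule card_Un_le)
      finally show "card W - 1 \<le> card {y \<in> W. R x y} + card {y \<in> W. S x y}" .
    qed
    ultimately have "(4 * n + 1) * (4 * n) \<le> 2 * n * (4 * n) + 2 * n * (4 * n)"
      using W(2) by (simp add: sum.distrib)
    then show False using assms(3) by (simp add: algebra_simps)
  qed
  then have ex: "\<exists>m. 2 * n + 1 \<le> m \<and> (has_cycle R W m \<or> has_cycle S W m)"
    by (metis Suc_eq_plus1 Suc_leI)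
  \<comment> \<open>Minimising over both colours at once excludes length \<open>L - 1\<close> in the
    other colour as well, as the chord arguments require.\<close>
  define L where "L = (LEAST m. 2 * n + 1 \<le> m \<and> (has_cycle R W m \<or> has_cycle S W m))"
  have L: "2 * n + 1 \<le> L" "has_cycle R W L \<or> has_cycle S W L"
    using LeastI_ex[OF ex] by (auto simp: L_def)
  have least: "\<not> has_cycle R W m \<and> \<not> has_cycle S W m" if "2 * n + 1 \<le> m" "m < L" for m
    using not_less_Least that unfolding L_def by blast
  have "L = 2 * n + 1"
  proof (rule ccontr)
    assume "L \<noteq> 2 * n + 1"
    then have lt: "2 * n + 1 < L" using L(1) by simp
    from L(2) show False
    proof
      assume "has_cycle R W L"
      then show False using least_cycle_large_set[OF W(3) _ lt least assms(3)] W(2) by simp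
    next
      assume "has_cycle S W L"
      then show False
        using two_colour_complete.least_cycle_large_set[OF swapped W(3) _ lt _ assms(3)] least W(2)
        by (metis le_refl)
    qed
  qed
  then show ?thesis using L(2) W(1) has_cycle_mono[of _ W "2 * n + 1" V] by auto
qed

section \<open>Two-coloured complete multipartite graphs\<close>

lemma periodic_cycle_has_cycle:
  assumes "periodic_cycle R x L" "range x \<subseteq> V" "L > 0"
  shows "has_cycle R V L"
proof (rule periodic_cycle_subcycle[OF assms(1,2), of "[0..<L]"])
  have step: "R (x i) (x (Suc i))" for i using assms(1) by (simp add: periodic_cycle_def)
  show "successively (\<lambda>i j. R (x i) (x j)) [0..<L]" using step by (intro successively_upt)
  have "x (0 + L) = x 0" using assms(1) unfolding periodic_cycle_def by blast
  then show "R (x (last [0..<L])) (x (hd [0..<L]))" using step[of "L - 1"] assms(3) by simp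
qed (use assms(3) in auto)

lemma has_cycle_periodic_from:
  assumes "has_cycle R V L" "L > 0" "finite V" "card V = L" "q \<in> V"
  obtains x where "periodic_cycle R x L" "range x \<subseteq> V" "x 0 = q"
proof -
  obtain x where x: "periodic_cycle R x L" "range x \<subseteq> V" using has_cycle_periodic[OF assms(1,2)] .
  have "card (x ` {..<L}) = L" using x(1) by (simp add: periodic_cycle_def card_image)
  then have "x ` {..<L} = V" using x(2) assms(3,4) by (intro card_subset_eq) auto
  then obtain k where k: "x k = q" using assms(5) by auto
  show thesis
    using periodic_cycle_shift[OF x(1) assms(2), of k] x(2) k by (intro that[of "\<lambda>i. x (i + k)"]) auto
qed

lemma periodic_cycle_insert:
  assumes "periodic_cycle R x L" "range x \<subseteq> V" "L > 0" "w \<in> V" "w \<notin> range x" "R (x i) w" "R w (x (Suc i))"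
  shows "has_cycle R V (L + 1)"
proof -
  define y where "y j = x (j + Suc i)" for j
  have y: "periodic_cycle R y L" 
    unfolding y_def using periodic_cycle_shift[OF assms(1,3), of "Suc i"] .
  have step: "R (y j) (y (Suc j))" for j using y by (simp add: periodic_cycle_def)
  have "x (i + L) = x i" using assms(1) by (simp add: periodic_cycle_def)
  then have last: "y (L - 1) = x i" using assms(3) by (simp add: y_def add.commute)
  have "successively R (map y [0..<L])" unfolding successively_map using step by (intro successively_upt)
  moreover have "last (map y [0..<L]) = x i" "hd (map y [0..<L]) = x (Suc i)"
    using last assms(3) by (auto simp: last_map hd_map y_def)
  moreover have "distinct (map y [0..<L])" using y by (simp add: distinct_map periodic_cycle_def atLeast0LessThan)
  moreover have "set (map y [0..<L]) \<subseteq> V" "w \<notin> set (map y [0..<L])" using assms(2,5) by (auto simp: y_def)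
  ultimately show ?thesis
    using assms by (intro has_cycleI[of "map y [0..<L] @ [w]"]) (auto simp: successively_append_iff hd_append)
qed

text \<open>Edges inside a class may have any colour in the application and so belong to neither
  relation. Classes are named by natural numbers, so that a fresh name exists whenever a vertex
  leaves its class.\<close>

locale two_colour_multipartite =
  fixes V :: "'a set" and f :: "'a \<Rightarrow> nat" and R S :: "'a \<Rightarrow> 'a \<Rightarrow> bool" and n :: nat
  assumes fin: "finite V"
    and symR: "\<And>x y. R x y \<Longrightarrow> R y x"
    and symS: "\<And>x y. S x y \<Longrightarrow> S y x"
    and indR: "\<And>x y. x \<in> V \<Longrightarrow> y \<in> V \<Longrightarrow> R x y \<Longrightarrow> f x \<noteq> f y"
    and indS: "\<And>x y. x \<in> V \<Longrightarrow> y \<in> V \<Longrightarrow> S x y \<Longrightarrow> f x \<noteq> f y"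
    and complete: "\<And>x y. x \<in> V \<Longrightarrow> y \<in> V \<Longrightarrow> f x \<noteq> f y \<Longrightarrow> R x y \<or> S x y"
    and twinR: "\<And>x x' y. x \<in> V \<Longrightarrow> x' \<in> V \<Longrightarrow> y \<in> V \<Longrightarrow> f x = f x' \<Longrightarrow> R x y \<Longrightarrow> R x' y"
    and twinS: "\<And>x x' y. x \<in> V \<Longrightarrow> x' \<in> V \<Longrightarrow> y \<in> V \<Longrightarrow> f x = f x' \<Longrightarrow> S x y \<Longrightarrow> S x' y"
    and class_le: "\<And>a. card {x \<in> V. f x = a} \<le> n"
begin

lemma swapped: "two_colour_multipartite V f S R n"
proof
  show "S x y \<or> R x y" if "x \<in> V" "y \<in> V" "f x \<noteq> f y" for x y
    using complete[OF that] by blast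
qed (fact fin symS symR indS indR twinS twinR class_le)+

text \<open>Deleting \<open>q\<close> leaves a path whose chords of step two and three all have colour \<open>S\<close>, because
  \<open>q\<close>, its twin \<open>u\<close> and an edge in their common neighbourhood can replace \<open>q\<close> on the cycle by
  two to four vertices. The chords of step two and three contain an explicit Hamiltonian cycle of
  this path, into which two further vertices are inserted.\<close>

lemma twin_outside_even_cycle:
  assumes n: "n \<in> {6, 7}" and y: "periodic_cycle R y (2 * n)" "range y \<subseteq> V"
    and u: "u \<in> V" "u \<notin> range y" "f u = f (y 0)" and deg: "3 * n + 1 \<le> card {z \<in> V. R u z}"
    and no: "\<not> has_cycle R V (2 * n + 1)" "\<not> has_cycle S V (2 * n + 1)"
  shows False
proof -
  define q where "q = y 0"
  have n6: "6 \<le> n" using n by auto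
  have inV: "y i \<in> V" for i using y(2) by blast
  have stepR: "R (y i) (y (Suc i))" for i using y(1) by (simp add: periodic_cycle_def)
  have yeq: "y i = y j \<longleftrightarrow> i mod (2 * n) = j mod (2 * n)" for i j
    using periodic_cycle_eq_iff[OF y(1)] n6 by simp
  have "y (0 + 2 * n) = y 0" using y(1) unfolding periodic_cycle_def by blast
  then have y2n: "y (2 * n) = q" by (simp add: q_def)
  have qV: "q \<in> V" using inV by (simp add: q_def)
  have nbr: "R q z \<longleftrightarrow> R u z" if "z \<in> V" for z
    using twinR[of q u z] twinR[of u q z] u qV that by (auto simp: q_def)
  have Rq: "R q (y 1)" "R (y (2 * n - 1)) q" 
    using stepR[of 0] stepR[of "2 * n - 1"] y2n n6 by (auto simp: q_def)
  have Ru: "R u (y 1)" "R (y (2 * n - 1)) u"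
    using Rq nbr[OF inV] symR by blast+
  define T where "T = {z \<in> V. R u z} - range y"
  have T: "z \<in> V" "R u z" "R q z" "z \<notin> range y" "z \<noteq> u" "z \<noteq> q" if "z \<in> T" for z
    using that nbr[of z] indR[OF u(1) u(1)] by (auto simp: T_def q_def)
  have finT: "finite T" using fin by (simp add: T_def)
  \<comment> \<open>Two consecutive cycle vertices adjacent to \<open>u\<close> would admit
    \<open>u\<close> between them. So \<open>u\<close> sees at most one vertex of each of the
    \<open>n\<close> pairs, and \<open>3 n + 1 - n\<close> neighbours remain off the cycle.\<close>
  have cardT: "2 * n + 1 \<le> card T"
  proof -
    define I where "I = {i. i < 2 * n \<and> R u (y i)}"
    have consec: "\<not> (R u (y i) \<and> R u (y (Suc i)))" for i
      using periodic_cycle_insert[OF y _ u(1,2), of i] no(1) symR n6 by auto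
    have "inj_on (\<lambda>i. i div 2) I"
    proof (rule inj_onI)
      fix i j assume ij: "i \<in> I" "j \<in> I" "i div 2 = j div 2"
      then have "i = j \<or> j = Suc i \<or> i = Suc j" by presburger
      then show "i = j" using consec ij(1,2) by (auto simp: I_def)
    qed
    moreover have "(\<lambda>i. i div 2) ` I \<subseteq> {..<n}" by (auto simp: I_def)
    ultimately have "card I \<le> card {..<n}" by (intro card_inj_on_le) auto
    then have I: "card I \<le> n" by simp
    have "{z \<in> V. R u z} \<subseteq> T \<union> y ` I"
    proof
      fix z assume z: "z \<in> {z \<in> V. R u z}"
      show "z \<in> T \<union> y ` I"
      proof (cases "z \<in> range y")
        case True
        then obtain i where "z = y i" by blast
        then have "z = y (i mod (2 * n))" using yeq by simp
        moreover have "i mod (2 * n) < 2 * n" using n6 by simp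
        ultimately show ?thesis using z by (auto simp: I_def)
      qed (use z in \<open>auto simp: T_def\<close>)
    qed
    then have "card {z \<in> V. R u z} \<le> card (T \<union> y ` I)"
      using finT by (intro card_mono) (auto simp: I_def)
    also have "\<dots> \<le> card T + card (y ` I)" by (rule card_Un_le)
    also have "card (y ` I) \<le> card I" by (rule card_image_le) (simp add: I_def)
    finally show ?thesis using deg I by simp
  qed
  \<comment> \<open>Otherwise all edges between different classes of \<open>T\<close> are in
    \<open>S\<close>, and \<open>multipartite_cycle\<close> applies.\<close>
  have "\<exists>a\<in>T. \<exists>b\<in>T. R a b"
  proof (rule ccontr)
    assume neg: "\<not> ?thesis"
    have "has_cycle S T (2 * n + 1)"
    proof (rule multipartite_cycle[of T n f])
      show "S a b" if "a \<in> T" "b \<in> T" "f a \<noteq> f b" for a b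
        using complete[of a b] T that neg by blast
      show "card {x \<in> T. f x = a} \<le> n" for a
        using class_le[of a] card_mono[of "{x \<in> V. f x = a}" "{x \<in> T. f x = a}"] fin T(1)
        by (fastforce intro: le_trans)
    qed (use finT cardT n6 in auto)
    then show False using no(2) has_cycle_mono[of S T "2 * n + 1" V S] T(1) by auto
  qed
  then obtain a b where ab: "a \<in> T" "b \<in> T" "R a b" "a \<noteq> b" using indR T(1) by metis
  have replace: "has_cycle R V m" 
    if "distinct is" "set is \<subseteq> {1..<2 * n}" "distinct es" "set es \<subseteq> {q, u} \<union> T" "is \<noteq> []" "es \<noteq> []"
      "successively R (map y is)" "successively R es" "R (y (last is)) (hd es)" "R (last es) (y (hd is))"
      "m = length is + length es" for "is" es m
  proof (rule has_cycleI[of "map y is @ es"])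
    have "inj_on y {..<2 * n}" using y(1) by (simp add: periodic_cycle_def)
    then have "distinct (map y is)"
      using that(1,2) by (simp add: distinct_map) (metis (no_types, lifting) atLeastLessThan_iff inj_on_subset lessThan_iff subsetD subsetI)
    moreover have "y i \<notin> set es" if i: "i \<in> set is" for i
    proof -
      have "1 \<le> i" "i < 2 * n" using i \<open>set is \<subseteq> {1..<2 * n}\<close> by auto
      then have "y i \<noteq> q" using yeq[of i 0] by (simp add: q_def)
      moreover have "y i \<noteq> u" "y i \<notin> T" using u(2) by (auto simp: T_def)
      ultimately show ?thesis using \<open>set es \<subseteq> {q, u} \<union> T\<close> by blast
    qed
    ultimately show "distinct (map y is @ es)" using that(3) by auto
    show "set (map y is @ es) \<subseteq> V" using that(4) inV qV u(1) T(1) by auto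
  qed (use that in \<open>auto simp: successively_append_iff last_map hd_map hd_append\<close>)
  have upt: "successively R (map y [i..<j])" for i j
    unfolding successively_map using stepR by (intro successively_upt)
  have qu: "q \<noteq> u" using u(2) by (auto simp: q_def)
  have TRu: "R z u" "R z q" if "z \<in> T" for z using T(2,3)[OF that] symR by blast+
  have noR2: "\<not> R (y i) (y (i + 2))" if i: "1 \<le> i" "i + 2 < 2 * n" for i
  proof
    assume chord: "R (y i) (y (i + 2))"
    have "has_cycle R V (2 * n + 1)"
    proof (rule replace[of "[1..<i + 1] @ [i + 2..<2 * n]" "[q, a, u]"])
      show "successively R (map y ([1..<i + 1] @ [i + 2..<2 * n]))"
        unfolding map_append successively_append_iff using upt chord i
        by (simp add: last_map hd_map del: upt_Suc)
    qed (use i ab T[OF ab(1)] T[OF ab(2)] qu Rq Ru TRu in \<open>auto simp: hd_append simp del: upt_Suc\<close>)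
    then show False using no(1) by simp
  qed
  have noR3: "\<not> R (y i) (y (i + 3))" if i: "1 \<le> i" "i + 3 < 2 * n" for i
  proof
    assume chord: "R (y i) (y (i + 3))"
    have "has_cycle R V (2 * n + 1)"
    proof (rule replace[of "[1..<i + 1] @ [i + 3..<2 * n]" "[q, a, b, u]"])
      show "successively R (map y ([1..<i + 1] @ [i + 3..<2 * n]))"
        unfolding map_append successively_append_iff using upt chord i
        by (simp add: last_map hd_map del: upt_Suc)
    qed (use i ab T[OF ab(1)] T[OF ab(2)] qu Rq Ru TRu in \<open>auto simp: hd_append simp del: upt_Suc\<close>)
    then show False using no(1) by simp
  qed
  have S2: "S (y i) (y (i + 2))" if i: "1 \<le> i" "i + 2 < 2 * n" for i
  proof -
    \<comment> \<open>A twin would inherit a cycle edge at the other end of the chord and turn it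
      into an \<open>R\<close>-chord of step three, taken above or, at the upper end, below.\<close>
    have "f (y i) \<noteq> f (y (i + 2))"
    proof
      assume eq: "f (y i) = f (y (i + 2))"
      show False
      proof (cases "i + 3 < 2 * n")
        case True
        have "R (y (i + 2)) (y (i + 3))" using stepR[of "i + 2"] by (simp add: eval_nat_numeral)
        then have "R (y i) (y (i + 3))" using twinR[OF inV inV inV eq[symmetric]] by blast
        then show False using noR3[OF i(1) True] by simp
      next
        case False
        then have i2: "1 \<le> i - 1" "i - 1 + 3 < 2 * n" "i - 1 + 3 = i + 2" using i n6 by auto
        have "R (y i) (y (i - 1))" using symR[OF stepR[of "i - 1"]] i by simp
        then have "R (y (i + 2)) (y (i - 1))" using twinR[OF inV inV inV eq] by blast
        then show False using noR3[OF i2(1,2)] i2(3) symR by simp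
      qed
    qed
    then show ?thesis using complete[OF inV inV] noR2[OF i] by blast
  qed
  have S3: "S (y i) (y (i + 3))" if i: "1 \<le> i" "i + 3 < 2 * n" for i
  proof -
    have "f (y i) \<noteq> f (y (i + 3))"
    proof
      assume eq: "f (y i) = f (y (i + 3))"
      have "R (y i) (y (i + 1))" using stepR[of i] by simp
      then have "R (y (i + 3)) (y (i + 1))" using twinR[OF inV inV inV eq] by blast
      then have "R (y (i + 1)) (y (i + 1 + 2))" using symR by (simp add: eval_nat_numeral)
      then show False using noR2[of "i + 1"] i by simp
    qed
    then show ?thesis using complete[OF inV inV] noR3[OF i] by blast
  qed
  \<comment> \<open>An edge to \<open>y 1\<close> lets \<open>w\<close> be inserted next to
    \<open>q\<close>. An edge to \<open>y 3\<close> leaves \<open>2 n - 3\<close> path vertices,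
    completed by \<open>q\<close>, \<open>t\<close>, \<open>u\<close>, \<open>w\<close>. The other
    end is symmetric.\<close>
  have noRT: "\<not> R w (y 1)" "\<not> R w (y 3)" "\<not> R w (y (2 * n - 1))" "\<not> R w (y (2 * n - 3))" if w: "w \<in> T" for w
  proof -
    have t: "\<exists>t\<in>T. t \<noteq> w" using ab by metis
    then obtain t where t: "t \<in> T" "t \<noteq> w" by blast
    show "\<not> R w (y 1)"
      using periodic_cycle_insert[OF y _ T(1)[OF w] T(4)[OF w], of 0] T(3)[OF w] no(1) n6
      by (auto simp: q_def)
    show "\<not> R w (y (2 * n - 1))"
      using periodic_cycle_insert[OF y _ T(1)[OF w] T(4)[OF w], of "2 * n - 1"] T(3)[OF w] no(1) n6 symR y2n
      by auto
    show "\<not> R w (y 3)"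
    proof
      assume "R w (y 3)"
      then have "has_cycle R V (2 * n + 1)"
        using n6 t w T[OF w] T[OF t(1)] TRu[OF t(1)] qu Rq upt[of 3 "2 * n"]
        by (intro replace[of "[3..<2 * n]" "[q, t, u, w]"]) auto
      then show False using no(1) by simp
    qed
    show "\<not> R w (y (2 * n - 3))"
    proof
      assume "R w (y (2 * n - 3))"
      then have "R (y (2 * n - 3)) w" by (rule symR)
      moreover have "last [1..<2 * n - 2] = 2 * n - 3" "hd [1..<2 * n - 2] = 1" using n6 by auto
      ultimately have "has_cycle R V (2 * n + 1)"
        using n6 t w T[OF w] T[OF t(1)] TRu[OF t(1)] TRu[OF w] qu Rq upt[of 1 "2 * n - 2"]
        by (intro replace[of "[1..<2 * n - 2]" "[w, u, t, q]"]) auto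
      then show False using no(1) by simp
    qed
  qed
  \<comment> \<open>\<open>y k\<close> is not in \<open>T\<close>, so its class takes at most
    \<open>n - 1\<close> vertices of \<open>T\<close>, and \<open>2 n + 1 - 2 * (n - 1) = 3\<close>.
    This allows the choice of \<open>w'\<close> different from \<open>w\<close>.\<close>
  have free: "3 \<le> card {w \<in> T. f w \<noteq> f (y i) \<and> f w \<noteq> f (y j)}" for i j
  proof -
    have small: "card {w \<in> T. f w = f (y k)} \<le> n - 1" for k
    proof -
      have "{w \<in> T. f w = f (y k)} \<subseteq> {x \<in> V. f x = f (y k)} - {y k}" using T(1,4) by blast
      then have "card {w \<in> T. f w = f (y k)} \<le> card ({x \<in> V. f x = f (y k)} - {y k})"
        using fin by (intro card_mono) auto
      also have "\<dots> = card {x \<in> V. f x = f (y k)} - 1" using fin inV by (intro card_Diff_singleton) auto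
      finally show ?thesis using class_le[of "f (y k)"] by linarith
    qed
    let ?F = "{w \<in> T. f w \<noteq> f (y i) \<and> f w \<noteq> f (y j)}" and ?C = "\<lambda>k. {w \<in> T. f w = f (y k)}"
    have "T \<subseteq> ?F \<union> (?C i \<union> ?C j)"
      by blast
    then have "card T \<le> card (?F \<union> (?C i \<union> ?C j))"
      using finT by (intro card_mono) auto
    also have "\<dots> \<le> card ?F + card (?C i \<union> ?C j)"
      by (rule card_Un_le)
    also have "card (?C i \<union> ?C j) \<le> card (?C i) + card (?C j)"
      by (rule card_Un_le)
    finally show ?thesis using cardT small[of i] small[of j] n6 by linarith
  qed
  have "{w \<in> T. f w \<noteq> f (y 1) \<and> f w \<noteq> f (y 3)} \<noteq> {}" using free[of 1 3] by (metis card.empty not_numeral_le_zero)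
  then obtain w where w: "w \<in> T" "f w \<noteq> f (y 1)" "f w \<noteq> f (y 3)" by blast
  have "\<not> {w \<in> T. f w \<noteq> f (y (2 * n - 1)) \<and> f w \<noteq> f (y (2 * n - 3))} \<subseteq> {w}"
  proof
    assume "{w \<in> T. f w \<noteq> f (y (2 * n - 1)) \<and> f w \<noteq> f (y (2 * n - 3))} \<subseteq> {w}"
    then have "card {w \<in> T. f w \<noteq> f (y (2 * n - 1)) \<and> f w \<noteq> f (y (2 * n - 3))} \<le> card {w}"
      by (intro card_mono) auto
    then show False using free[of "2 * n - 1" "2 * n - 3"] by simp
  qed
  then obtain w' where w': "w' \<in> T" "f w' \<noteq> f (y (2 * n - 1))" "f w' \<noteq> f (y (2 * n - 3))" "w' \<noteq> w" by blast
  have Sw: "S w (y 1)" "S (y 3) w" "S (y (2 * n - 1)) w'" "S w' (y (2 * n - 3))"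
  proof -
    have Sz: "S z (y i)" if "z \<in> T" "f z \<noteq> f (y i)" "\<not> R z (y i)" for z i
      using complete[OF T(1) inV] that by blast
    show "S w (y 1)" "S w' (y (2 * n - 3))" using Sz w w' noRT by blast+
    show "S (y 3) w" "S (y (2 * n - 1)) w'" using symS[OF Sz] w w' noRT by blast+
  qed
  have yne: "y i \<noteq> y j" if "i < 2 * n" "j < 2 * n" "i \<noteq> j" for i j using that yeq by simp
  have wy: "w \<noteq> y i" "w' \<noteq> y i" "y i \<noteq> w" "y i \<noteq> w'" for i using T(4)[OF w(1)] T(4)[OF w'(1)] by blast+
  consider "n = 6" | "n = 7" using n by blast
  then show False
  proof cases
    case 1
    \<comment> \<open>All \<open>2 n - 1\<close> path vertices and \<open>w\<close>,
      \<open>w'\<close>. The vertex \<open>w\<close> links \<open>y 3\<close> to \<open>y 1\<close>,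
      \<open>w'\<close> links the corresponding pair at the far end, and every other step is two or
      three.\<close>
    let ?xs = "[y 3, w, y 1, y 4, y 2, y 5, y 7, y 10, y 8, y 11, w', y 9, y 6]"
    have "has_cycle S V 13"
    proof (rule has_cycleI[of ?xs])
      show "distinct ?xs"
        using w'(4) 1 by (simp add: yne wy)
      show "successively S ?xs"
        using Sw S3[of 1] symS[OF S2[of 2]] S3[of 2] S2[of 5] S3[of 7] symS[OF S2[of 8]] S3[of 8]
          symS[OF S3[of 6]] 1 by simp
      show "S (last ?xs)
          (hd ?xs)"
        using symS[OF S3[of 3]] 1 by simp
    qed (use inV T(1) w(1) w'(1) in auto)
    then show False using no(2) 1 by simp
  next
    case 2
    let ?xs = "[y 3, w, y 1, y 4, y 2, y 5, y 7, y 9, y 12, y 10, y 13, w', y 11, y 8, y 6]"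
    have "has_cycle S V 15"
    proof (rule has_cycleI[of ?xs])
      show "distinct ?xs"
        using w'(4) 2 by (simp add: yne wy)
      show "successively S ?xs"
        using Sw S3[of 1] symS[OF S2[of 2]] S3[of 2] S2[of 5] S2[of 7] S3[of 9] symS[OF S2[of 10]] S3[of 10]
          symS[OF S3[of 8]] symS[OF S2[of 6]] 2 by simp
      show "S (last ?xs)
          (hd ?xs)"
        using symS[OF S3[of 3]] 2 by simp
    qed (use inV T(1) w(1) w'(1) in auto)
    then show False using no(2) 2 by simp
  qed
qed

text \<open>Iterating this step turns the multipartite graph into a complete one.\<close>

lemma separate_twin:
  assumes n: "n \<in> {6, 7}" and u: "u \<in> V" "u' \<in> V" "u \<noteq> u'" "f u = f u'"
    and deg: "3 * n + 1 \<le> card {z \<in> V. R u z}"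
    and no: "\<not> has_cycle R V (2 * n + 1)" "\<not> has_cycle S V (2 * n + 1)"
  shows "\<exists>f' R'. two_colour_multipartite V f' R' S n \<and> card (f ` V) < card (f' ` V) \<and>
           \<not> has_cycle R' V (2 * n + 1)"
proof -
  obtain k where k: "k \<notin> f ` V" using fin by (metis ex_new_if_finite finite_imageI infinite_UNIV_nat)
  define f' where "f' = f(u := k)"
  define P where "P = {z \<in> V. z \<noteq> u \<and> f z = f u}"
  \<comment> \<open>\<open>u\<close> becomes a class of its own and is joined to its former twins in
    the colour of its large degree. \<open>S\<close> is unchanged, so only \<open>R'\<close>-cycles
    through \<open>u\<close> are new.\<close>
  define R' where "R' x y \<longleftrightarrow> R x y \<or> (x = u \<and> y \<in> P) \<or> (y = u \<and> x \<in> P)" for x y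
  have kV: "f x \<noteq> k" if "x \<in> V" for x using k that by blast
  have "two_colour_multipartite V f' R' S n"
  proof
    show "f' x \<noteq> f' y" if "x \<in> V" "y \<in> V" "R' x y" for x y
      using that indR[of x y] kV[of x] kV[of y] by (auto simp: R'_def f'_def P_def)
    show "f' x \<noteq> f' y" if "x \<in> V" "y \<in> V" "S x y" for x y
      using that indS[of x y] kV[of x] kV[of y] by (auto simp: f'_def)
    show "R' x y \<or> S x y" if "x \<in> V" "y \<in> V" "f' x \<noteq> f' y" for x y
    proof -
      have "f x = f y \<or> R x y \<or> S x y" using complete that(1,2) by blast
      then show ?thesis using that by (auto simp: R'_def f'_def P_def split: if_splits)
    qed
    have f'f: "x = x' \<or> x \<noteq> u \<and> x' \<noteq> u \<and> f x = f x'" if "x \<in> V" "x' \<in> V" "f' x = f' x'" for x x'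
      using that kV[of x] kV[of x'] by (auto simp: f'_def split: if_splits)
    show "R' x' y" if "x \<in> V" "x' \<in> V" "y \<in> V" "f' x = f' x'" "R' x y" for x x' y
      using f'f[OF that(1,2,4)] that twinR[of x x' y] by (auto simp: R'_def P_def)
    show "S x' y" if "x \<in> V" "x' \<in> V" "y \<in> V" "f' x = f' x'" "S x y" for x x' y
      using f'f[OF that(1,2,4)] that twinS[of x x' y] by auto
    show "card {x \<in> V. f' x = a} \<le> n" for a
    proof (cases "a = k")
      case True
      then have "{x \<in> V. f' x = a} \<subseteq> {u}" using kV by (auto simp: f'_def split: if_splits)
      then have "card {x \<in> V. f' x = a} \<le> card {u}" by (intro card_mono) auto
      then show ?thesis using n by auto
    next
      case False
      then have "{x \<in> V. f' x = a} \<subseteq> {x \<in> V. f x = a}" by (auto simp: f'_def split: if_splits)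
      then show ?thesis using class_le[of a] card_mono[of "{x \<in> V. f x = a}" "{x \<in> V. f' x = a}"] fin by simp
    qed
  qed (use fin symR symS in \<open>auto simp: R'_def\<close>)
  moreover have "card (f ` V) < card (f' ` V)"
  proof -
    have "f ` V \<subseteq> f' ` V"
    proof
      fix a assume "a \<in> f ` V"
      then obtain z where z: "z \<in> V" "a = f z" by blast
      show "a \<in> f' ` V"
      proof (cases "z = u")
        case True
        then show ?thesis using z u by (intro image_eqI[of _ _ u']) (auto simp: f'_def)
      qed (use z in \<open>auto simp: f'_def intro!: image_eqI[of _ _ z]\<close>)
    qed
    moreover have "k \<in> f' ` V" using u(1) by (intro image_eqI[of _ _ u]) (auto simp: f'_def)
    ultimately have "f ` V \<subset> f' ` V" using k by blast
    then show ?thesis using fin by (intro psubset_card_mono) auto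
  qed
  moreover have "\<not> has_cycle R' V (2 * n + 1)"
  proof
    assume "has_cycle R' V (2 * n + 1)"
    then obtain x0 where x0: "periodic_cycle R' x0 (2 * n + 1)" "range x0 \<subseteq> V"
      using has_cycle_periodic[of R' V "2 * n + 1"] by auto
    show False
    proof (cases "u \<in> range x0")
      case False
      then have "periodic_cycle R x0 (2 * n + 1)" using x0(1) by (auto simp: periodic_cycle_def R'_def)
      then show False using periodic_cycle_has_cycle[OF _ x0(2)] no(1) by simp
    next
      case True
      then obtain j where j: "x0 j = u" by auto
      define x where "x i = x0 (i + j)" for i
      have x: "periodic_cycle R' x (2 * n + 1)" "range x \<subseteq> V" "x 0 = u"
        using periodic_cycle_shift[OF x0(1), of j] x0(2) j by (auto simp: x_def [abs_def])
      have inV: "x i \<in> V" for i using x(2) by blast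
      have step: "R' (x i) (x (Suc i))" for i using x(1) by (simp add: periodic_cycle_def)
      have "x (0 + (2 * n + 1)) = x 0" using x(1) unfolding periodic_cycle_def by blast
      then have xL: "x (2 * n + 1) = u" using x(3) by simp
      have inj: "inj_on x {..<2 * n + 1}" using x(1) by (simp add: periodic_cycle_def)
      have xu: "x i \<noteq> u" if "1 \<le> i" "i \<le> 2 * n" for i
        using inj_onD[OF inj, of i 0] that x(3) by auto
      have stepR: "R (x i) (x (Suc i))" if "1 \<le> i" "Suc i \<le> 2 * n" for i
        using step[of i] xu[of i] xu[of "Suc i"] that by (simp add: R'_def)
      define xs where "xs = map x [1..<2 * n + 1]"
      have path: "successively R xs"
        unfolding xs_def successively_map using stepR by (intro successively_upt) auto
      have dist: "distinct xs"
        unfolding xs_def distinct_map by (intro conjI inj_on_subset[OF inj]) auto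
      have n1: "1 \<le> n" "2 \<le> n" using n by auto
      have len: "length xs = 2 * n" by (simp add: xs_def del: upt_Suc)
      have ends: "last xs = x (2 * n)" "hd xs = x 1" "xs \<noteq> []"
        using n1 by (auto simp: xs_def last_map hd_map simp del: upt_Suc)
      have setx: "set xs \<subseteq> V" using inV by (auto simp: xs_def)
      have uxs: "u \<notin> set xs"
      proof
        assume "u \<in> set xs"
        then obtain i where "i \<in> {1..<2 * n + 1}" "u = x i"
          unfolding xs_def set_map set_upt by blast
        then show False using xu[of i] by simp
      qed
      have first: "R u (x 1) \<or> x 1 \<in> P" using step[of 0] x(3) by (auto simp: R'_def P_def)
      have final: "R (x (2 * n)) u \<or> x (2 * n) \<in> P" using step[of "2 * n"] xL by (auto simp: R'_def P_def)
      have replace: "has_cycle R V (2 * n + 1)" if "z \<in> V" "z \<notin> set xs" "R z (x 1)" "R (x (2 * n)) z" for z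
        using that path dist ends setx len
        by (intro has_cycleI[of "z # xs"]) (auto simp: successively_Cons)
      \<comment> \<open>If one cycle neighbour of \<open>u\<close> is a twin of \<open>u\<close> and
        the other an \<open>R\<close>-neighbour, then these two are \<open>R\<close>-adjacent.
        Removing \<open>u\<close> leaves an \<open>R\<close>-cycle of length \<open>2 n\<close>
        containing a twin of \<open>u\<close>.\<close>
      have shorter: False if close: "R (x (2 * n)) (x 1)" and q: "q \<in> set xs" "f q = f u" for q
      proof -
        let ?W = "set xs"
        have "has_cycle R ?W (2 * n)"
          using path dist ends len close by (intro has_cycleI[of "xs"]) (auto)
        moreover have "card ?W = 2 * n" using distinct_card[OF dist] len by simp
        ultimately obtain y where y: "periodic_cycle R y (2 * n)" "range y \<subseteq> ?W" "y 0 = q"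
          using has_cycle_periodic_from[of R ?W "2 * n" q] q(1) n1 by auto
        have "range y \<subseteq> V" "u \<notin> range y" using y(2) setx uxs by blast+
        then show False using twin_outside_even_cycle[OF n y(1) _ u(1) _ _ deg no] y(3) q(2) by simp
      qed
      have x1in: "x 1 \<in> set xs" "x (2 * n) \<in> set xs"
        using n1 by (auto simp: xs_def simp del: upt_Suc)
      consider "R u (x 1)" "R (x (2 * n)) u" | "x 1 \<in> P" "R (x (2 * n)) u"
        | "R u (x 1)" "x (2 * n) \<in> P" | "x 1 \<in> P" "x (2 * n) \<in> P"
        using first final by blast
      then show False
      proof cases
        case 1
        then show False using replace[OF u(1) uxs] no(1) by blast
      next
        case 2
        then have "R (x (2 * n)) (x 1)" 
          using twinR[OF u(1) inV[of 1] inV[of "2 * n"]] symR by (auto simp: P_def)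
        then show False using shorter[OF _ x1in(1)] 2(1) by (auto simp: P_def)
      next
        case 3
        then have "R (x (2 * n)) (x 1)" 
          using twinR[OF u(1) inV[of "2 * n"] inV[of 1]] by (auto simp: P_def)
        then show False using shorter[OF _ x1in(2)] 3(2) by (auto simp: P_def)
      next
        case 4
        \<comment> \<open>Both cycle neighbours are twins of \<open>u\<close>, so any
          \<open>R\<close>-neighbour of \<open>u\<close> off the cycle can take its place; the
          degree exceeds the \<open>2 n\<close> other cycle vertices.\<close>
        have "\<not> {z \<in> V. R u z} \<subseteq> set xs"
        proof
          assume "{z \<in> V. R u z} \<subseteq> set xs"
          then have "card {z \<in> V. R u z} \<le> card (set xs)"
            by (intro card_mono) auto
          also have "\<dots> = 2 * n" using distinct_card[OF dist] len by simp
          finally show False using deg n by auto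
        qed
        then obtain z where z: "z \<in> V" "R u z" "z \<notin> set xs" by blast
        have "R (x 1) z" "R (x (2 * n)) z"
          using twinR[OF u(1) inV[of 1] z(1)] twinR[OF u(1) inV[of "2 * n"] z(1)] 4 z(2) by (auto simp: P_def)
        then show False using replace[OF z(1,3)] no(1) symR by blast
      qed
    qed
  qed
  ultimately show ?thesis by blast
qed

end

text \<open>At least \<open>6 n + 1\<close> vertices lie outside the class of a vertex, so one
  colour has degree at least \<open>3 n + 1\<close> and a twin can be separated. Each separation
  adds a class and keeps \<open>V\<close>; once \<open>f\<close> is injective, the graph is
  complete.\<close>

lemma two_colour_multipartite_odd_cycle:
  assumes "two_colour_multipartite V f R S n" "n \<in> {6, 7}" "7 * n + 1 \<le> card V"
  shows "has_cycle R V (2 * n + 1) \<or> has_cycle S V (2 * n + 1)"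
  using assms(1)
proof (induction "card V - card (f ` V)" arbitrary: f R S rule: less_induct)
  case less
  interpret two_colour_multipartite V f R S n by (rule less.prems)
  show ?case
  proof (rule ccontr)
    assume neg: "\<not> ?case"
    have le: "card (g ` V) \<le> card V" for g :: "'a \<Rightarrow> nat" using fin by (rule card_image_le)
    show False
    proof (cases "inj_on f V")
      case True
      define R' where "R' x y \<longleftrightarrow> x \<in> V \<and> y \<in> V \<and> R x y" for x y
      define S' where "S' x y \<longleftrightarrow> x \<in> V \<and> y \<in> V \<and> S x y" for x y
      have "two_colour_complete V R' S'"
      proof
        show "R' x y \<or> S' x y" if "x \<in> V" "y \<in> V" "x \<noteq> y" for x y
          using that complete[of x y] inj_onD[OF True, of x y] by (auto simp: R'_def S'_def)
      qed (auto simp: R'_def S'_def intro: symR symS)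
      moreover have "\<not> R' x x" "\<not> S' x x" for x using indR[of x x] indS[of x x] by (auto simp: R'_def S'_def)
      ultimately have "has_cycle R' V (2 * n + 1) \<or> has_cycle S' V (2 * n + 1)"
        using two_colour_odd_cycle[of V R' S' n] fin assms(2,3) by auto
      then show False
        using neg has_cycle_mono[of R' V "2 * n + 1" V R] has_cycle_mono[of S' V "2 * n + 1" V S]
        by (auto simp: R'_def S'_def)
    next
      case False
      then obtain u u' where u: "u \<in> V" "u' \<in> V" "u \<noteq> u'" "f u = f u'" by (auto simp: inj_on_def)
      have "V \<subseteq> {x \<in> V. f x = f u} \<union> ({z \<in> V. R u z} \<union> {z \<in> V. S u z})"
        using complete[OF u(1)] by fastforce
      then have "card V \<le> card ({x \<in> V. f x = f u} \<union> ({z \<in> V. R u z} \<union> {z \<in> V. S u z}))"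
        using fin by (intro card_mono) auto
      also have "\<dots> \<le> card {x \<in> V. f x = f u} + card ({z \<in> V. R u z} \<union> {z \<in> V. S u z})" by (rule card_Un_le)
      also have "card ({z \<in> V. R u z} \<union> {z \<in> V. S u z}) \<le> card {z \<in> V. R u z} + card {z \<in> V. S u z}"
        by (rule card_Un_le)
      finally have "6 * n + 1 \<le> card {z \<in> V. R u z} + card {z \<in> V. S u z}"
        using class_le[of "f u"] assms(3) by linarith
      then consider "3 * n + 1 \<le> card {z \<in> V. R u z}" | "3 * n + 1 \<le> card {z \<in> V. S u z}" by linarith
      then show False
      proof cases
        case 1
        then obtain f' R' where f': "two_colour_multipartite V f' R' S n" "card (f ` V) < card (f' ` V)"
          "\<not> has_cycle R' V (2 * n + 1)" using separate_twin[OF assms(2) u 1] neg by blast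
        then have "has_cycle R' V (2 * n + 1) \<or> has_cycle S V (2 * n + 1)"
          using less.hyps[of f' R' S] le[of f'] by linarith
        then show False using f'(3) neg by blast
      next
        case 2
        then obtain f' S' where f': "two_colour_multipartite V f' S' R n" "card (f ` V) < card (f' ` V)"
          "\<not> has_cycle S' V (2 * n + 1)"
          using two_colour_multipartite.separate_twin[OF swapped assms(2) u 2] neg by blast
        then have "has_cycle S' V (2 * n + 1) \<or> has_cycle R V (2 * n + 1)"
          using less.hyps[of f' S' R] le[of f'] by linarith
        then show False using f'(3) neg by blast
      qed
    qed
  qed
qed

section \<open>Gallai colourings\<close>

definition gallai_on :: "('a \<Rightarrow> 'a \<Rightarrow> nat) \<Rightarrow> 'a set \<Rightarrow> bool" where
  "gallai_on c V \<longleftrightarrow> (\<forall>x\<in>V. \<forall>y\<in>V. \<forall>z\<in>V. distinct [x, y, z] \<longrightarrow>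
     c x y = c y z \<or> c y z = c x z \<or> c x y = c x z)"

lemma gallai_onD:
  assumes "gallai_on c V" "x \<in> V" "y \<in> V" "z \<in> V" "x \<noteq> y" "y \<noteq> z" "x \<noteq> z"
  shows "c x y = c y z \<or> c y z = c x z \<or> c x y = c x z"
  using assms unfolding gallai_on_def by auto

text \<open>Within \<open>V\<close> its classes are the components of colour \<open>i\<close>. Paths
  must stay inside \<open>V\<close>, so deleting a vertex can split a component.\<close>

definition colour_rel :: "('a \<Rightarrow> 'a \<Rightarrow> nat) \<Rightarrow> 'a set \<Rightarrow> nat \<Rightarrow> 'a rel" where
  "colour_rel c V i = {(x, y). x \<in> V \<and> y \<in> V \<and> x \<noteq> y \<and> c x y = i}\<^sup>*"

lemma colour_rel_refl: "(x, x) \<in> colour_rel c V i"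
  by (simp add: colour_rel_def)

lemma colour_rel_edge:
  assumes "x \<in> V" "y \<in> V" "x \<noteq> y" "c x y = i"
  shows "(x, y) \<in> colour_rel c V i"
  unfolding colour_rel_def using assms by (intro r_into_rtrancl) auto

lemma colour_rel_trans:
  "(x, y) \<in> colour_rel c V i \<Longrightarrow> (y, z) \<in> colour_rel c V i \<Longrightarrow> (x, z) \<in> colour_rel c V i"
  unfolding colour_rel_def by (rule rtrancl_trans)

lemma colour_rel_sym:
  assumes "\<And>x y. c x y = c y x" "(x, y) \<in> colour_rel c V i"
  shows "(y, x) \<in> colour_rel c V i"
proof -
  have "sym {(x, y). x \<in> V \<and> y \<in> V \<and> x \<noteq> y \<and> c x y = i}"
    using assms(1) by (auto simp: sym_def)
  then have "sym (colour_rel c V i)" unfolding colour_rel_def by (rule sym_rtrancl)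
  then show ?thesis using assms(2) by (meson symD)
qed

lemma colour_rel_first_edge:
  assumes "(x, y) \<in> colour_rel c V i" "x \<noteq> y"
  shows "\<exists>z\<in>V. z \<noteq> x \<and> c x z = i"
  using assms unfolding colour_rel_def by (auto elim: converse_rtranclE)

text \<open>Edges leaving a component of colour \<open>i\<close> do not have colour
  \<open>i\<close>. For an edge \<open>z z'\<close> of colour \<open>i\<close> inside it, the
  triangle with \<open>y\<close> forces the other two colours to agree.\<close>

lemma component_uniform:
  assumes sym: "\<And>x y. c x y = c y x" and g: "gallai_on c V"
    and "(x, x') \<in> colour_rel c V i" "x \<in> V" "y \<in> V" "(x, y) \<notin> colour_rel c V i"
  shows "c x y = c x' y"
  using assms(3) unfolding colour_rel_def
proof (induction rule: rtrancl_induct)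
  case (step z z')
  have z: "z \<in> V" "z' \<in> V" "z \<noteq> z'" "c z z' = i" using step.hyps(2) by auto
  have xz: "(x, z) \<in> colour_rel c V i" using step.hyps(1) by (simp add: colour_rel_def)
  then have xz': "(x, z') \<in> colour_rel c V i" using colour_rel_trans[OF xz colour_rel_edge[of z V z' c i]] z by simp
  have ne: "z \<noteq> y" "z' \<noteq> y" using xz xz' assms(6) by auto
  have "c z y \<noteq> i"
    using colour_rel_trans[OF xz colour_rel_edge[of z V y c i]] z(1) assms(5,6) ne(1) by blast
  moreover have "c z' y \<noteq> i"
    using colour_rel_trans[OF xz' colour_rel_edge[of z' V y c i]] z(2) assms(5,6) ne(2) by blast
  ultimately have "c z y = c z' y"
    using gallai_onD[OF g z(1,2) assms(5) z(3) ne(2,1)] z(4) by metis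
  then show ?case using step.IH by simp
qed simp

text \<open>The core of Gallai's theorem, by deletion of a vertex \<open>v\<close>: if every
  occurring colour connected \<open>A\<close>, every one of at least three colours would occur at
  \<open>v\<close>, but \<open>v\<close> turns out to see too few.\<close>

lemma gallai_disconnected_colour:
  assumes "finite A" and sym: "\<And>x y. c x y = c y x" and "gallai_on c A"
    and "\<And>r b. \<exists>x\<in>A. \<exists>y\<in>A. x \<noteq> y \<and> c x y \<notin> {r, b}"
  shows "\<exists>x\<in>A. \<exists>y\<in>A. \<exists>p\<in>A. \<exists>q\<in>A. x \<noteq> y \<and> (p, q) \<notin> colour_rel c A (c x y)"
  using assms(1,3,4)
proof (induction A rule: finite_psubset_induct)
  case (psubset A)
  note g = psubset.prems(1) and many = psubset.prems(2)
  show ?case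
  proof (rule ccontr)
    assume "\<not> ?case"
    then have conn: "(p, q) \<in> colour_rel c A (c x y)" if "x \<in> A" "y \<in> A" "x \<noteq> y" "p \<in> A" "q \<in> A" for x y p q
      using that by blast
    obtain v where v: "v \<in> A" using many by blast
    define B where "B = A - {v}"
    have BA: "B \<subset> A" using v by (auto simp: B_def)
    have gB: "gallai_on c B" using g by (auto simp: gallai_on_def B_def)
    have at_v: "\<exists>z\<in>A. z \<noteq> v \<and> c v z = c x y" if xy: "x \<in> A" "y \<in> A" "x \<noteq> y" for x y
    proof -
      obtain q where q: "q \<in> A" "q \<noteq> v" using xy by metis
      then show ?thesis using colour_rel_first_edge[OF conn[OF xy v q(1)]] by blast
    qed
    show False
    proof (cases "\<forall>r b. \<exists>x\<in>B. \<exists>y\<in>B. x \<noteq> y \<and> c x y \<notin> {r, b}")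
      case True
      then obtain e e' p q where B: "e \<in> B" "e' \<in> B" "e \<noteq> e'" "p \<in> B" "q \<in> B" "(p, q) \<notin> colour_rel c B (c e e')"
        using psubset.IH[OF BA gB] by blast
      define i where "i = c e e'"
      let ?C = "colour_rel c B i"
      have Csym: "(y, x) \<in> ?C" if "(x, y) \<in> ?C" for x y using colour_rel_sym[OF sym that] .
      \<comment> \<open>Colour \<open>i\<close> is connected in \<open>A\<close> but not in
        \<open>B\<close>, so each of its components in \<open>B\<close> is linked to
        \<open>v\<close> by an edge of colour \<open>i\<close>.\<close>
      have neighbour: "\<exists>z'\<in>B. (z, z') \<in> ?C \<and> c v z' = i" if z: "z \<in> B" for z
      proof -
        have "(z, v) \<in> colour_rel c A i" using conn[of e e' z v] B v z by (auto simp: i_def B_def)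
        moreover have "z \<noteq> v" using z by (simp add: B_def)
        ultimately show ?thesis unfolding colour_rel_def
        proof (induction rule: converse_rtrancl_induct)
          case (step s s')
          then have s: "s \<in> A" "s' \<in> A" "s \<noteq> s'" "c s s' = i" by auto
          show ?case
          proof (cases "s' = v")
            case True
            then show ?thesis using s step.prems sym by (intro bexI[of _ s]) (auto simp: B_def)
          next
            case False
            then obtain z' where z': "z' \<in> B" "(s', z') \<in> ?C" "c v z' = i" using step.IH by (auto simp: colour_rel_def)
            have "(s, s') \<in> ?C" using s False step.prems by (intro colour_rel_edge) (auto simp: B_def)
            then have "(s, z') \<in> ?C" using z'(2) colour_rel_trans by metis
            then show ?thesis using z' by (auto simp: colour_rel_def)
          qed
        qed simp
      qed
      \<comment> \<open>In the triangle of \<open>v\<close>, \<open>w\<close> and the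
        \<open>i\<close>-neighbour \<open>z'\<close> of \<open>v\<close> in the component of
        \<open>y\<close>, only the edge at \<open>z'\<close> and \<open>v\<close> has colour
        \<open>i\<close>. The other two agree, and uniformity carries the colour from
        \<open>z'\<close> to \<open>y\<close>.\<close>
      have outside: "c w y = c v w" if w: "w \<in> B" "c v w \<noteq> i" and y: "y \<in> B" "(w, y) \<notin> ?C" for w y
      proof -
        obtain z' where z': "z' \<in> B" "(y, z') \<in> ?C" "c v z' = i" using neighbour[OF y(1)] by blast
        have wz: "(w, z') \<notin> ?C" using y(2) z'(2) Csym colour_rel_trans by metis
        then have ne: "w \<noteq> z'" "c w z' \<noteq> i"
          using colour_rel_edge[of w B z' c i] w(1) z'(1) colour_rel_refl by metis+
        have "c v w = c w z' \<or> c w z' = c v z' \<or> c v w = c v z'"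
          using w z' ne v by (intro gallai_onD[OF g]) (auto simp: B_def)
        then have "c w z' = c v w" using ne z'(3) w(2) by metis
        moreover have "c y w = c z' w"
          using component_uniform[OF sym gB z'(2) y(1) w(1)] y(2) Csym by blast
        ultimately show ?thesis using sym by metis
      qed
      \<comment> \<open>Vertices of different components are compared through their common edge,
        vertices of one component through a vertex of another.\<close>
      have same: "c v w = c v w'" if w: "w \<in> B" "c v w \<noteq> i" and w': "w' \<in> B" "c v w' \<noteq> i" for w w'
      proof (cases "(w, w') \<in> ?C")
        case False
        then show ?thesis using outside[OF w w'(1)] outside[OF w' w(1)] Csym sym by metis
      next
        case True
        obtain y where y: "y \<in> B" "(w, y) \<notin> ?C"
          using B(4,5,6) Csym colour_rel_trans unfolding i_def by metis
        then have "(w', y) \<notin> ?C" using True colour_rel_trans by metis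
        then show ?thesis
          using outside[OF w y] outside[OF w' y(1)] component_uniform[OF sym gB True w(1) y] by simp
      qed
      have "\<exists>\<beta>. \<forall>w\<in>B. c v w \<in> {i, \<beta>}" using same by (metis insert_iff)
      then obtain \<beta> where \<beta>: "\<And>w. w \<in> B \<Longrightarrow> c v w \<in> {i, \<beta>}" by blast
      obtain x y where xy: "x \<in> A" "y \<in> A" "x \<noteq> y" "c x y \<notin> {i, \<beta>}" using many[of i \<beta>] by blast
      obtain z where "z \<in> A" "z \<noteq> v" "c v z = c x y" using at_v[OF xy(1-3)] by blast
      then show False using \<beta>[of z] xy(4) by (simp add: B_def)
    next
      case False
      then obtain r b where rb: "\<And>x y. x \<in> B \<Longrightarrow> y \<in> B \<Longrightarrow> x \<noteq> y \<Longrightarrow> c x y \<in> {r, b}" by blast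
      obtain x y where xy: "x \<in> A" "y \<in> A" "x \<noteq> y" "c x y \<notin> {r, b}" using many[of r b] by blast
      then have "x = v \<or> y = v" using rb by (auto simp: B_def)
      then obtain w where w: "w \<in> B" "c v w \<notin> {r, b}" using xy sym by (metis B_def Diff_iff empty_iff insert_iff)
      show False
      \<comment> \<open>The colour \<open>c v w\<close> occurs only at \<open>v\<close>. If all
        edges at \<open>v\<close> have it, no other colour reaches \<open>v\<close>; otherwise a
        vertex joined to \<open>v\<close> differently has no edge of this colour.\<close>
      proof (cases "\<forall>z\<in>B. c v z = c v w")
        case True
        obtain x y where xy: "x \<in> A" "y \<in> A" "x \<noteq> y" "c x y \<notin> {c v w, r}" using many[of "c v w" r] by blast
        then have xyB: "x \<in> B" "y \<in> B" using True sym by (metis B_def Diff_iff empty_iff insert_iff)+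
        obtain z where "z \<in> A" "z \<noteq> v" "c v z = c x y" using at_v[OF xy(1-3)] by blast
        then show False using True xy(4) by (simp add: B_def)
      next
        case False
        then obtain z where z: "z \<in> B" "c v z \<noteq> c v w" by blast
        have wA: "w \<in> A" "w \<noteq> v" using w(1) by (auto simp: B_def)
        have "(z, v) \<in> colour_rel c A (c v w)" using conn[OF v wA(1)] wA(2) z(1) v by (auto simp: B_def)
        then obtain s where s: "s \<in> A" "s \<noteq> z" "c z s = c v w"
          using colour_rel_first_edge[of z v c A] z(1) by (auto simp: B_def)
        have "s \<noteq> v" using s(3) z(2) sym by metis
        then have "s \<in> B" using s(1) by (simp add: B_def)
        then have "c z s \<in> {r, b}" using rb[OF z(1)] s(2) by metis
        then show False using s(3) w(2) by simp
      qed
    qed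
  qed
qed

text \<open>With at most two colours, singletons suffice. Otherwise the components of a disconnected
  colour are contracted to representatives \<open>h x\<close>, between which colours are well
  defined by \<open>component_uniform\<close>. An edge of that colour makes the set of
  representatives smaller, and disconnectedness leaves at least two.\<close>

lemma gallai_partition:
  assumes "finite A" and sym: "\<And>x y. c x y = c y x" and "gallai_on c A" "2 \<le> card A"
  shows "\<exists>(f :: 'a \<Rightarrow> nat) r b. (\<exists>x\<in>A. \<exists>y\<in>A. f x \<noteq> f y) \<and>
     (\<forall>x\<in>A. \<forall>y\<in>A. f x \<noteq> f y \<longrightarrow> c x y \<in> {r, b}) \<and>
     (\<forall>x\<in>A. \<forall>x'\<in>A. \<forall>y\<in>A. f x = f x' \<longrightarrow> f x \<noteq> f y \<longrightarrow> c x y = c x' y)"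
  using assms(1,3,4)
proof (induction A rule: finite_psubset_induct)
  case (psubset A)
  note g = psubset.prems(1)
  show ?case
  proof (cases "\<exists>r b. \<forall>x\<in>A. \<forall>y\<in>A. x \<noteq> y \<longrightarrow> c x y \<in> {r, b}")
    case True
    then obtain r b where rb: "\<And>x y. x \<in> A \<Longrightarrow> y \<in> A \<Longrightarrow> x \<noteq> y \<Longrightarrow> c x y \<in> {r, b}" by blast
    obtain f :: "'a \<Rightarrow> nat" where f: "inj_on f A"
      using finite_imp_inj_to_nat_seg[OF psubset.hyps] by blast
    obtain x y where "x \<in> A" "y \<in> A" "x \<noteq> y"
      using psubset.prems(2) card_le_Suc0_iff_eq[OF psubset.hyps] by fastforce
    moreover have "f x = f y \<longleftrightarrow> x = y" if "x \<in> A" "y \<in> A" for x y using f that by (auto simp: inj_on_def)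
    ultimately show ?thesis using rb by (intro exI[of _ f] exI[of _ r] exI[of _ b]) auto
  next
    case False
    then have "\<exists>x\<in>A. \<exists>y\<in>A. x \<noteq> y \<and> c x y \<notin> {r, b}" for r b by blast
    then obtain e e' p q where A: "e \<in> A" "e' \<in> A" "e \<noteq> e'" "p \<in> A" "q \<in> A" "(p, q) \<notin> colour_rel c A (c e e')"
      using gallai_disconnected_colour[OF psubset.hyps sym g] by blast
    define i where "i = c e e'"
    let ?C = "colour_rel c A i"
    have Csym: "(y, x) \<in> ?C" if "(x, y) \<in> ?C" for x y using colour_rel_sym[OF sym that] .
    define h where "h x = (SOME y. y \<in> A \<and> (x, y) \<in> ?C)" for x
    have h: "h x \<in> A \<and> (x, h x) \<in> ?C" if "x \<in> A" for x
      unfolding h_def by (rule someI[of _ x]) (use that colour_rel_refl in auto)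
    have hC: "h x = h y \<longleftrightarrow> (x, y) \<in> ?C" if "x \<in> A" "y \<in> A" for x y
    proof
      assume "h x = h y"
      then show "(x, y) \<in> ?C" using h that Csym colour_rel_trans by metis
    next
      assume "(x, y) \<in> ?C"
      then have "(x, z) \<in> ?C \<longleftrightarrow> (y, z) \<in> ?C" for z using Csym colour_rel_trans by metis
      then show "h x = h y" by (simp add: h_def)
    qed
    have hh: "h (h x) = h x" if "x \<in> A" for x using hC[of "h x" x] h[OF that] that Csym by blast
    have sub: "h ` A \<subseteq> A" using h by blast
    have "h e = h e'" using hC[OF A(1,2)] colour_rel_edge[of e A e' c i] A by (simp add: i_def)
    then have "\<not> (e \<in> h ` A \<and> e' \<in> h ` A)" using hh A(3) by fastforce
    then have psub: "h ` A \<subset> A" using sub A by blast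
    have ne: "h p \<noteq> h q" using hC[OF A(4,5)] A(6) by (simp add: i_def)
    have fin: "finite (h ` A)" using psubset.hyps by simp
    have "card {h p, h q} \<le> card (h ` A)" using A fin by (intro card_mono) auto
    then have card2: "2 \<le> card (h ` A)" using ne by simp
    have gh: "gallai_on c (h ` A)" using g sub unfolding gallai_on_def by blast
    obtain f r b where f0: "(\<exists>x\<in>h ` A. \<exists>y\<in>h ` A. f x \<noteq> (f y :: nat)) \<and>
      (\<forall>x\<in>h ` A. \<forall>y\<in>h ` A. f x \<noteq> f y \<longrightarrow> c x y \<in> {r, b}) \<and>
      (\<forall>x\<in>h ` A. \<forall>x'\<in>h ` A. \<forall>y\<in>h ` A. f x = f x' \<longrightarrow> f x \<noteq> f y \<longrightarrow> c x y = c x' y)"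
      using psubset.IH[OF psub gh card2] by (elim exE) (rule that)
    note f = f0[THEN conjunct1] f0[THEN conjunct2, THEN conjunct1, rule_format]
      f0[THEN conjunct2, THEN conjunct2, rule_format]
    have ch: "c x y = c (h x) (h y)" if xy: "x \<in> A" "y \<in> A" "h x \<noteq> h y" for x y
    proof -
      have "(x, y) \<notin> ?C" using hC xy by blast
      then have "c x y = c (h x) y" using component_uniform[OF sym g _ xy(1,2)] h xy by blast
      moreover have "(y, h x) \<notin> ?C" using hC[of y "h x"] hh[OF xy(1)] h[OF xy(1)] xy by metis
      then have "c y (h x) = c (h y) (h x)"
        using component_uniform[OF sym g _ xy(2), of "h y" i "h x"] h xy by blast
      ultimately show ?thesis using sym by metis
    qed
    show ?thesis
    proof (rule exI[of _ "f \<circ> h"], rule exI[of _ r], rule exI[of _ b], intro conjI ballI impI)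
      show "\<exists>x\<in>A. \<exists>y\<in>A. (f \<circ> h) x \<noteq> (f \<circ> h) y" using f(1) by auto
      show "c x y \<in> {r, b}" if xy: "x \<in> A" "y \<in> A" "(f \<circ> h) x \<noteq> (f \<circ> h) y" for x y
        using ch[of x y] f(2)[of "h x" "h y"] xy by (metis comp_apply imageI)
      show "c x y = c x' y" if xy: "x \<in> A" "x' \<in> A" "y \<in> A" "(f \<circ> h) x = (f \<circ> h) x'" "(f \<circ> h) x \<noteq> (f \<circ> h) y" for x x' y
        using ch[of x y] ch[of x' y] f(3)[of "h x" "h x'" "h y"] xy by (metis comp_apply imageI)
    qed
  qed
qed

text \<open>Vertices outside a module are attached to it in a single colour. The colours of the edges
  between them can be replaced so that no colours besides those of the attachments and one spare
  colour \<open>i0\<close> are needed: a cycle meets the vertices attached in smaller colours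
  only between two vertices attached in its own colour, where they can be replaced by unused vertices of
  the module.\<close>

lemma recolour_attachments:
  fixes c :: "'a \<Rightarrow> 'a \<Rightarrow> nat"
  assumes fin: "finite W" and AW: "A \<subseteq> W" and sym: "\<And>x y. c x y = c y x" and g: "gallai_on c A"
    and lab: "\<And>v a. v \<in> W - A \<Longrightarrow> a \<in> A \<Longrightarrow> c v a = lab v"
    and i0: "\<And>v. v \<in> W - A \<Longrightarrow> lab v \<noteq> i0"
    and small: "\<And>i. card {v \<in> W - A. lab v = i} \<le> 2 * n"
    and large: "2 * n + 1 \<le> card A"
    and no: "\<And>i. \<not> has_cycle (\<lambda>x y. c x y = i) W (2 * n + 1)"
  obtains c' where "\<And>x y. c' x y = c' y x" "gallai_on c' W"
    "\<And>i. \<not> has_cycle (\<lambda>x y. c' x y = i) W (2 * n + 1)"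
    "\<And>x y. x \<in> A \<Longrightarrow> y \<in> A \<Longrightarrow> c' x y = c x y"
    "\<And>x y. x \<in> W - A \<Longrightarrow> y \<in> A \<Longrightarrow> c' x y = lab x"
    "\<And>x y. x \<in> W - A \<Longrightarrow> y \<in> W - A \<Longrightarrow> c' x y = (if lab x = lab y then i0 else max (lab x) (lab y))"
proof -
  \<comment> \<open>Taking the larger label gives a triangle with three labels its largest colour
    twice.\<close>
  define c' where "c' x y = (if x \<in> A then if y \<in> A then c x y else lab y
     else if y \<in> A then lab x else if lab x = lab y then i0 else max (lab x) (lab y))" for x y
  have sym': "c' x y = c' y x" for x y using sym by (auto simp: c'_def max_def)
  have g': "gallai_on c' W"
    unfolding gallai_on_def
  proof (intro ballI impI)
    fix x y z assume "x \<in> W" "y \<in> W" "z \<in> W" "distinct [x, y, z]"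
    then show "c' x y = c' y z \<or> c' y z = c' x z \<or> c' x y = c' x z"
      using gallai_onD[OF g, of x y z] by (cases "x \<in> A"; cases "y \<in> A"; cases "z \<in> A") (auto simp: c'_def max_def)
  qed
  have no': "\<not> has_cycle (\<lambda>x y. c' x y = \<gamma>) W (2 * n + 1)" for \<gamma>
  proof
    assume "has_cycle (\<lambda>x y. c' x y = \<gamma>) W (2 * n + 1)"
    then obtain x where x: "periodic_cycle (\<lambda>x y. c' x y = \<gamma>) x (2 * n + 1)" "range x \<subseteq> W"
      using has_cycle_periodic[of _ W "2 * n + 1"] by auto
    have step: "c' (x t) (x (Suc t)) = \<gamma>" for t using x(1) by (simp add: periodic_cycle_def)
    have xW: "x t \<in> W" for t using x(2) by blast
    have cardx: "card (x ` {..<2 * n + 1}) = 2 * n + 1"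
      using x(1) by (subst card_image) (auto simp: periodic_cycle_def)
    have finx: "finite (range x)" using x(2) fin finite_subset by blast
    show False
    \<comment> \<open>No label equals \<open>i0\<close>, so an \<open>i0\<close>-cycle stays in
      \<open>A\<close> or within one label class, which has at most \<open>2 n\<close>
      vertices.\<close>
    proof (cases "\<gamma> = i0")
      case True
      have inv: "(x t \<in> A \<longleftrightarrow> x (Suc t) \<in> A) \<and> (x t \<notin> A \<longrightarrow> lab (x t) = lab (x (Suc t)))" for t
        using step[of t] i0[of "x t"] i0[of "x (Suc t)"] xW[of t] xW[of "Suc t"] True
        by (auto simp: c'_def max_def split: if_splits)
      have all: "(x t \<in> A \<longleftrightarrow> x 0 \<in> A) \<and> (x 0 \<notin> A \<longrightarrow> lab (x t) = lab (x 0))" for t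
      proof (induction t)
        case (Suc t)
        then show ?case using inv[of t] by metis
      qed simp
      show False
      proof (cases "x 0 \<in> A")
        case True
        then have "range x \<subseteq> A" using all by blast
        then have "has_cycle (\<lambda>x y. c' x y = \<gamma>) A (2 * n + 1)" using periodic_cycle_has_cycle[OF x(1)] by simp
        then have "has_cycle (\<lambda>x y. c x y = \<gamma>) W (2 * n + 1)"
          by (rule has_cycle_mono[OF _ AW]) (auto simp: c'_def)
        then show False using no by blast
      next
        case False
        then have "x ` {..<2 * n + 1} \<subseteq> {v \<in> W - A. lab v = lab (x 0)}" using all xW by auto
        then have "2 * n + 1 \<le> card {v \<in> W - A. lab v = lab (x 0)}"
          using card_mono[of "{v \<in> W - A. lab v = lab (x 0)}" "x ` {..<2 * n + 1}"] cardx fin by simp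
        then show False using small[of "lab (x 0)"] by simp
      qed
    next
      case False
      define Lo where "Lo = {v \<in> range x. v \<notin> A \<and> lab v \<noteq> \<gamma>}"
      have "card Lo \<le> card (A - range x)"
      proof -
        have fA: "finite A" using fin AW finite_subset by blast
        have "range x = x ` {..<2 * n + 1}"
        proof
          show "range x \<subseteq> x ` {..<2 * n + 1}"
          proof
            fix v assume "v \<in> range x"
            then obtain t where "v = x t" by blast
            then have "v = x (t mod (2 * n + 1))" using periodic_cycle_eq_iff[OF x(1)] by simp
            then show "v \<in> x ` {..<2 * n + 1}" by (metis imageI lessThan_iff mod_less_divisor zero_less_Suc Suc_eq_plus1)
          qed
        qed auto
        then have r: "card (range x) = 2 * n + 1" using cardx by simp
        have "card Lo + card (range x \<inter> A) = card (Lo \<union> (range x \<inter> A))"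
          using finx by (subst card_Un_disjoint) (auto simp: Lo_def)
        also have "\<dots> \<le> card (range x)" using finx by (intro card_mono) (auto simp: Lo_def)
        finally have "card Lo + card (range x \<inter> A) \<le> card A" using r large by simp
        moreover have "card A = card (A - range x) + card (range x \<inter> A)"
          using fA by (metis Int_commute add.commute card_Int_Diff)
        ultimately show ?thesis by simp
      qed
      moreover have "finite Lo" "finite (A - range x)" using finx fin AW finite_subset by (auto simp: Lo_def)
      ultimately obtain g where g: "inj_on g Lo" "g ` Lo \<subseteq> A - range x"
        using card_le_inj[of Lo "A - range x"] by blast
      define \<psi> where "\<psi> v = (if v \<in> Lo then g v else v)" for v
      define z where "z t = \<psi> (x t)" for t
      have inj\<psi>: "inj_on \<psi> (range x)"
      proof (rule inj_onI)
        fix p q assume "p \<in> range x" "q \<in> range x" "\<psi> p = \<psi> q"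
        then show "p = q" using g inj_onD[OF g(1), of p q] unfolding \<psi>_def
          by (metis Diff_iff image_subset_iff)
      qed
      have "periodic_cycle (\<lambda>x y. c x y = \<gamma>) z (2 * n + 1)"
      proof -
        have "inj_on z {..<2 * n + 1}"
        proof (rule inj_onI)
          fix s t assume st: "s \<in> {..<2 * n + 1}" "t \<in> {..<2 * n + 1}" "z s = z t"
          then have "x s = x t" using inj\<psi> by (auto simp: inj_on_def z_def)
          then show "s = t" using x(1) st(1,2) by (auto simp: periodic_cycle_def inj_on_def)
        qed
        moreover have "z (t + (2 * n + 1)) = z t" for t
          using x(1) unfolding periodic_cycle_def z_def by metis
        moreover have "c (z t) (z (Suc t)) = \<gamma>" for t
        proof -
          define p q where "p = x t" "q = x (Suc t)"
          have pq: "p \<in> W" "q \<in> W" "p \<in> range x" "q \<in> range x" "c' p q = \<gamma>" using xW step by (auto simp: p_q_def)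
          have gA: "g v \<in> A" if "v \<in> Lo" for v using g(2) that by blast
          have lab': "c a v = lab v" if "v \<in> W - A" "a \<in> A" for v a using lab[OF that] sym by metis
          have "c (\<psi> p) (\<psi> q) = \<gamma>"
          proof (cases "p \<in> A"; cases "q \<in> A")
            assume "p \<in> A" "q \<in> A"
            then show ?thesis using pq(5) by (simp add: \<psi>_def Lo_def c'_def)
          next
            assume a: "p \<in> A" "q \<notin> A"
            then have "lab q = \<gamma>" using pq(5) by (simp add: c'_def)
            then show ?thesis using a lab'[of q p] pq(2) by (simp add: \<psi>_def Lo_def)
          next
            assume a: "p \<notin> A" "q \<in> A"
            then have "lab p = \<gamma>" using pq(5) by (simp add: c'_def)
            then show ?thesis using a lab[of p q] pq(1) by (simp add: \<psi>_def Lo_def)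
          next
            assume a: "p \<notin> A" "q \<notin> A"
            then have m: "lab p \<noteq> lab q" "max (lab p) (lab q) = \<gamma>" using pq(5) False by (auto simp: c'_def split: if_splits)
            then consider "lab p = \<gamma>" "lab q \<noteq> \<gamma>" | "lab q = \<gamma>" "lab p \<noteq> \<gamma>" by (metis max_def)
            then show ?thesis
            proof cases
              case 1
              then have "q \<in> Lo" "p \<notin> Lo" using a pq by (auto simp: Lo_def)
              then show ?thesis using lab[of p "g q"] gA[of q] a pq(1) 1 by (simp add: \<psi>_def)
            next
              case 2
              then have "p \<in> Lo" "q \<notin> Lo" using a pq by (auto simp: Lo_def)
              then show ?thesis using lab'[of q "g p"] gA[of p] a pq(2) 2 by (simp add: \<psi>_def)
            qed
          qed
          then show ?thesis by (simp add: z_def p_q_def)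
        qed
        ultimately show ?thesis by (simp add: periodic_cycle_def)
      qed
      moreover have "range z \<subseteq> W" using g(2) AW x(2) by (auto simp: z_def \<psi>_def)
      ultimately have "has_cycle (\<lambda>x y. c x y = \<gamma>) W (2 * n + 1)"
        using periodic_cycle_has_cycle[of _ z "2 * n + 1" W] by simp
      then show False using no by blast
    qed
  qed
  show thesis
    by (rule that[of c']) (use sym' g' no' in \<open>auto simp: c'_def\<close>)
qed

section \<open>The statement proved by induction on the number of colours\<close>

definition good_colouring :: "nat \<Rightarrow> nat set \<Rightarrow> ('a \<Rightarrow> 'a \<Rightarrow> nat) \<Rightarrow> 'a set \<Rightarrow> bool" where
  "good_colouring m K c V \<longleftrightarrow> finite V \<and> finite K \<and> (\<forall>x y. c x y = c y x) \<and>
     (\<forall>x\<in>V. \<forall>y\<in>V. x \<noteq> y \<longrightarrow> c x y \<in> K) \<and> gallai_on c V \<and>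
     (\<forall>i. \<not> has_cycle (\<lambda>x y. c x y = i) V m)"

text \<open>Arbitrary colour sets \<open>K\<close> allow a colour to be dropped without renaming the
  others. The vertex type is fixed because a quantifier cannot range over types.\<close>

definition gallai_cycle_bound :: "nat \<Rightarrow> nat \<Rightarrow> bool" where
  "gallai_cycle_bound n k \<longleftrightarrow> (\<forall>(V :: nat set) c K.
     good_colouring (2 * n + 1) K c V \<longrightarrow> card K = k \<longrightarrow> card V \<le> n * 2 ^ k)"

lemma good_colouring_subset:
  assumes "good_colouring m K c V" "U \<subseteq> V" "m > 0" "finite K'"
    and "\<And>x y. x \<in> U \<Longrightarrow> y \<in> U \<Longrightarrow> x \<noteq> y \<Longrightarrow> c x y \<in> K'"
  shows "good_colouring m K' c U"
proof -
  have "gallai_on c U" using assms(1,2) unfolding good_colouring_def gallai_on_def by blast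
  moreover have "\<not> has_cycle (\<lambda>x y. c x y = i) U m" for i
    using assms(1) has_cycle_mono[OF _ assms(2,3), of "\<lambda>x y. c x y = i" "\<lambda>x y. c x y = i"]
    unfolding good_colouring_def by blast
  moreover have "finite U" using assms(1,2) finite_subset unfolding good_colouring_def by blast
  ultimately show ?thesis using assms(1,4,5) unfolding good_colouring_def by blast
qed

text \<open>The edges within \<open>W - A\<close> may use colours outside \<open>K'\<close>;
  recolouring brings them into \<open>K'\<close>, so the bound for \<open>K'\<close> covers
  \<open>W\<close> and not only \<open>A\<close>. If \<open>A\<close> is too small for recolouring,
  \<open>total\<close> suffices.\<close>

lemma attachment_bound:
  fixes W :: "nat set"
  assumes bound: "gallai_cycle_bound n (card K')" and good: "good_colouring (2 * n + 1) K c V"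
    and W: "W \<subseteq> V" "A \<subseteq> W" and "finite K'"
    and K': "\<And>x y. x \<in> A \<Longrightarrow> y \<in> A \<Longrightarrow> x \<noteq> y \<Longrightarrow> c x y \<in> K'"
    and lab: "\<And>v a. v \<in> W - A \<Longrightarrow> a \<in> A \<Longrightarrow> c v a = lab v"
    and i0: "i0 \<in> K'" "\<And>v. v \<in> W - A \<Longrightarrow> lab v \<in> K' - {i0}"
    and small: "\<And>i. card {v \<in> W - A. lab v = i} \<le> 2 * n"
    and total: "2 * n + card (W - A) \<le> n * 2 ^ card K'"
  shows "card W \<le> n * 2 ^ card K'"
proof (cases "2 * n + 1 \<le> card A")
  case False
  have "finite W" using good W(1) finite_subset unfolding good_colouring_def by blast
  then have "card W = card (W - A) + card A"
    using W(2) by (metis add.commute card_Diff_subset card_mono finite_subset le_add_diff_inverse)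
  then show ?thesis using False total by simp
next
  case True
  have gW: "good_colouring (2 * n + 1) K c W"
  proof (rule good_colouring_subset[OF good W(1)])
    show "finite K" using good by (simp add: good_colouring_def)
    show "c x y \<in> K" if "x \<in> W" "y \<in> W" "x \<noteq> y" for x y
      using that good W(1) unfolding good_colouring_def by blast
  qed simp
  have fW: "finite W" and symc: "\<And>x y. c x y = c y x" and gcW: "gallai_on c W"
    and nocyc: "\<And>i. \<not> has_cycle (\<lambda>x y. c x y = i) W (2 * n + 1)"
    using gW unfolding good_colouring_def by blast+
  have gA: "gallai_on c A" using gcW W(2) unfolding gallai_on_def by blast
  have ne: "lab v \<noteq> i0" if "v \<in> W - A" for v using i0(2)[OF that] by simp
  obtain c' where c': "\<And>x y. c' x y = c' y x" "gallai_on c' W"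
    "\<And>i. \<not> has_cycle (\<lambda>x y. c' x y = i) W (2 * n + 1)"
    "\<And>x y. x \<in> A \<Longrightarrow> y \<in> A \<Longrightarrow> c' x y = c x y"
    "\<And>x y. x \<in> W - A \<Longrightarrow> y \<in> A \<Longrightarrow> c' x y = lab x"
    "\<And>x y. x \<in> W - A \<Longrightarrow> y \<in> W - A \<Longrightarrow> c' x y = (if lab x = lab y then i0 else max (lab x) (lab y))"
    by (rule recolour_attachments[OF fW W(2) symc gA lab ne small True nocyc]) (assumption | rule that)+
  have "c' x y \<in> K'" if "x \<in> W" "y \<in> W" "x \<noteq> y" for x y
    using that K'[of x y] i0(1) i0(2)[of x] i0(2)[of y] c'(4,5,6)[of x y] c'(5)[of y x] c'(1)[of x y]
    by (cases "x \<in> A"; cases "y \<in> A") (auto simp: max_def)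
  then have "good_colouring (2 * n + 1) K' c' W"
    using c'(1,2,3) fW assms(5) by (simp add: good_colouring_def)
  then show ?thesis using bound unfolding gallai_cycle_bound_def by blast
qed

section \<open>The induction step\<close>

text \<open>A set \<open>A\<close> of least size among the modules to which every colour attaches at most \<open>n\<close>
  vertices, together with a Gallai partition of \<open>A\<close> into the classes of \<open>f\<close>.\<close>

locale gallai_core =
  fixes n k :: nat and K :: "nat set" and c :: "nat \<Rightarrow> nat \<Rightarrow> nat" and V A :: "nat set"
    and lab f :: "nat \<Rightarrow> nat" and r b :: nat
  assumes n: "n \<in> {6, 7}" and k: "3 \<le> k" and cardK: "card K = k"
    and bound1: "gallai_cycle_bound n (k - 1)" and bound2: "gallai_cycle_bound n (k - 2)"
    and good: "good_colouring (2 * n + 1) K c V"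
    and AV: "A \<subseteq> V"
    and lab: "\<And>v a. v \<in> V - A \<Longrightarrow> a \<in> A \<Longrightarrow> c v a = lab v"
    and labK: "\<And>v. v \<in> V - A \<Longrightarrow> lab v \<in> K"
    and labn: "\<And>i. card {v \<in> V - A. lab v = i} \<le> n"
    and rK: "r \<in> K" and bK: "b \<in> K" and rb: "r \<noteq> b"
    and cross: "\<And>x y. x \<in> A \<Longrightarrow> y \<in> A \<Longrightarrow> f x \<noteq> f y \<Longrightarrow> c x y \<in> {r, b}"
    and unif: "\<And>x x' y. x \<in> A \<Longrightarrow> x' \<in> A \<Longrightarrow> y \<in> A \<Longrightarrow> f x = f x' \<Longrightarrow> f x \<noteq> f y \<Longrightarrow> c x y = c x' y"
    and minimal: "\<And>A' lab'. A' \<subset> A \<Longrightarrow> A' \<noteq> {} \<Longrightarrow>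
       (\<And>v a. v \<in> V - A' \<Longrightarrow> a \<in> A' \<Longrightarrow> c v a = lab' v) \<Longrightarrow> \<exists>i. n < card {v \<in> V - A'. lab' v = i}"
    and large: "n * 2 ^ k < card V"
begin

lemma swapped: "gallai_core n k K c V A lab f b r"
proof
  show "c x y \<in> {b, r}" if "x \<in> A" "y \<in> A" "f x \<noteq> f y" for x y
    using cross[OF that] by blast
qed (fact n k cardK bound1 bound2 good AV lab labK labn rK bK rb[symmetric] unif minimal large)+

lemma finV: "finite V" and sym: "c x y = c y x" and gallai: "gallai_on c V"
  and nocyc: "\<not> has_cycle (\<lambda>x y. c x y = i) V (2 * n + 1)" and finK: "finite K"
  and inK: "x \<in> V \<Longrightarrow> y \<in> V \<Longrightarrow> x \<noteq> y \<Longrightarrow> c x y \<in> K"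
  using good by (auto simp: good_colouring_def)

lemma n6: "6 \<le> n"
  using n by auto

lemma powers: "(2::nat) ^ k = 2 * 2 ^ (k - 1)" "(2::nat) ^ (k - 1) = 2 * 2 ^ (k - 2)" "(2::nat) \<le> 2 ^ (k - 2)"
  "k * n \<le> n * 2 ^ (k - 1)" "4 * n \<le> n * 2 ^ (k - 1)"
proof -
  have k': "k = Suc (k - 1)" "k - 1 = Suc (k - 2)" using k by auto
  show "(2::nat) ^ k = 2 * 2 ^ (k - 1)" using k'(1) by (metis power_Suc)
  show p: "(2::nat) ^ (k - 1) = 2 * 2 ^ (k - 2)" using k'(2) by (metis power_Suc)
  have "(2::nat) ^ 1 \<le> 2 ^ (k - 2)" using k by (intro power_increasing) auto
  then show p2: "(2::nat) \<le> 2 ^ (k - 2)" by simp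
  have "k - 1 < 2 ^ (k - 1)" by (rule less_exp)
  then have "k \<le> 2 ^ (k - 1)" by linarith
  then show "k * n \<le> n * 2 ^ (k - 1)" by (simp add: mult.commute)
  have "4 \<le> (2::nat) ^ (k - 1)" using p p2 by linarith
  then show "4 * n \<le> n * 2 ^ (k - 1)" by (simp add: mult.commute)
qed

section \<open>The surroundings of the core and bounds for sets that lack a colour\<close>

definition part :: "nat \<Rightarrow> nat set" where
  "part t = {x \<in> A. f x = t}"

definition U :: "nat set" where
  "U = A \<union> {v \<in> V - A. lab v \<in> {r, b}}"

definition Oth :: "nat set" where
  "Oth = {v \<in> V - A. lab v \<notin> {r, b}}"

lemma UOth: "U \<union> Oth = V" "U \<inter> Oth = {}" "U \<subseteq> V" "A \<subseteq> U" "Oth \<subseteq> V" "part t \<subseteq> A"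
  using AV by (auto simp: U_def Oth_def part_def)

lemma U_swapped: "gallai_core.U V A lab b r = U"
  using swapped by (auto simp: U_def gallai_core.U_def)

lemma partV: "part t \<subseteq> V"
  using UOth(6) AV by blast

lemma finite_subsets: "X \<subseteq> V \<Longrightarrow> finite X"
  using finV finite_subset by blast

lemma card_Oth: "card Oth \<le> (k - 2) * n"
proof -
  let ?X = "\<lambda>i. {v \<in> V - A. lab v = i}"
  have "Oth \<subseteq> (\<Union>i\<in>K - {r, b}. ?X i)" using labK by (auto simp: Oth_def)
  then have "card Oth \<le> card (\<Union>i\<in>K - {r, b}. ?X i)"
    using finV finK by (intro card_mono) auto
  also have "\<dots> \<le> (\<Sum>i\<in>K - {r, b}. card (?X i))"
    using finK by (intro card_UN_le) auto
  also have "\<dots> \<le> (\<Sum>i\<in>K - {r, b}. n)" using labn by (intro sum_mono) auto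
  also have "\<dots> = (k - 2) * n"
    using rK bK rb cardK finK by (simp add: card_Diff_subset numeral_2_eq_2)
  finally show ?thesis .
qed

lemma third_colour: obtains i0 where "i0 \<in> K" "i0 \<noteq> r" "i0 \<noteq> b"
proof -
  have "\<not> K \<subseteq> {r, b}"
  proof
    assume "K \<subseteq> {r, b}"
    then have "card K \<le> card {r, b}" by (intro card_mono) auto
    then show False using cardK k by (auto simp: card_insert_if split: if_splits)
  qed
  then show thesis using that by blast
qed

lemma to_part:
  assumes "v \<in> U" "v \<notin> part t"
  shows "(\<forall>x\<in>part t. c v x = r) \<or> (\<forall>x\<in>part t. c v x = b)"
proof (cases "v \<in> A")
  case False
  then have "lab v \<in> {r, b}" "v \<in> V - A" using assms(1) by (auto simp: U_def)
  then show ?thesis using lab[of v] UOth(6) by blast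
next
  case True
  have ne: "f v \<noteq> t" using True assms(2) by (simp add: part_def)
  have "c v x = c v x'" if "x \<in> part t" "x' \<in> part t" for x x'
    using unif[of x x' v] that True ne sym by (auto simp: part_def)
  moreover have "c v x \<in> {r, b}" if "x \<in> part t" for x
    using cross[of v x] that True ne by (auto simp: part_def)
  ultimately show ?thesis by (metis insert_iff empty_iff)
qed

lemma no_edge:
  assumes "X \<subseteq> V" "Y \<subseteq> V" "X \<inter> Y = {}" "\<And>x y. x \<in> X \<Longrightarrow> y \<in> Y \<Longrightarrow> c x y = i"
    and "n + 1 \<le> card X" "n \<le> card Y" "u \<in> X" "v \<in> X" "u \<noteq> v"
  shows "c u v \<noteq> i"
proof
  assume "c u v = i"
  then have "has_cycle (\<lambda>x y. c x y = i) (X \<union> Y) (2 * n + 1)"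
    using assms finite_subsets sym n6 by (intro bipartite_edge_cycle[of X Y _ n u v]) auto
  then have "has_cycle (\<lambda>x y. c x y = i) V (2 * n + 1)"
    by (rule has_cycle_mono) (use assms in auto)
  then show False using nocyc by blast
qed

lemma no_apex:
  assumes "X \<subseteq> V" "Y \<subseteq> V" "X \<inter> Y = {}" "\<And>x y. x \<in> X \<Longrightarrow> y \<in> Y \<Longrightarrow> c x y = i"
    and "n \<le> card X" "n \<le> card Y" "v \<in> V" "v \<notin> X" "v \<notin> Y" "x \<in> X" "y \<in> Y" "c v x = i" "c v y = i"
  shows False
proof -
  have "has_cycle (\<lambda>x y. c x y = i) (insert v (X \<union> Y)) (2 * n + 1)"
    using assms finite_subsets sym n6 by (intro bipartite_apex_cycle[of X Y _ x y n v]) auto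
  then have "has_cycle (\<lambda>x y. c x y = i) V (2 * n + 1)"
    by (rule has_cycle_mono) (use assms in auto)
  then show False using nocyc by blast
qed

text \<open>Dropping \<open>q\<close> from the colours of \<open>B\<close> leaves \<open>p\<close>
  as the spare colour, since \<open>Oth\<close> is attached in third colours only. Thus
  \<open>Oth\<close> is counted at no cost.\<close>

lemma attach_other:
  assumes B: "B \<subseteq> A" and pq: "p \<in> {r, b}" "q \<in> {r, b}" "p \<noteq> q"
    and free: "\<And>x y. x \<in> B \<Longrightarrow> y \<in> B \<Longrightarrow> x \<noteq> y \<Longrightarrow> c x y \<noteq> q"
  shows "card B + card Oth \<le> n * 2 ^ (k - 1)"
proof -
  have cK: "card (K - {q}) = k - 1" using pq rK bK finK cardK by auto
  have disj: "B \<inter> Oth = {}" using B by (auto simp: Oth_def)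
  then have W: "(B \<union> Oth) - B = Oth" by blast
  have "card (B \<union> Oth) \<le> n * 2 ^ card (K - {q})"
  proof (rule attachment_bound[OF _ good, of "K - {q}" "B \<union> Oth" B lab p])
    show "gallai_cycle_bound n (card (K - {q}))" using bound1 cK by simp
    show "B \<union> Oth \<subseteq> V" using B AV UOth by blast
    show "c x y \<in> K - {q}" if "x \<in> B" "y \<in> B" "x \<noteq> y" for x y
      using inK[of x y] free[of x y] that B AV by blast
    show "c v a = lab v" if "v \<in> B \<union> Oth - B" "a \<in> B" for v a
      using lab[of v a] that B by (auto simp: Oth_def)
    show "lab v \<in> K - {q} - {p}" if "v \<in> B \<union> Oth - B" for v
      using labK[of v] that B pq by (auto simp: Oth_def)
    show "card {v \<in> B \<union> Oth - B. lab v = i} \<le> 2 * n" for i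
    proof -
      have "card {v \<in> B \<union> Oth - B. lab v = i} \<le> card {v \<in> V - A. lab v = i}"
        using finV by (intro card_mono) (auto simp: Oth_def)
      then show ?thesis using labn[of i] by linarith
    qed
    show "2 * n + card (B \<union> Oth - B) \<le> n * 2 ^ card (K - {q})"
    proof -
      have "2 * n + (k - 2) * n = k * n" using k by (simp add: diff_mult_distrib)
      then show ?thesis unfolding W cK using card_Oth powers(4) by linarith
    qed
    show "p \<in> K - {q}" using pq rK bK by auto
  qed (use finK in auto)
  moreover have "card (B \<union> Oth) = card B + card Oth"
    using disj finite_subsets B AV UOth by (intro card_Un_disjoint) auto
  ultimately show ?thesis using cK by simp
qed

text \<open>Here \<open>p\<close> is the only label and a third colour is the spare one. The limit
  \<open>2 n\<close> on \<open>D\<close> is that of \<open>recolour_attachments\<close>.\<close>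

lemma attach_one:
  assumes B: "B \<subseteq> V" "D \<subseteq> V" "B \<inter> D = {}" and pq: "p \<in> {r, b}" "q \<in> {r, b}" "p \<noteq> q"
    and free: "\<And>x y. x \<in> B \<Longrightarrow> y \<in> B \<Longrightarrow> x \<noteq> y \<Longrightarrow> c x y \<noteq> q"
    and D: "\<And>x y. x \<in> D \<Longrightarrow> y \<in> B \<Longrightarrow> c x y = p" "card D \<le> 2 * n"
  shows "card B + card D \<le> n * 2 ^ (k - 1)"
proof -
  obtain i0 where i0: "i0 \<in> K" "i0 \<noteq> r" "i0 \<noteq> b" using third_colour .
  have cK: "card (K - {q}) = k - 1" using pq rK bK finK cardK by auto
  have W: "(B \<union> D) - B = D" using B by blast
  have "card (B \<union> D) \<le> n * 2 ^ card (K - {q})"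
  proof (rule attachment_bound[OF _ good, of "K - {q}" "B \<union> D" B "\<lambda>_. p" i0])
    show "gallai_cycle_bound n (card (K - {q}))" using bound1 cK by simp
    show "c x y \<in> K - {q}" if "x \<in> B" "y \<in> B" "x \<noteq> y" for x y
      using inK[of x y] free[of x y] that B by blast
    show "card {v \<in> B \<union> D - B. p = i} \<le> 2 * n" for i
    proof -
      have "card {v \<in> B \<union> D - B. p = i} \<le> card D"
        using finite_subsets[OF B(2)] by (intro card_mono) auto
      then show ?thesis using D(2) by linarith
    qed
    show "2 * n + card (B \<union> D - B) \<le> n * 2 ^ card (K - {q})"
      unfolding W cK using D(2) powers(5) by linarith
  qed (use finK B D i0 pq rK bK in auto)
  moreover have "card (B \<union> D) = card B + card D"
    using finite_subsets B by (intro card_Un_disjoint) auto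
  ultimately show ?thesis using cK by simp
qed

lemma free_bound:
  assumes "B \<subseteq> V" "q \<in> {r, b}" "\<And>x y. x \<in> B \<Longrightarrow> y \<in> B \<Longrightarrow> x \<noteq> y \<Longrightarrow> c x y \<noteq> q"
  shows "card B \<le> n * 2 ^ (k - 1)"
proof -
  have "good_colouring (2 * n + 1) (K - {q}) c B"
    by (rule good_colouring_subset[OF good assms(1)]) (use finK inK assms in auto)
  moreover have "card (K - {q}) = k - 1" using assms(2) rK bK finK cardK by auto
  ultimately show ?thesis using bound1 unfolding gallai_cycle_bound_def by blast
qed

lemma free_bound_two:
  assumes "B \<subseteq> V" "\<And>x y. x \<in> B \<Longrightarrow> y \<in> B \<Longrightarrow> x \<noteq> y \<Longrightarrow> c x y \<noteq> r"
    "\<And>x y. x \<in> B \<Longrightarrow> y \<in> B \<Longrightarrow> x \<noteq> y \<Longrightarrow> c x y \<noteq> b"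
  shows "card B \<le> n * 2 ^ (k - 2)"
proof -
  have "good_colouring (2 * n + 1) (K - {r, b}) c B"
    by (rule good_colouring_subset[OF good assms(1)]) (use finK inK assms in auto)
  moreover have "card (K - {r, b}) = k - 2" using rK bK rb finK cardK by (simp add: card_Diff_subset numeral_2_eq_2)
  ultimately show ?thesis using bound2 unfolding gallai_cycle_bound_def by blast
qed

section \<open>Two parts with more than \<open>n\<close> vertices\<close>

definition attached :: "nat \<Rightarrow> nat \<Rightarrow> nat \<Rightarrow> nat \<Rightarrow> nat set" where
  "attached s t p q = {v \<in> U. v \<notin> part s \<and> v \<notin> part t \<and> (\<forall>x\<in>part s. c v x = p) \<and> (\<forall>x\<in>part t. c v x = q)}"

lemma attached_swap: "attached s t p q = attached t s q p"
  by (auto simp: attached_def)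

lemma attached_disjoint:
  assumes "x \<in> part s" "y \<in> part t" "p \<noteq> p' \<or> q \<noteq> q'"
  shows "attached s t p q \<inter> attached s t p' q' = {}"
proof (rule ccontr)
  assume "\<not> ?thesis"
  then obtain v where "v \<in> attached s t p q" "v \<in> attached s t p' q'" by blast
  then have "c v x = p" "c v x = p'" "c v y = q" "c v y = q'"
    using assms(1,2) unfolding attached_def by blast+
  then show False using assms(3) by simp
qed

text \<open>A vertex blue to both parts would be an apex. A vertex outside \<open>A\<close> has one
  label and cannot see the parts differently. \<open>part t\<close> and the vertices of type
  \<open>b r\<close> are all blue to \<open>part s\<close>, so together they contain no blue
  edge.\<close>

lemma two_parts:
  assumes st: "s \<noteq> t" and big: "n + 1 \<le> card (part s)" "n + 1 \<le> card (part t)"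
    and blue: "\<And>x y. x \<in> part s \<Longrightarrow> y \<in> part t \<Longrightarrow> c x y = b"
  shows "attached s t b b = {}" "attached s t r b \<subseteq> A" "attached s t b r \<subseteq> A"
    and "U = part s \<union> part t \<union> attached s t r r \<union> attached s t r b \<union> attached s t b r"
    and "card V = card (part s) + card (part t) + card (attached s t r r) + card (attached s t r b) + card (attached s t b r) + card Oth"
    and "x \<in> part s \<Longrightarrow> y \<in> part s \<Longrightarrow> x \<noteq> y \<Longrightarrow> c x y \<noteq> b"
    and "x \<in> part t \<union> attached s t b r \<Longrightarrow> y \<in> part t \<union> attached s t b r \<Longrightarrow> x \<noteq> y \<Longrightarrow> c x y \<noteq> b"
proof -
  let ?X = "attached s t r r" and ?Y = "attached s t r b" and ?Z = "attached s t b r"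
  have PV: "part s \<subseteq> V" "part t \<subseteq> V" using AV UOth by blast+
  have disj: "part s \<inter> part t = {}" using st by (auto simp: part_def)
  have ne: "part s \<noteq> {}" "part t \<noteq> {}" using big by auto
  then obtain xs xt where x: "xs \<in> part s" "xt \<in> part t" by blast
  show bb: "attached s t b b = {}"
  proof (rule ccontr)
    assume "attached s t b b \<noteq> {}"
    then obtain v where v: "v \<in> U" "v \<notin> part s" "v \<notin> part t" "c v xs = b" "c v xt = b" using x by (auto simp: attached_def)
    show False
      by (rule no_apex[OF PV disj blue _ _ _ v(2,3) x v(4,5)]) (use big v(1) UOth in auto)
  qed
  have diff: "attached s t p q \<subseteq> A" if "p \<noteq> q" for p q
  proof
    fix v assume v: "v \<in> attached s t p q"
    show "v \<in> A"
    proof (rule ccontr)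
      assume "v \<notin> A"
      then have vV: "v \<in> V - A" using v UOth(3) by (auto simp: attached_def)
      have "xs \<in> A" "xt \<in> A" using x by (auto simp: part_def)
      then have "c v xs = lab v" "c v xt = lab v" using lab[OF vV] by blast+
      then show False using v x that by (auto simp: attached_def)
    qed
  qed
  show "?Y \<subseteq> A" "?Z \<subseteq> A" using diff rb by auto
  have "v \<in> part s \<union> part t \<union> ?X \<union> ?Y \<union> ?Z" if v: "v \<in> U" for v
  proof (cases "v \<in> part s \<or> v \<in> part t")
    case False
    moreover have "v \<notin> attached s t b b" using bb by simp
    ultimately show ?thesis
      using to_part[OF v, of s] to_part[OF v, of t] v unfolding attached_def by blast
  qed auto
  then have "U \<subseteq> part s \<union> part t \<union> ?X \<union> ?Y \<union> ?Z" by blast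
  moreover have "attached s t p q \<subseteq> U" for p q by (auto simp: attached_def)
  moreover have "part s \<subseteq> U" "part t \<subseteq> U" using UOth(4,6) by blast+
  ultimately show U: "U = part s \<union> part t \<union> ?X \<union> ?Y \<union> ?Z"
    by (simp add: subset_antisym)
  have tdisj: "?X \<inter> ?Y = {}" "?X \<inter> ?Z = {}" "?Y \<inter> ?Z = {}"
    by (rule attached_disjoint[OF x], use rb in simp)+
  have sub: "attached s t p q \<subseteq> U" for p q by (auto simp: attached_def)
  have tp: "part s \<inter> attached s t p q = {}" "part t \<inter> attached s t p q = {}" "Oth \<inter> attached s t p q = {}" for p q
    using UOth(2) sub[of p q] by (auto simp: attached_def)
  have fin: "finite (part s)" "finite (part t)" "finite Oth" "finite (attached s t p q)" for p q
    using finite_subsets[OF PV(1)] finite_subsets[OF PV(2)] finite_subsets[OF UOth(5)]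
      finite_subset[OF sub[of p q] finite_subsets[OF UOth(3)]] by auto
  have "card V = card U + card Oth" using UOth(1,2) finite_subsets[OF UOth(3)] fin(3) by (metis card_Un_disjoint)
  also have "card U = card (part s) + card (part t) + card (?X) + card (?Y) + card (?Z)"
    using U fin disj tdisj tp by (simp add: card_Un_disjoint Int_Un_distrib2)
  finally show "card V = card (part s) + card (part t) + card (?X) + card (?Y) + card (?Z) + card Oth" .
  show "c x y \<noteq> b" if "x \<in> part s" "y \<in> part s" "x \<noteq> y" for x y
    using no_edge[OF PV disj blue _ _ that] big by simp
  show "c x y \<noteq> b" if xy: "x \<in> part t \<union> ?Z" "y \<in> part t \<union> ?Z" "x \<noteq> y" for x y
  proof (rule no_edge[OF _ PV(1) _ _ _ _ xy])
    show "part t \<union> ?Z \<subseteq> V" using PV UOth by (auto simp: attached_def)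
    show "(part t \<union> ?Z) \<inter> part s = {}" using disj tp by blast
    show "c u v = b" if "u \<in> part t \<union> ?Z" "v \<in> part s" for u v
      using that blue[of v u] sym by (auto simp: attached_def)
    show "n + 1 \<le> card (part t \<union> ?Z)"
      using big(2) card_mono[of "part t \<union> ?Z" "part t"] fin by (meson finite_UnI le_trans sup_ge1)
  qed (use big in simp)
qed

text \<open>Otherwise the vertices red to \<open>part s\<close> can be counted with it by
  \<open>attach_one\<close>, and the rest of \<open>U\<close> with \<open>Oth\<close> by
  \<open>attach_other\<close>. Each half has at most \<open>n * 2 ^ (k - 1)\<close> vertices, too
  few for \<open>V\<close>.\<close>

lemma two_parts_few:
  assumes st: "s \<noteq> t" and big: "n + 1 \<le> card (part s)" "n + 1 \<le> card (part t)"
    and blue: "\<And>x y. x \<in> part s \<Longrightarrow> y \<in> part t \<Longrightarrow> c x y = b"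
  shows "2 * n + 1 \<le> card (attached s t r r \<union> attached s t r b)"
proof (rule ccontr)
  let ?X = "attached s t r r" and ?Y = "attached s t r b" and ?Z = "attached s t b r"
  assume "\<not> ?thesis"
  then have small: "card (?X \<union> ?Y) \<le> 2 * n" by simp
  note tp = two_parts[OF st big blue]
  have ne: "part t \<noteq> {}" using big by auto
  have fin: "finite (attached s t p q)" for p q
    using UOth finite_subsets[of "attached s t p q"] by (auto simp: attached_def)
  have 1: "card (part s) + card (?X \<union> ?Y) \<le> n * 2 ^ (k - 1)"
  proof (rule attach_one[where p = r and q = b])
    show "c x y = r" if "x \<in> ?X \<union> ?Y" "y \<in> part s" for x y
      using that by (auto simp: attached_def)
    show "c x y \<noteq> b" if "x \<in> part s" "y \<in> part s" "x \<noteq> y" for x y using tp(6) that by blast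
    show "part s \<subseteq> V" by (rule partV)
    show "?X \<union> ?Y \<subseteq> V" using UOth(3) by (auto simp: attached_def)
  qed (use rb small in \<open>auto simp: attached_def\<close>)
  have 2: "card (part t \<union> ?Z) + card Oth \<le> n * 2 ^ (k - 1)"
  proof (rule attach_other[where p = r and q = b])
    show "c x y \<noteq> b" if "x \<in> part t \<union> ?Z" "y \<in> part t \<union> ?Z" "x \<noteq> y" for x y
      using tp(7) that by blast
    show "part t \<union> ?Z \<subseteq> A" using tp(3) UOth(6) by blast
  qed (use rb in auto)
  have "card (part t \<union> ?Z) = card (part t) + card (?Z)"
    using fin finite_subsets[OF partV] by (intro card_Un_disjoint) (auto simp: attached_def)
  moreover have "card (?X \<union> ?Y) = card (?X) + card (?Y)"
  proof (rule card_Un_disjoint[OF fin fin])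
    obtain x y where "x \<in> part s" "y \<in> part t" using big by fastforce
    then show "?X \<inter> ?Y = {}" using attached_disjoint rb by blast
  qed
  moreover have "n * 2 ^ k = n * 2 ^ (k - 1) + n * 2 ^ (k - 1)" using powers(1) by simp
  ultimately show False using 1 2 tp(5) large by linarith
qed

text \<open>By \<open>two_parts_few\<close> the vertices red to either part are numerous, so neither
  they nor the parts contain red edges. Counting then shows that all three types \<open>r r\<close>,
  \<open>r b\<close>, \<open>b r\<close> occur, and one vertex of each forms a blue detour between
  the two parts.\<close>

lemma two_large_parts:
  assumes st: "s \<noteq> t" and big: "n + 1 \<le> card (part s)" "n + 1 \<le> card (part t)"
    and blue: "\<And>x y. x \<in> part s \<Longrightarrow> y \<in> part t \<Longrightarrow> c x y = b"
  shows False
proof -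
  let ?X = "attached s t r r" and ?Y = "attached s t r b" and ?Z = "attached s t b r"
  note tp = two_parts[OF st big blue]
  have blue': "c x y = b" if "x \<in> part t" "y \<in> part s" for x y using blue[OF that(2,1)] sym by metis
  have ne: "part s \<noteq> {}" "part t \<noteq> {}" using big by auto
  have PV: "part s \<subseteq> V" "part t \<subseteq> V" using AV UOth by blast+
  have TV: "attached s t p q \<subseteq> V" for p q using UOth by (auto simp: attached_def)
  have XY: "2 * n + 1 \<le> card (?X \<union> ?Y)" using two_parts_few[OF st big blue] .
  have XZ: "2 * n + 1 \<le> card (?X \<union> ?Z)"
    using two_parts_few[OF st[symmetric] big(2,1) blue'] attached_swap by metis
  have redXY: "c x y \<noteq> r" if "x \<in> ?X \<union> ?Y" "y \<in> ?X \<union> ?Y" "x \<noteq> y" for x y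
    by (rule no_edge[OF _ PV(1) _ _ _ _ that]) (use TV XY big in \<open>auto simp: attached_def\<close>)
  have redXZ: "c x y \<noteq> r" if "x \<in> ?X \<union> ?Z" "y \<in> ?X \<union> ?Z" "x \<noteq> y" for x y
    by (rule no_edge[OF _ PV(2) _ _ _ _ that]) (use TV XZ big in \<open>auto simp: attached_def\<close>)
  have reds: "c x y \<noteq> r" if "x \<in> part s" "y \<in> part s" "x \<noteq> y" for x y
    by (rule no_edge[OF PV(1) _ _ _ _ _ that, of "?X \<union> ?Y"]) (use TV XY big sym in \<open>auto simp: attached_def\<close>)
  have redt: "c x y \<noteq> r" if "x \<in> part t" "y \<in> part t" "x \<noteq> y" for x y
    by (rule no_edge[OF PV(2) _ _ _ _ _ that, of "?X \<union> ?Z"]) (use TV XZ big sym in \<open>auto simp: attached_def\<close>)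
  have 1: "card (part s \<union> part t) + card Oth \<le> n * 2 ^ (k - 1)"
  proof (rule attach_other[where p = b and q = r])
    show "c x y \<noteq> r" if "x \<in> part s \<union> part t" "y \<in> part s \<union> part t" "x \<noteq> y" for x y
      using that reds redt blue blue' rb by (metis UnE)
    show "part s \<union> part t \<subseteq> A" using UOth(6) by blast
  qed (use rb in auto)
  have "card (part s \<union> part t) = card (part s) + card (part t)"
    using st finite_subsets[OF PV(1)] finite_subsets[OF PV(2)] by (intro card_Un_disjoint) (auto simp: part_def)
  moreover have kk: "n * 2 ^ k = n * 2 ^ (k - 1) + n * 2 ^ (k - 1)" using powers(1) by simp
  ultimately have 2: "n * 2 ^ (k - 1) < card ?X + card ?Y + card ?Z"
    using 1 tp(5) large by linarith
  have finT: "finite (attached s t p q)" for p q using finite_subsets[OF TV] .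
  obtain xs xt where x: "xs \<in> part s" "xt \<in> part t" using ne by blast
  have cXY: "card (?X \<union> ?Y) = card ?X + card ?Y"
    using rb by (intro card_Un_disjoint[OF finT finT] attached_disjoint[OF x]) simp
  have cXZ: "card (?X \<union> ?Z) = card ?X + card ?Z"
    using rb by (intro card_Un_disjoint[OF finT finT] attached_disjoint[OF x]) simp
  have "card (?X \<union> ?Y) \<le> n * 2 ^ (k - 1)" using free_bound[of "?X \<union> ?Y" r] TV redXY by blast
  then have "?Z \<noteq> {}" using 2 cXY by auto
  have "card (?X \<union> ?Z) \<le> n * 2 ^ (k - 1)" using free_bound[of "?X \<union> ?Z" r] TV redXZ by blast
  then have "?Y \<noteq> {}" using 2 cXZ by auto
  have "card ?Z \<le> n * 2 ^ (k - 2)"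
    by (rule free_bound_two) (use TV redXZ tp(7) in blast)+
  moreover have "card ?Y \<le> n * 2 ^ (k - 2)"
    by (rule free_bound_two) (use TV redXY two_parts(7)[OF st[symmetric] big(2,1) blue'] attached_swap in blast)+
  ultimately have "?X \<noteq> {}" using 2 powers(2) by auto
  then obtain w v u where wvu: "w \<in> ?X" "v \<in> ?Y" "u \<in> ?Z" using \<open>?Y \<noteq> {}\<close> \<open>?Z \<noteq> {}\<close> by blast
  have cols: "c w xs = r" "c w xt = r" "c v xs = r" "c v xt = b" "c u xs = b" "c u xt = r"
    using wvu x by (auto simp: attached_def)
  have xA: "xs \<in> A" "xt \<in> A" using x by (auto simp: part_def)
  \<comment> \<open>If \<open>w\<close> is in \<open>A\<close>, then \<open>z\<close> sees
    \<open>part s\<close> or \<open>part t\<close> differently from \<open>w\<close>, so they lie in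
    different parts and a third colour is excluded. Outside \<open>A\<close>, the label of
    \<open>w\<close> is red or blue.\<close>
  have toX: "c w z \<in> {r, b}" if z: "z \<in> A" "z \<in> U" and zz: "c z xs \<noteq> r \<and> z \<notin> part s \<or> c z xt \<noteq> r \<and> z \<notin> part t" for z
  proof (cases "w \<in> A")
    case False
    then have "w \<in> V - A" "lab w \<in> {r, b}" using wvu(1) by (auto simp: attached_def U_def)
    then show ?thesis using lab[of w z] z by simp
  next
    case True
    have "f w \<noteq> f z"
    proof
      assume eq: "f w = f z"
      have "f w \<noteq> f xs" "f w \<noteq> f xt" using True wvu(1) x by (auto simp: attached_def part_def)
      then have "c w xs = c z xs" "c w xt = c z xt" using unif[OF True z(1) _ eq] xA by auto
      then show False using zz cols by auto
    qed
    then show ?thesis using cross[OF True z(1)] by blast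
  qed
  have vA: "v \<in> A" "v \<in> U" "u \<in> A" "u \<in> U" using wvu tp(2,3) by (auto simp: attached_def)
  have npart: "v \<notin> part s" "v \<notin> part t" "u \<notin> part s" "u \<notin> part t" "w \<notin> part s" "w \<notin> part t"
    using wvu by (auto simp: attached_def)
  have neq: "w \<noteq> v" "w \<noteq> u" "v \<noteq> u" using cols rb by metis+
  have wv: "c w v = b" using toX[OF vA(1,2)] cols npart rb redXY[of w v] wvu neq by auto
  have wu: "c w u = b" using toX[OF vA(3,4)] cols npart rb redXZ[of w u] wvu neq by auto
  have "has_cycle (\<lambda>x y. c x y = b) ({v, w, u} \<union> (part s \<union> part t)) (2 * n + 1)"
  proof (rule bipartite_detour_cycle[of "part s" "part t" _ xs xt n v w u])
    show "finite (part s)" "finite (part t)" using finite_subsets PV by blast+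
    show "part s \<inter> part t = {}" using st by (auto simp: part_def)
    show "c x y = b \<and> c y x = b" if "x \<in> part s" "y \<in> part t" for x y
      using blue[OF that] blue'[OF that(2,1)] by simp
    show "distinct [v, w, u]" using neq by simp
    show "{v, w, u} \<inter> (part s \<union> part t) = {}" using npart by blast
    show "c v w = b" "c w u = b" "c u xs = b" "c xt v = b"
      using wv wu cols(4,5) sym[of v w] sym[of xt v] by simp_all
  qed (use x n6 big in linarith | fact x)+
  moreover have "{v, w, u} \<union> (part s \<union> part t) \<subseteq> V" using PV TV wvu by blast
  ultimately have "has_cycle (\<lambda>x y. c x y = b) V (2 * n + 1)"
    by (rule has_cycle_mono) auto
  then show False using nocyc by blast
qed

section \<open>Exactly one part with more than \<open>n\<close> vertices\<close>

text \<open>With both sides of the blue bipartite graph above \<open>n\<close>, neither contains a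
  blue edge. So \<open>B\<close> is red between parts, and more than \<open>2 n\<close> vertices
  would give a red cycle by \<open>multipartite_cycle\<close>.\<close>

lemma one_side:
  assumes big: "n + 1 \<le> card (part t)" and others: "\<And>s. s \<noteq> t \<Longrightarrow> card (part s) \<le> n"
    and B: "B = {v \<in> U. v \<notin> part t \<and> (\<forall>x\<in>part t. c v x = b)}" "n + 1 \<le> card B"
  shows "card B \<le> 2 * n" "x \<in> part t \<Longrightarrow> y \<in> part t \<Longrightarrow> x \<noteq> y \<Longrightarrow> c x y \<noteq> b"
proof -
  have PV: "part t \<subseteq> V" "B \<subseteq> V" using AV UOth B by blast+
  have finB: "finite B" using finite_subsets PV by blast
  have ne: "part t \<noteq> {}" using big by auto
  show "c x y \<noteq> b" if "x \<in> part t" "y \<in> part t" "x \<noteq> y" for x y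
    by (rule no_edge[OF PV _ _ _ _ that]) (use B big sym in auto)
  have freeB: "c x y \<noteq> b" if "x \<in> B" "y \<in> B" "x \<noteq> y" for x y
    by (rule no_edge[OF PV(2,1) _ _ _ _ that]) (use B big in auto)
  \<comment> \<open>At most \<open>n\<close> vertices have label \<open>b\<close>, so
    \<open>B\<close> meets \<open>A\<close>; a vertex of \<open>B\<close> outside \<open>A\<close>
    would be joined in blue to that vertex.\<close>
  have BA: "B \<subseteq> A"
  proof (rule ccontr)
    assume "\<not> B \<subseteq> A"
    then obtain v where v: "v \<in> B" "v \<notin> A" by blast
    then have vV: "v \<in> V - A" using PV by blast
    obtain x where x: "x \<in> part t" using ne by blast
    have "lab v = b" using lab[OF vV, of x] x v(1) B(1) UOth(6) by auto
    have "\<not> B \<subseteq> {v \<in> V - A. lab v = b}"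
    proof
      assume "B \<subseteq> {v \<in> V - A. lab v = b}"
      then have "card B \<le> card {v \<in> V - A. lab v = b}" using finV by (intro card_mono) auto
      then show False using labn[of b] B(2) by simp
    qed
    then obtain w where w: "w \<in> B" "w \<notin> V - A \<or> lab w \<noteq> b" by blast
    have "w \<in> A"
    proof (rule ccontr)
      assume "w \<notin> A"
      then have wV: "w \<in> V - A" using w(1) PV by blast
      have "lab w = b" using lab[OF wV, of x] x w(1) B(1) UOth(6) by auto
      then show False using w(2) wV by blast
    qed
    then have "c v w = b" using lab[OF vV] \<open>lab v = b\<close> by simp
    then show False using freeB[OF v(1) w(1)] v(2) \<open>w \<in> A\<close> by blast
  qed
  show "card B \<le> 2 * n"
  proof (rule ccontr)
    assume "\<not> ?thesis"
    then have "has_cycle (\<lambda>x y. c x y = r) B (2 * n + 1)"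
    proof (intro multipartite_cycle[of B n f])
      show "c x y = r" if "x \<in> B" "y \<in> B" "f x \<noteq> f y" for x y
        using cross[of x y] freeB[of x y] that BA by blast
      show "card {x \<in> B. f x = a} \<le> n" for a
      proof (cases "a = t")
        case True
        then have "{x \<in> B. f x = a} = {}" using B BA by (auto simp: part_def)
        then show ?thesis by (metis card.empty le0)
      next
        case False
        have "{x \<in> B. f x = a} \<subseteq> part a" using BA by (auto simp: part_def)
        moreover have "finite (part a)" using finite_subsets AV UOth(6) by blast
        ultimately show ?thesis using others[OF False] card_mono le_trans by blast
      qed
    qed (use finB n6 in auto)
    then have "has_cycle (\<lambda>x y. c x y = r) V (2 * n + 1)"
      by (rule has_cycle_mono) (use PV in auto)
    then show False using nocyc by blast
  qed
qed

text \<open>If the red side is large too, both sides have at most \<open>2 n\<close> vertices, and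
  \<open>part t\<close> is counted with \<open>Oth\<close>. If not, \<open>part t\<close> is counted
  with the red side, and the blue side with \<open>Oth\<close> has at most \<open>k * n\<close>
  vertices.\<close>

lemma one_large_blue:
  assumes big: "n + 1 \<le> card (part t)" and others: "\<And>s. s \<noteq> t \<Longrightarrow> card (part s) \<le> n"
    and B: "B = {v \<in> U. v \<notin> part t \<and> (\<forall>x\<in>part t. c v x = b)}" "n + 1 \<le> card B"
    and R: "R = {v \<in> U. v \<notin> part t \<and> (\<forall>x\<in>part t. c v x = r)}"
  shows False
proof -
  have PV: "part t \<subseteq> V" "B \<subseteq> V" "R \<subseteq> V" using AV UOth B R by blast+
  have ne: "part t \<noteq> {}" using big by auto
  note side = one_side[OF big others B]
  have fin: "finite (part t)" "finite B" "finite R" "finite Oth" using finite_subsets PV UOth by auto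
  obtain x where x: "x \<in> part t" using ne by blast
  have "V \<subseteq> part t \<union> B \<union> R \<union> Oth"
  proof
    fix v assume "v \<in> V"
    then consider "v \<in> Oth" | "v \<in> part t" | "v \<in> U" "v \<notin> part t" using UOth(1) by blast
    then show "v \<in> part t \<union> B \<union> R \<union> Oth"
    proof cases
      case 3
      then show ?thesis using to_part[OF 3] unfolding B(1) R by blast
    qed auto
  qed
  then have V: "V = part t \<union> B \<union> R \<union> Oth" using PV UOth(5) by blast
  have "part t \<inter> B = {}" "part t \<inter> R = {}" using B(1) R by auto
  moreover have "B \<inter> R = {}"
  proof (rule ccontr)
    assume "B \<inter> R \<noteq> {}"
    then obtain v where "v \<in> B" "v \<in> R" by blast
    then have "c v x = b" "c v x = r" using x unfolding B(1) R by blast+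
    then show False using rb by simp
  qed
  moreover have "B \<inter> Oth = {}" "R \<inter> Oth = {}" "part t \<inter> Oth = {}"
    using UOth(2) UOth(4) UOth(6)[of t] unfolding B(1) R by blast+
  ultimately have "card (part t \<union> B \<union> R \<union> Oth) = card (part t) + card B + card R + card Oth"
    using fin by (simp add: card_Un_disjoint Int_Un_distrib2)
  then have cV: "card V = card (part t) + card B + card R + card Oth" using V by metis
  have kk: "n * 2 ^ k = n * 2 ^ (k - 1) + n * 2 ^ (k - 1)" using powers(1) by simp
  show False
  proof (cases "n + 1 \<le> card R")
    case True
    have "card R \<le> 2 * n"
      using gallai_core.one_side(1)[OF swapped, unfolded U_swapped, of t R] big others R True by blast
    moreover have "card (part t) + card Oth \<le> n * 2 ^ (k - 1)"
      by (rule attach_other[where p = r and q = b]) (use UOth(6) rb side(2) in auto)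
    ultimately show False using cV side(1) large kk powers(5) by linarith
  next
    case False
    have "card (part t) + card R \<le> n * 2 ^ (k - 1)"
      by (rule attach_one[where p = r and q = b]) (use PV rb side(2) R False in auto)
    moreover have "card B + card Oth \<le> k * n"
    proof -
      have "2 * n + (k - 2) * n = k * n" using k by (simp add: diff_mult_distrib)
      then show ?thesis using side(1) card_Oth by linarith
    qed
    ultimately show False using cV large kk powers(4) by linarith
  qed
qed

text \<open>Once both sides have at most \<open>n\<close> vertices, \<open>part t\<close> is a
  proper submodule of \<open>A\<close> to which each colour attaches at most \<open>n\<close>
  vertices, against minimality.\<close>

lemma one_large_part:
  assumes big: "n + 1 \<le> card (part t)" and others: "\<And>s. s \<noteq> t \<Longrightarrow> card (part s) \<le> n"
    and proper: "part t \<noteq> A"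
  shows False
proof -
  define B where "B = {v \<in> U. v \<notin> part t \<and> (\<forall>x\<in>part t. c v x = b)}"
  define R where "R = {v \<in> U. v \<notin> part t \<and> (\<forall>x\<in>part t. c v x = r)}"
  have ne: "part t \<noteq> {}" using big by auto
  then obtain x where x: "x \<in> part t" by blast
  have B: "card B \<le> n"
  proof (rule ccontr)
    assume "\<not> card B \<le> n"
    then have "n + 1 \<le> card B" by simp
    then show False using one_large_blue[of t B R] big others B_def R_def by blast
  qed
  have R: "card R \<le> n"
  proof (rule ccontr)
    assume "\<not> card R \<le> n"
    then have "n + 1 \<le> card R" by simp
    then show False
      using gallai_core.one_large_blue[OF swapped, unfolded U_swapped, of t R B] big others B_def R_def
      by blast
  qed
  have PV: "part t \<subseteq> V" using AV UOth by blast
  define lab' where "lab' v = c v x" for v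
  have "\<exists>i. n < card {v \<in> V - part t. lab' v = i}"
  proof (rule minimal)
    show "part t \<subset> A" using proper UOth(6) by blast
    show "c v a = lab' v" if "v \<in> V - part t" "a \<in> part t" for v a
    proof (cases "v \<in> U")
      case True
      then show ?thesis using to_part[OF True, of t] that x by (auto simp: lab'_def)
    next
      case False
      then have "v \<in> V - A" using that UOth(4) by blast
      then show ?thesis using lab[of v] that(2) x UOth(6) by (metis lab'_def subsetD)
    qed
  qed (use ne in auto)
  then obtain i where i: "n < card {v \<in> V - part t. lab' v = i}" by blast
  have labx: "lab' v = lab v" if "v \<in> V - A" for v using lab[OF that, of x] x UOth(6) by (auto simp: lab'_def)
  let ?D = "if i = b then B else if i = r then R else {v \<in> V - A. lab v = i}"
  have "{v \<in> V - part t. lab' v = i} \<subseteq> ?D"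
  proof
    fix v assume "v \<in> {v \<in> V - part t. lab' v = i}"
    then have v: "v \<in> V" "v \<notin> part t" "c v x = i" "lab' v = i" by (auto simp: lab'_def)
    show "v \<in> ?D"
    proof (cases "v \<in> U")
      case True
      then show ?thesis using to_part[OF True v(2)] v x rb by (auto simp: B_def R_def)
    next
      case False
      then have "v \<in> V - A" "lab v \<notin> {r, b}" using v(1) by (auto simp: U_def)
      then show ?thesis using labx[of v] v by auto
    qed
  qed
  moreover have "finite ?D"
    using finV finite_subsets UOth(3) by (auto simp: B_def R_def intro: finite_subset[OF _ finite_subsets[OF UOth(3)]])
  ultimately have "card {v \<in> V - part t. lab' v = i} \<le> card ?D"
    by (rule card_mono[rotated])
  also have "\<dots> \<le> n" using B R labn[of i] by auto
  finally show False using i by simp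
qed

section \<open>All parts have at most \<open>n\<close> vertices\<close>

text \<open>The parts and the two sets attached in red and blue are the classes of a two-coloured
  complete multipartite graph on \<open>U\<close>.\<close>

lemma no_large_part:
  assumes small: "\<And>s. card (part s) \<le> n"
  shows False
proof -
  obtain i0 where i0: "i0 \<in> K" "i0 \<noteq> r" "i0 \<noteq> b" using third_colour .
  have "n * 2 ^ k + 1 \<le> card U + (k - 2) * n"
  proof -
    have "card V = card U + card Oth" using UOth(1,2) finite_subsets UOth(3,5) by (metis card_Un_disjoint)
    then show ?thesis using large card_Oth by linarith
  qed
  moreover have "(k - 2) * n + 7 * n \<le> n * 2 ^ k"
  proof -
    \<comment> \<open>Equality holds at \<open>k = 3\<close>.\<close>
    have "k - 2 + 7 \<le> 2 ^ k"
      using k by (induction k rule: dec_induct) auto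
    then have "n * (k - 2 + 7) \<le> n * 2 ^ k" by (rule mult_le_mono2)
    then show ?thesis by (simp add: algebra_simps)
  qed
  ultimately have bigU: "7 * n + 1 \<le> card U" by linarith
  have UA: "v \<in> V - A" "lab v \<in> {r, b}" if "v \<in> U - A" for v using that by (auto simp: U_def)
  have finU: "finite U" using finite_subsets UOth(3) by blast
  have bigA: "2 * n + 1 \<le> card A"
  proof -
    let ?X = "\<lambda>i. {v \<in> V - A. lab v = i}"
    have "U \<subseteq> A \<union> (?X r \<union> ?X b)" by (auto simp: U_def)
    then have "card U \<le> card (A \<union> (?X r \<union> ?X b))"
      using finV finite_subsets[OF AV] by (intro card_mono) auto
    also have "\<dots> \<le> card A + card (?X r \<union> ?X b)" by (rule card_Un_le)
    also have "card (?X r \<union> ?X b) \<le> card (?X r) + card (?X b)"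
      by (rule card_Un_le)
    finally show ?thesis using labn[of r] labn[of b] bigU n6 by linarith
  qed
  have gA: "gallai_on c A" using gallai AV unfolding gallai_on_def by blast
  have labU: "c v a = lab v" if "v \<in> U - A" "a \<in> A" for v a using lab UA that by blast
  have ne: "lab v \<noteq> i0" if "v \<in> U - A" for v using UA[OF that] i0 by auto
  have labs: "card {v \<in> U - A. lab v = i} \<le> n" for i
  proof -
    have "card {v \<in> U - A. lab v = i} \<le> card {v \<in> V - A. lab v = i}"
      using finV UOth(3) by (intro card_mono) auto
    then show ?thesis using labn[of i] by linarith
  qed
  have labs2: "card {v \<in> U - A. lab v = i} \<le> 2 * n" for i using labs[of i] by linarith
  have nocycU: "\<not> has_cycle (\<lambda>x y. c x y = i) U (2 * n + 1)" for i
    using nocyc[of i] has_cycle_mono[of "\<lambda>x y. c x y = i" U "2 * n + 1" V "\<lambda>x y. c x y = i"] UOth(3) by auto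
  \<comment> \<open>The labels in \<open>U\<close> are only \<open>r\<close> and \<open>b\<close>,
    so recolouring makes all edges between the two attached sets red or blue.\<close>
  obtain c' where c': "\<And>x y. c' x y = c' y x" "gallai_on c' U"
    "\<And>i. \<not> has_cycle (\<lambda>x y. c' x y = i) U (2 * n + 1)"
    "\<And>x y. x \<in> A \<Longrightarrow> y \<in> A \<Longrightarrow> c' x y = c x y"
    "\<And>x y. x \<in> U - A \<Longrightarrow> y \<in> A \<Longrightarrow> c' x y = lab x"
    "\<And>x y. x \<in> U - A \<Longrightarrow> y \<in> U - A \<Longrightarrow> c' x y = (if lab x = lab y then i0 else max (lab x) (lab y))"
    by (rule recolour_attachments[OF finU UOth(4) sym gA labU ne labs2 bigA nocycU]) (assumption | rule that)+
  \<comment> \<open>The values \<open>0\<close> and \<open>1\<close> are kept for the attached sets,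
    hence the shift by two on \<open>A\<close>.\<close>
  define f' where "f' x = (if x \<in> A then f x + 2 else if lab x = r then 0 else 1)" for x
  have c'2: "c' x y = lab y" if "x \<in> A" "y \<in> U - A" for x y using c'(5)[OF that(2,1)] c'(1) by metis
  have f'eq: "(x \<in> A \<and> y \<in> A \<and> f x = f y) \<or> (x \<in> U - A \<and> y \<in> U - A \<and> lab x = lab y)"
    if "x \<in> U" "y \<in> U" "f' x = f' y" for x y
    using that UA[of x] UA[of y] rb by (auto simp: f'_def split: if_splits)
  have f'ne: "(x \<in> A \<and> y \<in> A \<and> f x \<noteq> f y) \<or> (x \<in> U - A \<and> y \<in> A) \<or> (x \<in> A \<and> y \<in> U - A)
       \<or> (x \<in> U - A \<and> y \<in> U - A \<and> lab x \<noteq> lab y)"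
    if "x \<in> U" "y \<in> U" "f' x \<noteq> f' y" for x y
    using that by (auto simp: f'_def split: if_splits)
  have comp: "c' x y \<in> {r, b}" if "x \<in> U" "y \<in> U" "f' x \<noteq> f' y" for x y
    using f'ne[OF that] cross[of x y] c'(4,5,6)[of x y] c'2[of x y] UA[of x] UA[of y] by (auto simp: max_def)
  have twin: "c' x y = c' x' y" if "x \<in> U" "x' \<in> U" "y \<in> U" "f' x = f' x'" "f' x \<noteq> f' y" for x x' y
  proof -
    have ne': "f' x' \<noteq> f' y" using that by simp
    show ?thesis
      using f'eq[OF that(1,2,4)] f'ne[OF that(1,3,5)] f'ne[OF that(2,3) ne'] unif[of x x' y]
        c'(4,5,6)[of x y] c'(4,5,6)[of x' y] c'2[of x y] c'2[of x' y]
      by auto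
  qed
  have "two_colour_multipartite U f' (\<lambda>x y. f' x \<noteq> f' y \<and> c' x y = r) (\<lambda>x y. f' x \<noteq> f' y \<and> c' x y = b) n"
  proof
    show "(f' x \<noteq> f' y \<and> c' x y = r) \<or> (f' x \<noteq> f' y \<and> c' x y = b)" if "x \<in> U" "y \<in> U" "f' x \<noteq> f' y" for x y
      using comp[OF that] that by blast
    show "f' x' \<noteq> f' y \<and> c' x' y = r" if "x \<in> U" "x' \<in> U" "y \<in> U" "f' x = f' x'" "f' x \<noteq> f' y \<and> c' x y = r" for x x' y
      using twin[OF that(1-4)] that by metis
    show "f' x' \<noteq> f' y \<and> c' x' y = b" if "x \<in> U" "x' \<in> U" "y \<in> U" "f' x = f' x'" "f' x \<noteq> f' y \<and> c' x y = b" for x x' y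
      using twin[OF that(1-4)] that by metis
    show "card {x \<in> U. f' x = a} \<le> n" for a
    proof (cases "2 \<le> a")
      case True
      then have "{x \<in> U. f' x = a} \<subseteq> part (a - 2)" by (auto simp: f'_def part_def split: if_splits)
      moreover have "finite (part (a - 2))" using finite_subsets AV UOth(6) by blast
      ultimately show ?thesis using small card_mono le_trans by blast
    next
      case False
      then have "{x \<in> U. f' x = a} \<subseteq> {v \<in> U - A. lab v = (if a = 0 then r else b)}"
        using UA by (auto simp: f'_def split: if_splits)
      then have "card {x \<in> U. f' x = a} \<le> card {v \<in> U - A. lab v = (if a = 0 then r else b)}"
        using finU by (intro card_mono) auto
      then show ?thesis using labs le_trans by blast
    qed
  qed (use finU c'(1) in auto)
  then have "has_cycle (\<lambda>x y. f' x \<noteq> f' y \<and> c' x y = r) U (2 * n + 1) \<or> has_cycle (\<lambda>x y. f' x \<noteq> f' y \<and> c' x y = b) U (2 * n + 1)"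
    using two_colour_multipartite_odd_cycle[OF _ n bigU] by blast
  then have "\<exists>i. has_cycle (\<lambda>x y. c' x y = i) U (2 * n + 1)"
    using has_cycle_conjD[of _ _ U "2 * n + 1"] by fastforce
  then show False using c'(3) by blast
qed

lemma contradiction:
  assumes "\<exists>x\<in>A. \<exists>y\<in>A. f x \<noteq> f y"
  shows False
proof -
  have "card (part s) \<le> n" for s
  proof (rule ccontr)
    assume "\<not> card (part s) \<le> n"
    then have s: "n + 1 \<le> card (part s)" by simp
    have "part s \<noteq> A"
    proof
      assume "part s = A"
      then have "f x = s" if "x \<in> A" for x using that unfolding part_def by blast
      then show False using assms by metis
    qed
    then obtain t where t: "t \<noteq> s" "\<not> card (part t) \<le> n" using one_large_part[OF s] by blast
    then have t': "n + 1 \<le> card (part t)" by simp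
    then have "part t \<noteq> {}" "part s \<noteq> {}" using s by auto
    then obtain x y where xy: "x \<in> part s" "y \<in> part t" by blast
    have same: "c x' y' = c x y" if "x' \<in> part s" "y' \<in> part t" for x' y'
    proof -
      have "c x' y' = c x y'" using unif[of x' x y'] that xy t(1) by (auto simp: part_def)
      also have "\<dots> = c y' x" by (rule sym)
      also have "\<dots> = c y x" using unif[of y' y x] that xy t(1) by (auto simp: part_def)
      finally show ?thesis using sym by metis
    qed
    have "c x y \<in> {r, b}" using cross[of x y] xy t(1) by (auto simp: part_def)
    then show False
    proof
      assume "c x y = r"
      then show False
        using gallai_core.two_large_parts[OF swapped, of s t] t s t' same by simp
    next
      assume "c x y \<in> {b}"
      then show False using two_large_parts[of s t] t s t' same by simp
    qed
  qed
  then show False using no_large_part by blast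
qed

end

section \<open>The Gallai-Ramsey number\<close>

lemma gallai_cycle_bound_one: "1 \<le> n \<Longrightarrow> gallai_cycle_bound n 1"
  unfolding gallai_cycle_bound_def
proof (intro allI impI, rule ccontr)
  fix V :: "nat set" and c K
  assume n: "1 \<le> n" and good: "good_colouring (2 * n + 1) K c V" and K: "card K = 1" and large: "\<not> card V \<le> n * 2 ^ 1"
  obtain i where i: "K = {i}" using K by (auto simp: card_1_singleton_iff)
  have "2 * n + 1 \<le> card V" using large by simp
  then obtain W where W: "W \<subseteq> V" "card W = 2 * n + 1" "finite W" by (metis obtain_subset_with_card_n)
  obtain xs where xs: "set xs = W" "distinct xs" using finite_distinct_list[OF W(3)] by blast
  have len: "length xs = 2 * n + 1" using xs W(2) by (metis distinct_card)
  have col: "c x y = i" if "x \<in> W" "y \<in> W" "x \<noteq> y" for x y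
    using good that W(1) i unfolding good_colouring_def by blast
  have "sorted_wrt (\<lambda>x y. x \<noteq> y) xs" using xs(2) by (simp add: distinct_conv_nth sorted_wrt_iff_nth_less)
  then have "successively (\<lambda>x y. x \<noteq> y) xs" by (rule successively_if_sorted_wrt)
  then have "successively (\<lambda>x y. c x y = i) xs"
    by (rule successively_mono) (use col xs(1) in blast)
  moreover have "c (last xs) (hd xs) = i"
  proof -
    have ne: "xs \<noteq> []" using len by auto
    have "xs ! (2 * n) \<noteq> xs ! 0" using xs(2) len n by (simp add: nth_eq_iff_index_eq)
    then have "last xs \<noteq> hd xs" using ne len by (simp add: last_conv_nth hd_conv_nth)
    then show ?thesis using ne xs(1) by (intro col) auto
  qed
  ultimately have "has_cycle (\<lambda>x y. c x y = i) V (2 * n + 1)"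
    using xs W(1) len by (intro has_cycleI[of xs]) auto
  then show False using good unfolding good_colouring_def by blast
qed

lemma gallai_cycle_bound_two: "3 \<le> n \<Longrightarrow> gallai_cycle_bound n 2"
  unfolding gallai_cycle_bound_def
proof (intro allI impI, rule ccontr)
  fix V :: "nat set" and c K
  assume n: "3 \<le> n" and good: "good_colouring (2 * n + 1) K c V" and K: "card K = 2" and large: "\<not> card V \<le> n * 2 ^ 2"
  obtain r b where rb: "K = {r, b}" using K by (auto simp: card_2_iff)
  have sym: "c x y = c y x" for x y using good by (simp add: good_colouring_def)
  have "two_colour_complete V (\<lambda>x y. x \<noteq> y \<and> c x y = r) (\<lambda>x y. x \<noteq> y \<and> c x y = b)"
  proof
    show "(x \<noteq> y \<and> c x y = r) \<or> (x \<noteq> y \<and> c x y = b)" if "x \<in> V" "y \<in> V" "x \<noteq> y" for x y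
      using that good rb unfolding good_colouring_def by blast
  qed (use sym in auto)
  then have "has_cycle (\<lambda>x y. x \<noteq> y \<and> c x y = r) V (2 * n + 1) \<or> has_cycle (\<lambda>x y. x \<noteq> y \<and> c x y = b) V (2 * n + 1)"
    using n large good by (intro two_colour_odd_cycle) (auto simp: good_colouring_def)
  then have "\<exists>i. has_cycle (\<lambda>x y. c x y = i) V (2 * n + 1)"
    using has_cycle_conjD[of _ _ V "2 * n + 1"] by fastforce
  then show False using good unfolding good_colouring_def by blast
qed

lemma gallai_cycle_bound_step:
  assumes n: "n \<in> {6, 7}" and k: "3 \<le> k"
    and bounds: "gallai_cycle_bound n (k - 1)" "gallai_cycle_bound n (k - 2)"
  shows "gallai_cycle_bound n k"
  unfolding gallai_cycle_bound_def
proof (intro allI impI, rule ccontr)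
  fix V :: "nat set" and c K
  assume good: "good_colouring (2 * n + 1) K c V" and K: "card K = k" and large: "\<not> card V \<le> n * 2 ^ k"
  have finV: "finite V" and finK: "finite K" and sym: "\<And>x y. c x y = c y x" and gV: "gallai_on c V"
    and inK: "\<And>x y. x \<in> V \<Longrightarrow> y \<in> V \<Longrightarrow> x \<noteq> y \<Longrightarrow> c x y \<in> K"
    using good by (auto simp: good_colouring_def)
  \<comment> \<open>\<open>V\<close> itself satisfies \<open>Q\<close>, having nothing outside, so a
    smallest \<open>A\<close> exists.\<close>
  define Q where "Q A lab \<longleftrightarrow> A \<subseteq> V \<and> A \<noteq> {} \<and> (\<forall>v\<in>V - A. \<forall>a\<in>A. c v a = lab v) \<and>
    (\<forall>i. card {v \<in> V - A. lab v = i} \<le> n)" for A and lab :: "nat \<Rightarrow> nat"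
  have "V \<noteq> {}" using large by auto
  then have "Q V (\<lambda>_. 0)" by (simp add: Q_def)
  then have ex: "\<exists>m. \<exists>A lab. Q A lab \<and> card A = m" by blast
  define m where "m = (LEAST m. \<exists>A lab. Q A lab \<and> card A = m)"
  have "\<exists>A lab. Q A lab \<and> card A = m" unfolding m_def by (rule LeastI_ex[OF ex])
  then obtain A lab where Q: "Q A lab" and cA: "card A = m" by blast
  have least: "card A \<le> card A'" if "Q A' lab'" for A' lab'
    unfolding cA m_def by (rule Least_le) (use that in blast)
  have A: "A \<subseteq> V" "A \<noteq> {}" "\<And>v a. v \<in> V - A \<Longrightarrow> a \<in> A \<Longrightarrow> c v a = lab v"
    "\<And>i. card {v \<in> V - A. lab v = i} \<le> n"
    using Q by (auto simp: Q_def)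
  obtain a where a: "a \<in> A" using A(2) by blast
  have labK: "lab v \<in> K" if "v \<in> V - A" for v
  proof -
    have "c v a \<in> K" by (rule inK) (use that a A(1) in auto)
    then show ?thesis using A(3)[OF that a] by simp
  qed
  have finA: "finite A" using finite_subset[OF A(1) finV] .
  \<comment> \<open>At most \<open>k * n\<close> vertices are attached and
    \<open>(k + 1) * n \<le> n * 2 ^ k\<close>, so more than \<open>n\<close> remain in
    \<open>A\<close>.\<close>
  have card2: "2 \<le> card A"
  proof -
    have "V - A \<subseteq> (\<Union>i\<in>K. {v \<in> V - A. lab v = i})" using labK by auto
    then have "card (V - A) \<le> card (\<Union>i\<in>K. {v \<in> V - A. lab v = i})"
      using finV finK by (intro card_mono) auto
    also have "\<dots> \<le> (\<Sum>i\<in>K. card {v \<in> V - A. lab v = i})" using finK by (intro card_UN_le) auto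
    also have "\<dots> \<le> (\<Sum>i\<in>K. n)" using A(4) by (intro sum_mono) auto
    finally have "card (V - A) \<le> k * n" using K by simp
    then have "card V \<le> k * n + card A" using A(1) finA by (simp add: card_Diff_subset)
    moreover have "(k + 1) * n \<le> 2 ^ k * n"
    proof (rule mult_le_mono1)
      have "k < 2 ^ k" by (rule less_exp)
      then show "k + 1 \<le> 2 ^ k" by linarith
    qed
    ultimately show ?thesis using large n by (auto simp: algebra_simps)
  qed
  have gA: "gallai_on c A" using gV A(1) unfolding gallai_on_def by blast
  obtain f r0 b0 where f0: "(\<exists>x\<in>A. \<exists>y\<in>A. f x \<noteq> (f y :: nat)) \<and>
     (\<forall>x\<in>A. \<forall>y\<in>A. f x \<noteq> f y \<longrightarrow> c x y \<in> {r0, b0}) \<and>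
     (\<forall>x\<in>A. \<forall>x'\<in>A. \<forall>y\<in>A. f x = f x' \<longrightarrow> f x \<noteq> f y \<longrightarrow> c x y = c x' y)"
    using gallai_partition[OF finA sym gA card2] by (elim exE) (rule that)
  note f = f0[THEN conjunct1] f0[THEN conjunct2, THEN conjunct1, rule_format]
      f0[THEN conjunct2, THEN conjunct2, rule_format]
  obtain x y where xy: "x \<in> A" "y \<in> A" "f x \<noteq> f y" using f(1) by blast
  have crossK: "c x y \<in> K" if "x \<in> A" "y \<in> A" "f x \<noteq> f y" for x y
    by (rule inK) (use that A(1) in auto)
  \<comment> \<open>The partition may return equal colours or one outside \<open>K\<close>. A
    crossing edge puts one of them in \<open>K\<close>, and \<open>K\<close> has another colour to
    complete the pair.\<close>
  have "\<exists>r b. r \<in> K \<and> b \<in> K \<and> r \<noteq> b \<and> {r0, b0} \<inter> K \<subseteq> {r, b}"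
  proof -
    have d: "c x y \<in> K" "c x y \<in> {r0, b0}" using crossK[OF xy] f(2)[OF xy] by auto
    have "\<not> K \<subseteq> {c x y}"
    proof
      assume "K \<subseteq> {c x y}"
      then have "card K \<le> card {c x y}" by (intro card_mono) auto
      then show False using K k by simp
    qed
    then obtain e where e: "e \<in> K" "e \<noteq> c x y" by blast
    show ?thesis
    proof (cases "r0 \<in> K \<and> b0 \<in> K \<and> r0 \<noteq> b0")
      case True
      then show ?thesis by blast
    next
      case False
      then have "{r0, b0} \<inter> K \<subseteq> {c x y}" using d by blast
      then show ?thesis using d(1) e by blast
    qed
  qed
  then obtain r b where rb: "r \<in> K" "b \<in> K" "r \<noteq> b" "{r0, b0} \<inter> K \<subseteq> {r, b}" by blast
  interpret gallai_core n k K c V A lab f r b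
  proof
    show "c x y \<in> {r, b}" if "x \<in> A" "y \<in> A" "f x \<noteq> f y" for x y
      using crossK[OF that] f(2)[OF that] rb(4) by blast
    show "\<exists>i. n < card {v \<in> V - A'. lab' v = i}"
      if A': "A' \<subset> A" "A' \<noteq> {}" "\<And>v a. v \<in> V - A' \<Longrightarrow> a \<in> A' \<Longrightarrow> c v a = lab' v" for A' lab'
    proof (rule ccontr)
      assume "\<not> ?thesis"
      then have "Q A' lab'" using A' A(1) by (auto simp: Q_def not_less)
      then have "card A \<le> card A'" by (rule least)
      then show False using psubset_card_mono[OF finA A'(1)] by simp
    qed
    show "n * 2 ^ k < card V" using large by simp
  qed (fact n k K bounds good A labK rb f(3))+
  show False using contradiction[OF f(1)] .
qed

theorem gallai_cycle_bound:
  assumes "n \<in> {6, 7}" "1 \<le> k"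
  shows "gallai_cycle_bound n k"
  using assms(2)
proof (induction k rule: less_induct)
  case (less k)
  consider "k = 1" | "k = 2" | "3 \<le> k" using less.prems by linarith
  then show ?case
  proof cases
    case 3
    then show ?thesis using gallai_cycle_bound_step[OF assms(1) 3] less.IH[of "k - 1"] less.IH[of "k - 2"] by auto
  qed (use assms(1) gallai_cycle_bound_one gallai_cycle_bound_two in auto)
qed

section \<open>Transfer to the graph copies and colourings of the definition\<close>

lemma edge_complete_graph: "{x, y} \<in> edges (complete_graph N) \<longleftrightarrow> x < N \<and> y < N \<and> x \<noteq> y"
  by (auto simp: complete_graph_def nsets_def card_insert_if)

lemma monochromatic_cycle_copy:
  assumes "has_cycle (\<lambda>x y. c {x, y} = i) {..<N} m" "3 \<le> m"
  shows "has_monochromatic_copy N c (cycle_graph m)"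
proof -
  obtain x where x: "periodic_cycle (\<lambda>x y. c {x, y} = i) x m" "range x \<subseteq> {..<N}"
    using has_cycle_periodic[OF assms(1)] assms(2) by auto
  have inj: "x a = x b \<longleftrightarrow> a = b" if "a < m" "b < m" for a b
    using periodic_cycle_eq_iff[OF x(1), of a b] that assms(2) by simp
  have xmod: "x (Suc j mod m) = x (Suc j)" for j
    using periodic_cycle_eq_iff[OF x(1)] assms(2) by simp
  define S where "S = \<lparr>verts = x ` {..<m}, edges = {{x j, x (Suc j mod m)} | j. j < m}\<rparr>"
  have ne: "j \<noteq> Suc j mod m" if "j < m" for j using that assms(2) by (cases "Suc j = m") auto
  have lt: "Suc j mod m < m" for j using assms(2) by simp
  have "edges S \<subseteq> [verts S]\<^bsup>2\<^esup>"
  proof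
    fix e assume "e \<in> edges S"
    then obtain j where j: "j < m" "e = {x j, x (Suc j mod m)}" by (auto simp: S_def)
    then have "x j \<noteq> x (Suc j mod m)" using inj[OF j(1) lt] ne by blast
    then show "e \<in> [verts S]\<^bsup>2\<^esup>" using j lt by (auto simp: S_def nsets_def)
  qed
  moreover have V: "verts S \<subseteq> {..<N}" "finite (verts S)" using x(2) by (auto simp: S_def)
  ultimately have "subgraph S (complete_graph N)"
    using nsets_mono[OF V(1), of 2] by (auto simp: subgraph_def simple_graph_def complete_graph_def)
  moreover have "graph_iso (cycle_graph m) S"
    unfolding graph_iso_def
  proof (intro exI[of _ x] conjI ballI)
    show "bij_betw x (verts (cycle_graph m)) (verts S)"
      using inj by (auto simp: bij_betw_def inj_on_def cycle_graph_def S_def)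
    fix a b assume "a \<in> verts (cycle_graph m)" "b \<in> verts (cycle_graph m)"
    then have ab: "a < m" "b < m" by (auto simp: cycle_graph_def)
    have "{x a, x b} = {x j, x (Suc j mod m)} \<longleftrightarrow> {a, b} = {j, Suc j mod m}" if "j < m" for j
      using inj[OF ab(1) that] inj[OF ab(2) that] inj[OF ab(1) lt] inj[OF ab(2) lt]
      by (simp add: doubleton_eq_iff)
    then show "{a, b} \<in> edges (cycle_graph m) \<longleftrightarrow> {x a, x b} \<in> edges S"
      by (auto simp: cycle_graph_def S_def)
  qed
  moreover have "c e = i" if "e \<in> edges S" for e
    using that x(1) by (auto simp: S_def xmod periodic_cycle_def)
  ultimately show ?thesis unfolding has_monochromatic_copy_def by blast
qed

lemma large_gallai_coloring_has_copy:
  assumes n: "n \<in> {6, 7}" and "1 \<le> k" and c: "gallai_coloring k N c" and N: "n * 2 ^ k < N"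
  shows "has_monochromatic_copy N c (cycle_graph (2 * n + 1))"
proof (rule ccontr)
  assume neg: "\<not> ?thesis"
  have no: "\<not> has_cycle (\<lambda>x y. c {x, y} = i) {..<N} (2 * n + 1)" for i
    using neg monochromatic_cycle_copy[of c i N "2 * n + 1"] n by auto
  have tri: "c {x, y} = c {y, z} \<or> c {y, z} = c {x, z} \<or> c {x, y} = c {x, z}"
    if "x < N" "y < N" "z < N" "x \<noteq> y" "y \<noteq> z" "x \<noteq> z" for x y z
  proof -
    have "\<not> rainbow_triangle N c x y z" using c by (simp add: gallai_coloring_def)
    then show ?thesis using that by (simp add: rainbow_triangle_def edge_complete_graph)
  qed
  have "good_colouring (2 * n + 1) {1..k} (\<lambda>x y. c {x, y}) {..<N}"
    unfolding good_colouring_def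
  proof (intro conjI allI ballI impI no)
    show "c {x, y} = c {y, x}" for x y by (simp add: insert_commute)
    show "gallai_on (\<lambda>x y. c {x, y}) {..<N}"
      unfolding gallai_on_def
    proof (intro ballI impI)
      fix x y z assume "x \<in> {..<N}" "y \<in> {..<N}" "z \<in> {..<N}" "distinct [x, y, z]"
      then show "c {x, y} = c {y, z} \<or> c {y, z} = c {x, z} \<or> c {x, y} = c {x, z}"
        by (intro tri) auto
    qed
    fix x y assume "x \<in> {..<N}" "y \<in> {..<N}" "x \<noteq> y"
    then have "{x, y} \<in> edges (complete_graph N)" by (simp add: edge_complete_graph)
    then show "c {x, y} \<in> {1..k}" using c by (auto simp: gallai_coloring_def)
  qed auto
  then have "card {..<N} \<le> n * 2 ^ k"
    using gallai_cycle_bound[OF n assms(2)] unfolding gallai_cycle_bound_def by fastforce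
  then show False using N by simp
qed

text \<open>Blocks of \<open>2 n\<close> consecutive numbers, repeatedly merged in pairs: an edge receives the
  number of the round in which its ends are first in the same block.\<close>

definition block :: "nat \<Rightarrow> nat \<Rightarrow> nat \<Rightarrow> nat" where
  "block n j x = x div (n * 2 ^ Suc j)"

definition merge_coloring :: "nat \<Rightarrow> nat set \<Rightarrow> nat" where
  "merge_coloring n e = Suc (LEAST j. \<forall>x\<in>e. \<forall>y\<in>e. block n j x = block n j y)"

lemma block_Suc: "block n (Suc j) x = block n j x div 2"
  by (simp add: block_def div_mult2_eq[symmetric] mult.commute mult.left_commute)

lemma block_eq_mono: "j \<le> j' \<Longrightarrow> block n j x = block n j y \<Longrightarrow> block n j' x = block n j' y"
  by (induction rule: dec_induct) (auto simp: block_Suc)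

lemma block_top: "x < n * 2 ^ k \<Longrightarrow> 1 \<le> k \<Longrightarrow> block n (k - 1) x = 0"
  by (simp add: block_def)

text \<open>Blocks are nested, so vertices once merged stay merged, and after round
  \<open>k - 1\<close> a single block contains all numbers below \<open>n * 2 ^ k\<close>; hence the
  least round exists.\<close>

lemma merge_coloring_le_iff:
  assumes "x < n * 2 ^ k" "y < n * 2 ^ k" "1 \<le> k"
  shows "merge_coloring n {x, y} \<le> Suc j \<longleftrightarrow> block n j x = block n j y"
proof -
  have eq: "(\<forall>u\<in>{x, y}. \<forall>v\<in>{x, y}. block n j u = block n j v) \<longleftrightarrow> block n j x = block n j y" for j
    by auto
  have "block n (k - 1) x = block n (k - 1) y" using assms block_top by simp
  define l where "l = (LEAST j. block n j x = block n j y)"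
  have l: "block n l x = block n l y"
    unfolding l_def by (rule LeastI[of _ "k - 1"]) fact
  have "merge_coloring n {x, y} = Suc l" unfolding merge_coloring_def eq l_def ..
  moreover have "l \<le> j" if "block n j x = block n j y" using that unfolding l_def by (rule Least_le)
  moreover have "block n j x = block n j y" if "l \<le> j" using block_eq_mono[OF that l] .
  ultimately show ?thesis by auto
qed

text \<open>The colours form an ultrametric: the two largest colours of a triangle coincide.\<close>

lemma merge_coloring_gallai:
  assumes "N \<le> n * 2 ^ k" "1 \<le> k"
  shows "gallai_coloring k N (merge_coloring n)"
proof -
  have "merge_coloring n e \<in> {1..k}" if eE: "e \<in> edges (complete_graph N)" for e
  proof -
    obtain x y where e: "e = {x, y}" using eE by (auto simp: complete_graph_def nsets_def card_2_iff)
    then have "x < n * 2 ^ k" "y < n * 2 ^ k" using eE assms(1) by (auto simp: edge_complete_graph)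
    then have "merge_coloring n {x, y} \<le> Suc (k - 1)"
      using merge_coloring_le_iff[of x n k y "k - 1"] block_top assms(2) by simp
    then show ?thesis using assms(2) by (simp add: e merge_coloring_def)
  qed
  moreover have "\<not> rainbow_triangle N (merge_coloring n) x y z" for x y z
  proof
    assume t: "rainbow_triangle N (merge_coloring n) x y z"
    then have lt: "x < n * 2 ^ k" "y < n * 2 ^ k" "z < n * 2 ^ k"
      using assms(1) by (auto simp: rainbow_triangle_def edge_complete_graph)
    have ultra: "merge_coloring n {u, w} \<le> max (merge_coloring n {u, v}) (merge_coloring n {v, w})"
      if "u < n * 2 ^ k" "v < n * 2 ^ k" "w < n * 2 ^ k" for u v w
    proof -
      define j where "j = max (merge_coloring n {u, v}) (merge_coloring n {v, w}) - 1"
      have "1 \<le> merge_coloring n {u, v}" by (simp add: merge_coloring_def)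
      then have j: "max (merge_coloring n {u, v}) (merge_coloring n {v, w}) = Suc j"
        unfolding j_def by linarith
      then have "merge_coloring n {u, v} \<le> Suc j" "merge_coloring n {v, w} \<le> Suc j" by linarith+
      then have "block n j u = block n j w"
        using merge_coloring_le_iff[OF that(1,2) assms(2)] merge_coloring_le_iff[OF that(2,3) assms(2)] by simp
      then have "merge_coloring n {u, w} \<le> Suc j"
        using merge_coloring_le_iff[OF that(1,3) assms(2)] by simp
      then show ?thesis using j by simp
    qed
    have "merge_coloring n {x, z} \<le> max (merge_coloring n {x, y}) (merge_coloring n {y, z})"
      "merge_coloring n {x, y} \<le> max (merge_coloring n {x, z}) (merge_coloring n {y, z})"
      "merge_coloring n {y, z} \<le> max (merge_coloring n {x, y}) (merge_coloring n {x, z})"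
      using ultra[OF lt] ultra[OF lt(1,3,2)] ultra[OF lt(2,1,3)] by (simp_all add: insert_commute)
    moreover have "merge_coloring n {x, y} \<noteq> merge_coloring n {y, z}"
      "merge_coloring n {y, z} \<noteq> merge_coloring n {x, z}" "merge_coloring n {x, y} \<noteq> merge_coloring n {x, z}"
      using t by (auto simp: rainbow_triangle_def)
    ultimately show False by linarith
  qed
  ultimately show ?thesis by (auto simp: gallai_coloring_def)
qed

text \<open>A cycle of colour \<open>1\<close> would lie in one block of \<open>2 n\<close> numbers.
  In a later colour, each edge joins the two halves of a block, so the parity of the preceding block
  index alternates, which an odd cycle cannot do.\<close>

lemma merge_coloring_no_copy:
  assumes N: "N \<le> n * 2 ^ k" "1 \<le> k" "1 \<le> n"
  shows "\<not> has_monochromatic_copy N (merge_coloring n) (cycle_graph (2 * n + 1))"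
proof
  let ?m = "2 * n + 1"
  assume "has_monochromatic_copy N (merge_coloring n) (cycle_graph ?m)"
  then obtain S i where S: "subgraph S (complete_graph N)" "graph_iso (cycle_graph ?m) S"
    "\<forall>e\<in>edges S. merge_coloring n e = i" unfolding has_monochromatic_copy_def by blast
  obtain g where g: "bij_betw g {..<?m} (verts S)"
    "\<And>x y. x < ?m \<Longrightarrow> y < ?m \<Longrightarrow> {x, y} \<in> edges (cycle_graph ?m) \<longleftrightarrow> {g x, g y} \<in> edges S"
    using S(2) by (auto simp: graph_iso_def cycle_graph_def)
  have inj: "inj_on g {..<?m}" using g(1) by (simp add: bij_betw_def)
  have gN: "g j < n * 2 ^ k" if "j < ?m" for j
  proof -
    have "g j \<in> verts S" using g(1) that by (auto simp: bij_betw_def)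
    then show ?thesis using S(1) N(1) by (auto simp: subgraph_def complete_graph_def)
  qed
  have edge: "merge_coloring n {g j, g (Suc j mod ?m)} = i" if j: "j < ?m" for j
  proof -
    have "{j, Suc j mod ?m} \<in> edges (cycle_graph ?m)" using j by (auto simp: cycle_graph_def)
    moreover have "Suc j mod ?m < ?m" by simp
    ultimately have "{g j, g (Suc j mod ?m)} \<in> edges S" using g(2) j by blast
    then show ?thesis using S(3) by blast
  qed
  obtain l where l: "i = Suc l" using edge[of 0] by (auto simp: merge_coloring_def)
  have same: "block n l (g j) = block n l (g (Suc j mod ?m))" if "j < ?m" for j
    using merge_coloring_le_iff[OF gN[OF that] gN N(2), of "Suc j mod ?m" l] edge[OF that] l by simp
  show False
  proof (cases l)
    case 0
    have const: "block n 0 (g j) = block n 0 (g 0)" if "j < ?m" for j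
      using that
    proof (induction j)
      case (Suc j)
      then show ?case using same[of j] 0 by simp
    qed simp
    define q where "q = block n 0 (g 0)"
    have "g ` {..<?m} \<subseteq> {q * (2 * n)..<q * (2 * n) + 2 * n}"
    proof
      fix v assume "v \<in> g ` {..<?m}"
      then obtain j where "j < ?m" "v = g j" by auto
      then have "v div (2 * n) = q" using const[of j] by (simp add: q_def block_def mult.commute)
      moreover have "v mod (2 * n) < 2 * n" using N(3) by simp
      moreover have "v = v div (2 * n) * (2 * n) + v mod (2 * n)" by (simp only: div_mult_mod_eq)
      ultimately have "v = q * (2 * n) + v mod (2 * n)" by metis
      then show "v \<in> {q * (2 * n)..<q * (2 * n) + 2 * n}" using \<open>v mod (2 * n) < 2 * n\<close> by (metis
            add_less_cancel_left atLeastLessThan_iff le_add1)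
    qed
    then have "card (g ` {..<?m}) \<le> card {q * (2 * n)..<q * (2 * n) + 2 * n}" by (intro card_mono) auto
    then show False using inj by (simp add: card_image)
  next
    case (Suc l')
    have flip: "even (block n l' (g j)) \<longleftrightarrow> odd (block n l' (g (Suc j mod ?m)))" if j: "j < ?m" for j
    proof -
      have "block n l' (g j) \<noteq> block n l' (g (Suc j mod ?m))"
        using merge_coloring_le_iff[OF gN[OF j] gN N(2), of "Suc j mod ?m" l'] edge[OF j] l Suc by simp
      moreover have "block n l' (g j) div 2 = block n l' (g (Suc j mod ?m)) div 2"
        using same[OF j] Suc by (simp add: block_Suc)
      ultimately show ?thesis by presburger
    qed
    have par: "even (block n l' (g j)) \<longleftrightarrow> (even (block n l' (g 0)) \<longleftrightarrow> even j)" if "j < ?m" for j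
      using that
    proof (induction j)
      case (Suc j)
      then show ?case using flip[of j] by simp blast
    qed simp
    show False using flip[of "2 * n"] par[of "2 * n"] by simp
  qed
qed

theorem theorem1p10:
  fixes n k :: nat
  assumes "n \<in> {6, 7}" and "k \<ge> 1"
  shows "GR k (cycle_graph (2 * n + 1)) = n * 2 ^ k + 1"
  unfolding gallai_ramsey_number_def
proof (rule Least_equality)
  show "0 < n * 2 ^ k + 1 \<and> (\<forall>c. gallai_coloring k (n * 2 ^ k + 1) c \<longrightarrow>
      has_monochromatic_copy (n * 2 ^ k + 1) c (cycle_graph (2 * n + 1)))"
    using large_gallai_coloring_has_copy[OF assms] by simp
  fix N assume N: "0 < N \<and> (\<forall>c. gallai_coloring k N c \<longrightarrow> has_monochromatic_copy N c (cycle_graph (2 * n + 1)))"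
  show "n * 2 ^ k + 1 \<le> N"
  proof (rule ccontr)
    assume "\<not> n * 2 ^ k + 1 \<le> N"
    then have "N \<le> n * 2 ^ k" by simp
    moreover have "1 \<le> n" using assms(1) by auto
    ultimately show False
      using N merge_coloring_gallai[of N n k] merge_coloring_no_copy[of N n k] assms(2) by blast
  qed
qed

end
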